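(* The Fibonacci anyons form a tight braided bimonoidal category $\mathcal F^{\mathrm{any}}$, with additive structure the direct sum and multiplicative structure given by the fusion rule, associativity isomorphism and braiding described in the context.
   Context: Fibonacci anyons. $\mathcal F^{\mathrm{any}}$ is the abelian category with objects pairs $(m;n)$ of nonnegative integers and morphisms $(m;n)\to(m';n')$ pairs of complex linear maps $\mathbb C^m\to\mathbb C^{m'}$, $\mathbb C^n\to\mathbb C^{n'}$. Put $0=(0;0)$, $\mathbb 1=(1;0)$ (vacuum), $\tau=(0;1)$ (non-abelian anyon); the additive structure is the direct sum $\oplus$. The product $\otimes$ is $\mathbb C$-bilinear on morphisms, preserves direct sums in each variable (the distributivity isomorphisms and multiplicative zeros being the canonical ones of the additive structure), and is determined by the fusion rule: $\mathbb 1$ is the unit and $\tau\otimes\tau=\mathbb 1\oplus\tau$. Let $q=(\sqrt5-1)/2$ be the reciprocal of the golden ratio and $z=e^{3\pi i/5}$. On simple objects the associativity isomorphism is the identity except for $(\tau\otimes\tau)\otimes\tau\to\tau\otimes(\tau\otimes\tau)$, which is the identity on the $\mathbb 1$-component and, on the two-dimensional $\tau$-component, with bases given by the two channels $\mathbb 1,\tau\subset\tau\otimes\tau$ (in this order), is the matrix $\begin{pmatrix}q&\sqrt q\\ \sqrt q&-q\end{pmatrix}$. The braiding is the identity on simple objects when one of them is $\mathbb 1$, and $\tau\otimes\tau\to\tau\otimes\tau$ is multiplication by $z^2$ on the $\mathbb 1$-component and by $z$ on the $\tau$-component. Both are extended to all objects by naturality and additivity. Write $AB$ for $A\otimes B$;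 $\otimes$ binds tighter than $\oplus$. A bimonoidal category is a category $C$ with a symmetric monoidal structure $(\oplus,0,\alpha^\oplus,\lambda^\oplus,\rho^\oplus,\zeta^\oplus)$, a monoidal structure $(\otimes,1,\alpha^\otimes,\lambda^\otimes,\rho^\otimes)$ (with $\alpha_{A,B,C}:(AB)C\to A(BC)$, $\lambda_A$, $\rho_A$ the left/right unit isomorphisms), natural isomorphisms $\lambda^\bullet_A:0A\to0$, $\rho^\bullet_A:A0\to 0$, and natural monomorphisms $\delta^l_{A,B,C}:A(B\oplus C)\to AB\oplus AC$, $\delta^r_{A,B,C}:(A\oplus B)C\to AC\oplus BC$, such that for all objects: $\delta^l_{A,C,B}(1\otimes\zeta^\oplus_{B,C})=\zeta^\oplus_{AB,AC}\delta^l_{A,B,C}$; $\delta^r_{B,A,C}(\zeta^\oplus_{A,B}\otimes1)=\zeta^\oplus_{AC,BC}\delta^r_{A,B,C}$; $\alpha^\oplus(\delta^r_{A,B,D}\oplus1)\delta^r_{A\oplus B,C,D}=(1\oplus\delta^r_{B,C,D})\delta^r_{A,B\oplus C,D}(\alpha^\oplus_{A,B,C}\otimes1)$; $\alpha^\oplus(\delta^l_{A,B,C}\oplus1)\delta^l_{A,B\oplus C,D}=(1\oplus\delta^l_{A,C,D})\delta^l_{A,B,C\oplus D}(1\otimes\alpha^\oplus_{B,C,D})$; $\delta^l_{A,BC,BD}(1\otimes\delta^l_{B,C,D})\alpha^\otimes_{A,B,C\oplus D}=(\alpha^\otimes_{A,B,C}\oplus\alpha^\otimes_{A,B,D})\delta^l_{AB,C,D}$;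 $(\alpha^\otimes_{A,C,D}\oplus\alpha^\otimes_{B,C,D})\delta^r_{AC,BC,D}(\delta^r_{A,B,C}\otimes1)=\delta^r_{A,B,CD}\alpha^\otimes_{A\oplus B,C,D}$; $(\alpha^\otimes_{A,B,D}\oplus\alpha^\otimes_{A,C,D})\delta^r_{AB,AC,D}(\delta^l_{A,B,C}\otimes1)=\delta^l_{A,BD,CD}(1\otimes\delta^r_{B,C,D})\alpha^\otimes_{A,B\oplus C,D}$; $\mu(\delta^l_{A,C,D}\oplus\delta^l_{B,C,D})\delta^r_{A,B,C\oplus D}=(\delta^r_{A,B,C}\oplus\delta^r_{A,B,D})\delta^l_{A\oplus B,C,D}$, where $\mu:(AC\oplus AD)\oplus(BC\oplus BD)\to(AC\oplus BC)\oplus(AD\oplus BD)$ is the coherence isomorphism exchanging the two middle summands; $\lambda^\bullet_0=\rho^\bullet_0$; $\lambda^\oplus_0(\lambda^\bullet_A\oplus\lambda^\bullet_B)\delta^l_{0,A,B}=\lambda^\bullet_{A\oplus B}$; $\lambda^\oplus_0(\rho^\bullet_A\oplus\rho^\bullet_B)\delta^r_{A,B,0}=\rho^\bullet_{A\oplus B}$; $\rho^\otimes_0=\lambda^\bullet_1$; $\lambda^\otimes_0=\rho^\bullet_1$; $\lambda^\bullet_{AB}\alpha^\otimes_{0,A,B}=\lambda^\bullet_B(\lambda^\bullet_A\otimes1)$; $\rho^\bullet_A(1\otimes\lambda^\bullet_B)\alpha^\otimes_{A,0,B}=\lambda^\bullet_B(\rho^\bullet_A\otimes1)$; $\rho^\bullet_A(1\otimes\rho^\bullet_B)\alpha^\otimes_{A,B,0}=\rho^\bullet_{AB}$;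 $\lambda^\oplus_{AB}(\rho^\bullet_A\oplus1)\delta^l_{A,0,B}=1\otimes\lambda^\oplus_B$; $\lambda^\oplus_{BA}(\lambda^\bullet_A\oplus1)\delta^r_{0,B,A}=\lambda^\oplus_B\otimes1$; $\rho^\oplus_{AB}(1\oplus\rho^\bullet_A)\delta^l_{A,B,0}=1\otimes\rho^\oplus_B$; $\rho^\oplus_{AB}(1\oplus\lambda^\bullet_B)\delta^r_{A,0,B}=\rho^\oplus_A\otimes1$; $(\lambda^\otimes_A\oplus\lambda^\otimes_B)\delta^l_{1,A,B}=\lambda^\otimes_{A\oplus B}$; $(\rho^\otimes_A\oplus\rho^\otimes_B)\delta^r_{A,B,1}=\rho^\otimes_{A\oplus B}$. It is tight if $\delta^l,\delta^r$ are natural isomorphisms. A braided bimonoidal category is a bimonoidal category with a braiding $\zeta^\otimes$ making $\otimes$ braided monoidal, such that $\delta^l_{C,A,B}\zeta^\otimes_{A\oplus B,C}=(\zeta^\otimes_{A,C}\oplus\zeta^\otimes_{B,C})\delta^r_{A,B,C}$, $\delta^r_{B,C,A}\zeta^\otimes_{A,B\oplus C}=(\zeta^\otimes_{A,B}\oplus\zeta^\otimes_{A,C})\delta^l_{A,B,C}$, $\lambda^\bullet_A\zeta^\otimes_{A,0}=\rho^\bullet_A$, and $\rho^\bullet_A\zeta^\otimes_{0,A}=\lambda^\bullet_A$. *)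

theory Defs
  imports Complex_Main "Jordan_Normal_Form.Matrix"
begin

section \<open>Bimonoidal categories\<close>

text \<open>
  Objects are the elements of the type \<open>'o\<close>. The set \<open>Hom A B\<close> consists of the morphisms
  from \<open>A\<close> to \<open>B\<close>; composition \<open>g \<cdot> f\<close> (first \<open>f\<close>, then \<open>g\<close>) is only meaningful on composable
  morphisms, and likewise for the tensor products of morphisms below.
\<close>

locale category =
  fixes Hom :: "'o \<Rightarrow> 'o \<Rightarrow> 'm set"
    and Comp :: "'m \<Rightarrow> 'm \<Rightarrow> 'm" (infixl "\<cdot>" 55)
    and Id :: "'o \<Rightarrow> 'm"
  assumes hom_disjoint: "\<lbrakk>f \<in> Hom A B; f \<in> Hom A' B'\<rbrakk> \<Longrightarrow> A = A' \<and> B = B'"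
    and id_hom: "Id A \<in> Hom A A"
    and comp_hom: "\<lbrakk>f \<in> Hom A B; g \<in> Hom B C\<rbrakk> \<Longrightarrow> g \<cdot> f \<in> Hom A C"
    and id_left: "f \<in> Hom A B \<Longrightarrow> Id B \<cdot> f = f"
    and id_right: "f \<in> Hom A B \<Longrightarrow> f \<cdot> Id A = f"
    and comp_assoc: "\<lbrakk>f \<in> Hom A B; g \<in> Hom B C; h \<in> Hom C D\<rbrakk> \<Longrightarrow> h \<cdot> g \<cdot> f = h \<cdot> (g \<cdot> f)"
begin

definition inverse_arrows :: "'o \<Rightarrow> 'o \<Rightarrow> 'm \<Rightarrow> 'm \<Rightarrow> bool" where
  "inverse_arrows A B f g \<longleftrightarrow>
     f \<in> Hom A B \<and> g \<in> Hom B A \<and> g \<cdot> f = Id A \<and> f \<cdot> g = Id B"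

definition is_iso :: "'o \<Rightarrow> 'o \<Rightarrow> 'm \<Rightarrow> bool" where
  "is_iso A B f \<longleftrightarrow> (\<exists>g. inverse_arrows A B f g)"

definition inverse_of :: "'o \<Rightarrow> 'o \<Rightarrow> 'm \<Rightarrow> 'm" where
  "inverse_of A B f = (THE g. inverse_arrows A B f g)"

definition is_mono :: "'o \<Rightarrow> 'o \<Rightarrow> 'm \<Rightarrow> bool" where
  "is_mono A B f \<longleftrightarrow>
     f \<in> Hom A B \<and> (\<forall>X. \<forall>g \<in> Hom X A. \<forall>h \<in> Hom X A. f \<cdot> g = f \<cdot> h \<longrightarrow> g = h)"

end

locale monoidal_category = category Hom Comp Id
  for Hom :: "'o \<Rightarrow> 'o \<Rightarrow> 'm set"
    and Comp :: "'m \<Rightarrow> 'm \<Rightarrow> 'm" (infixl "\<cdot>" 55)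
    and Id :: "'o \<Rightarrow> 'm" +
  fixes tens_ob :: "'o \<Rightarrow> 'o \<Rightarrow> 'o" (infixl "\<odot>\<^sub>o" 70)
    and tens :: "'m \<Rightarrow> 'm \<Rightarrow> 'm" (infixl "\<odot>" 70)
    and unit :: 'o
    and assoc :: "'o \<Rightarrow> 'o \<Rightarrow> 'o \<Rightarrow> 'm"
    and lunit :: "'o \<Rightarrow> 'm"
    and runit :: "'o \<Rightarrow> 'm"
  assumes tens_hom:
      "\<lbrakk>f \<in> Hom A A'; g \<in> Hom B B'\<rbrakk> \<Longrightarrow> f \<odot> g \<in> Hom (A \<odot>\<^sub>o B) (A' \<odot>\<^sub>o B')"
    and tens_id: "Id A \<odot> Id B = Id (A \<odot>\<^sub>o B)"
    and tens_comp:
      "\<lbrakk>f \<in> Hom A A'; f' \<in> Hom A' A''; g \<in> Hom B B'; g' \<in> Hom B' B''\<rbrakk>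
       \<Longrightarrow> (f' \<cdot> f) \<odot> (g' \<cdot> g) = (f' \<odot> g') \<cdot> (f \<odot> g)"
    and assoc_iso:
      "is_iso ((A \<odot>\<^sub>o B) \<odot>\<^sub>o C) (A \<odot>\<^sub>o (B \<odot>\<^sub>o C)) (assoc A B C)"
    and assoc_natural:
      "\<lbrakk>f \<in> Hom A A'; g \<in> Hom B B'; h \<in> Hom C C'\<rbrakk>
       \<Longrightarrow> assoc A' B' C' \<cdot> ((f \<odot> g) \<odot> h) = (f \<odot> (g \<odot> h)) \<cdot> assoc A B C"
    and lunit_iso: "is_iso (unit \<odot>\<^sub>o A) A (lunit A)"
    and lunit_natural: "f \<in> Hom A A' \<Longrightarrow> lunit A' \<cdot> (Id unit \<odot> f) = f \<cdot> lunit A"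
    and runit_iso: "is_iso (A \<odot>\<^sub>o unit) A (runit A)"
    and runit_natural: "f \<in> Hom A A' \<Longrightarrow> runit A' \<cdot> (f \<odot> Id unit) = f \<cdot> runit A"
    and pentagon:
      "(Id A \<odot> assoc B C D) \<cdot> assoc A (B \<odot>\<^sub>o C) D \<cdot> (assoc A B C \<odot> Id D)
       = assoc A B (C \<odot>\<^sub>o D) \<cdot> assoc (A \<odot>\<^sub>o B) C D"
    and triangle: "(Id A \<odot> lunit B) \<cdot> assoc A unit B = runit A \<odot> Id B"

locale braided_monoidal_category =
  monoidal_category Hom Comp Id tens_ob tens unit assoc lunit runit
  for Hom :: "'o \<Rightarrow> 'o \<Rightarrow> 'm set"
    and Comp :: "'m \<Rightarrow> 'm \<Rightarrow> 'm" (infixl "\<cdot>" 55)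
    and Id :: "'o \<Rightarrow> 'm"
    and tens_ob :: "'o \<Rightarrow> 'o \<Rightarrow> 'o" (infixl "\<odot>\<^sub>o" 70)
    and tens :: "'m \<Rightarrow> 'm \<Rightarrow> 'm" (infixl "\<odot>" 70)
    and unit :: 'o
    and assoc :: "'o \<Rightarrow> 'o \<Rightarrow> 'o \<Rightarrow> 'm"
    and lunit :: "'o \<Rightarrow> 'm"
    and runit :: "'o \<Rightarrow> 'm" +
  fixes braid :: "'o \<Rightarrow> 'o \<Rightarrow> 'm"
  assumes braid_iso: "is_iso (A \<odot>\<^sub>o B) (B \<odot>\<^sub>o A) (braid A B)"
    and braid_natural:
      "\<lbrakk>f \<in> Hom A A'; g \<in> Hom B B'\<rbrakk> \<Longrightarrow> braid A' B' \<cdot> (f \<odot> g) = (g \<odot> f) \<cdot> braid A B"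
    and hexagon1:
      "assoc B C A \<cdot> braid A (B \<odot>\<^sub>o C) \<cdot> assoc A B C
       = (Id B \<odot> braid A C) \<cdot> assoc B A C \<cdot> (braid A B \<odot> Id C)"
    and hexagon2:
      "inverse_of ((C \<odot>\<^sub>o A) \<odot>\<^sub>o B) (C \<odot>\<^sub>o (A \<odot>\<^sub>o B)) (assoc C A B)
         \<cdot> braid (A \<odot>\<^sub>o B) C
         \<cdot> inverse_of ((A \<odot>\<^sub>o B) \<odot>\<^sub>o C) (A \<odot>\<^sub>o (B \<odot>\<^sub>o C)) (assoc A B C)
       = (braid A C \<odot> Id B)
         \<cdot> inverse_of ((A \<odot>\<^sub>o C) \<odot>\<^sub>o B) (A \<odot>\<^sub>o (C \<odot>\<^sub>o B)) (assoc A C B)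
         \<cdot> (Id A \<odot> braid B C)"

locale symmetric_monoidal_category = braided_monoidal_category +
  assumes braid_symmetric: "Comp (braid B A) (braid A B) = Id (tens_ob A B)"

locale bimonoidal_category =
  category Hom Comp Id
  + add: symmetric_monoidal_category Hom Comp Id sum_ob sum_mor zero
      \<alpha>\<^sub>s l\<^sub>s r\<^sub>s \<zeta>\<^sub>s
  + mult: monoidal_category Hom Comp Id prod_ob prod_mor one
      \<alpha>\<^sub>p l\<^sub>p r\<^sub>p
  for Hom :: "'o \<Rightarrow> 'o \<Rightarrow> 'm set"
    and Comp :: "'m \<Rightarrow> 'm \<Rightarrow> 'm" (infixl "\<cdot>" 55)
    and Id :: "'o \<Rightarrow> 'm"
    and sum_ob :: "'o \<Rightarrow> 'o \<Rightarrow> 'o" (infixl "\<oplus>\<^sub>o" 65)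
    and sum_mor :: "'m \<Rightarrow> 'm \<Rightarrow> 'm" (infixl "\<oplus>\<^sub>h" 65)
    and zero :: 'o
    and \<alpha>\<^sub>s :: "'o \<Rightarrow> 'o \<Rightarrow> 'o \<Rightarrow> 'm"
    and l\<^sub>s :: "'o \<Rightarrow> 'm"
    and r\<^sub>s :: "'o \<Rightarrow> 'm"
    and \<zeta>\<^sub>s :: "'o \<Rightarrow> 'o \<Rightarrow> 'm"
    and prod_ob :: "'o \<Rightarrow> 'o \<Rightarrow> 'o" (infixl "\<otimes>\<^sub>o" 70)
    and prod_mor :: "'m \<Rightarrow> 'm \<Rightarrow> 'm" (infixl "\<otimes>\<^sub>h" 70)
    and one :: 'o
    and \<alpha>\<^sub>p :: "'o \<Rightarrow> 'o \<Rightarrow> 'o \<Rightarrow> 'm"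
    and l\<^sub>p :: "'o \<Rightarrow> 'm"
    and r\<^sub>p :: "'o \<Rightarrow> 'm" +
  fixes lzero :: "'o \<Rightarrow> 'm"
    and rzero :: "'o \<Rightarrow> 'm"
    and \<delta>\<^sub>l :: "'o \<Rightarrow> 'o \<Rightarrow> 'o \<Rightarrow> 'm"
    and \<delta>\<^sub>r :: "'o \<Rightarrow> 'o \<Rightarrow> 'o \<Rightarrow> 'm"
  assumes lzero_iso: "is_iso (zero \<otimes>\<^sub>o A) zero (lzero A)"
    and lzero_natural:
      "f \<in> Hom A A' \<Longrightarrow> lzero A' \<cdot> (Id zero \<otimes>\<^sub>h f) = Id zero \<cdot> lzero A"
    and rzero_iso: "is_iso (A \<otimes>\<^sub>o zero) zero (rzero A)"
    and rzero_natural: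
      "f \<in> Hom A A' \<Longrightarrow> rzero A' \<cdot> (f \<otimes>\<^sub>h Id zero) = Id zero \<cdot> rzero A"
    and ldist_mono:
      "is_mono (A \<otimes>\<^sub>o (B \<oplus>\<^sub>o C)) (A \<otimes>\<^sub>o B \<oplus>\<^sub>o A \<otimes>\<^sub>o C) (\<delta>\<^sub>l A B C)"
    and ldist_natural:
      "\<lbrakk>f \<in> Hom A A'; g \<in> Hom B B'; h \<in> Hom C C'\<rbrakk>
       \<Longrightarrow> \<delta>\<^sub>l A' B' C' \<cdot> (f \<otimes>\<^sub>h (g \<oplus>\<^sub>h h)) = (f \<otimes>\<^sub>h g \<oplus>\<^sub>h f \<otimes>\<^sub>h h) \<cdot> \<delta>\<^sub>l A B C"
    and rdist_mono:
      "is_mono ((A \<oplus>\<^sub>o B) \<otimes>\<^sub>o C) (A \<otimes>\<^sub>o C \<oplus>\<^sub>o B \<otimes>\<^sub>o C) (\<delta>\<^sub>r A B C)"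
    and rdist_natural:
      "\<lbrakk>f \<in> Hom A A'; g \<in> Hom B B'; h \<in> Hom C C'\<rbrakk>
       \<Longrightarrow> \<delta>\<^sub>r A' B' C' \<cdot> ((f \<oplus>\<^sub>h g) \<otimes>\<^sub>h h) = (f \<otimes>\<^sub>h h \<oplus>\<^sub>h g \<otimes>\<^sub>h h) \<cdot> \<delta>\<^sub>r A B C"
    and ldist_sym:
      "\<delta>\<^sub>l A C B \<cdot> (Id A \<otimes>\<^sub>h \<zeta>\<^sub>s B C) = \<zeta>\<^sub>s (A \<otimes>\<^sub>o B) (A \<otimes>\<^sub>o C) \<cdot> \<delta>\<^sub>l A B C"
    and rdist_sym:
      "\<delta>\<^sub>r B A C \<cdot> (\<zeta>\<^sub>s A B \<otimes>\<^sub>h Id C) = \<zeta>\<^sub>s (A \<otimes>\<^sub>o C) (B \<otimes>\<^sub>o C) \<cdot> \<delta>\<^sub>r A B C"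
    and rdist_sum_assoc:
      "\<alpha>\<^sub>s (A \<otimes>\<^sub>o D) (B \<otimes>\<^sub>o D) (C \<otimes>\<^sub>o D) \<cdot> (\<delta>\<^sub>r A B D \<oplus>\<^sub>h Id (C \<otimes>\<^sub>o D)) \<cdot> \<delta>\<^sub>r (A \<oplus>\<^sub>o B) C D
       = (Id (A \<otimes>\<^sub>o D) \<oplus>\<^sub>h \<delta>\<^sub>r B C D) \<cdot> \<delta>\<^sub>r A (B \<oplus>\<^sub>o C) D \<cdot> (\<alpha>\<^sub>s A B C \<otimes>\<^sub>h Id D)"
    and ldist_sum_assoc:
      "\<alpha>\<^sub>s (A \<otimes>\<^sub>o B) (A \<otimes>\<^sub>o C) (A \<otimes>\<^sub>o D) \<cdot> (\<delta>\<^sub>l A B C \<oplus>\<^sub>h Id (A \<otimes>\<^sub>o D)) \<cdot> \<delta>\<^sub>l A (B \<oplus>\<^sub>o C) D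
       = (Id (A \<otimes>\<^sub>o B) \<oplus>\<^sub>h \<delta>\<^sub>l A C D) \<cdot> \<delta>\<^sub>l A B (C \<oplus>\<^sub>o D) \<cdot> (Id A \<otimes>\<^sub>h \<alpha>\<^sub>s B C D)"
    and ldist_prod_assoc:
      "\<delta>\<^sub>l A (B \<otimes>\<^sub>o C) (B \<otimes>\<^sub>o D) \<cdot> (Id A \<otimes>\<^sub>h \<delta>\<^sub>l B C D) \<cdot> \<alpha>\<^sub>p A B (C \<oplus>\<^sub>o D)
       = (\<alpha>\<^sub>p A B C \<oplus>\<^sub>h \<alpha>\<^sub>p A B D) \<cdot> \<delta>\<^sub>l (A \<otimes>\<^sub>o B) C D"
    and rdist_prod_assoc:
      "(\<alpha>\<^sub>p A C D \<oplus>\<^sub>h \<alpha>\<^sub>p B C D) \<cdot> \<delta>\<^sub>r (A \<otimes>\<^sub>o C) (B \<otimes>\<^sub>o C) D \<cdot> (\<delta>\<^sub>r A B C \<otimes>\<^sub>h Id D)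
       = \<delta>\<^sub>r A B (C \<otimes>\<^sub>o D) \<cdot> \<alpha>\<^sub>p (A \<oplus>\<^sub>o B) C D"
    and lrdist_prod_assoc:
      "(\<alpha>\<^sub>p A B D \<oplus>\<^sub>h \<alpha>\<^sub>p A C D) \<cdot> \<delta>\<^sub>r (A \<otimes>\<^sub>o B) (A \<otimes>\<^sub>o C) D \<cdot> (\<delta>\<^sub>l A B C \<otimes>\<^sub>h Id D)
       = \<delta>\<^sub>l A (B \<otimes>\<^sub>o D) (C \<otimes>\<^sub>o D) \<cdot> (Id A \<otimes>\<^sub>h \<delta>\<^sub>r B C D) \<cdot> \<alpha>\<^sub>p A (B \<oplus>\<^sub>o C) D"
    \<comment> \<open>the two ways of expanding \<open>(A \<oplus> B) \<otimes> (C \<oplus> D)\<close>; the composite in front of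
        \<open>\<delta>\<^sub>l A C D \<oplus> \<delta>\<^sub>l B C D\<close> exchanges the two middle summands of
        \<open>(W \<oplus> X) \<oplus> (Y \<oplus> Z)\<close>, where \<open>W = A \<otimes> C\<close>, \<open>X = A \<otimes> D\<close>, \<open>Y = B \<otimes> C\<close>, \<open>Z = B \<otimes> D\<close>\<close>
    and lrdist_exchange:
      "\<lbrakk>W = A \<otimes>\<^sub>o C; X = A \<otimes>\<^sub>o D; Y = B \<otimes>\<^sub>o C; Z = B \<otimes>\<^sub>o D\<rbrakk> \<Longrightarrow>
       (inverse_of ((W \<oplus>\<^sub>o Y) \<oplus>\<^sub>o (X \<oplus>\<^sub>o Z)) (W \<oplus>\<^sub>o (Y \<oplus>\<^sub>o (X \<oplus>\<^sub>o Z))) (\<alpha>\<^sub>s W Y (X \<oplus>\<^sub>o Z))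
         \<cdot> (Id W \<oplus>\<^sub>h \<alpha>\<^sub>s Y X Z)
         \<cdot> (Id W \<oplus>\<^sub>h (\<zeta>\<^sub>s X Y \<oplus>\<^sub>h Id Z))
         \<cdot> (Id W \<oplus>\<^sub>h inverse_of ((X \<oplus>\<^sub>o Y) \<oplus>\<^sub>o Z) (X \<oplus>\<^sub>o (Y \<oplus>\<^sub>o Z)) (\<alpha>\<^sub>s X Y Z))
         \<cdot> \<alpha>\<^sub>s W X (Y \<oplus>\<^sub>o Z))
       \<cdot> (\<delta>\<^sub>l A C D \<oplus>\<^sub>h \<delta>\<^sub>l B C D) \<cdot> \<delta>\<^sub>r A B (C \<oplus>\<^sub>o D)
       = (\<delta>\<^sub>r A B C \<oplus>\<^sub>h \<delta>\<^sub>r A B D) \<cdot> \<delta>\<^sub>l (A \<oplus>\<^sub>o B) C D"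
    and zero_zero: "lzero zero = rzero zero"
    and lzero_sum:
      "l\<^sub>s zero \<cdot> (lzero A \<oplus>\<^sub>h lzero B) \<cdot> \<delta>\<^sub>l zero A B = lzero (A \<oplus>\<^sub>o B)"
    and rzero_sum:
      "l\<^sub>s zero \<cdot> (rzero A \<oplus>\<^sub>h rzero B) \<cdot> \<delta>\<^sub>r A B zero = rzero (A \<oplus>\<^sub>o B)"
    and lzero_one: "r\<^sub>p zero = lzero one"
    and rzero_one: "l\<^sub>p zero = rzero one"
    and lzero_prod: "lzero (A \<otimes>\<^sub>o B) \<cdot> \<alpha>\<^sub>p zero A B = lzero B \<cdot> (lzero A \<otimes>\<^sub>h Id B)"
    and lrzero_prod:
      "rzero A \<cdot> (Id A \<otimes>\<^sub>h lzero B) \<cdot> \<alpha>\<^sub>p A zero B = lzero B \<cdot> (rzero A \<otimes>\<^sub>h Id B)"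
    and rzero_prod: "rzero A \<cdot> (Id A \<otimes>\<^sub>h rzero B) \<cdot> \<alpha>\<^sub>p A B zero = rzero (A \<otimes>\<^sub>o B)"
    and ldist_lzero:
      "l\<^sub>s (A \<otimes>\<^sub>o B) \<cdot> (rzero A \<oplus>\<^sub>h Id (A \<otimes>\<^sub>o B)) \<cdot> \<delta>\<^sub>l A zero B = Id A \<otimes>\<^sub>h l\<^sub>s B"
    and rdist_lzero:
      "l\<^sub>s (B \<otimes>\<^sub>o A) \<cdot> (lzero A \<oplus>\<^sub>h Id (B \<otimes>\<^sub>o A)) \<cdot> \<delta>\<^sub>r zero B A = l\<^sub>s B \<otimes>\<^sub>h Id A"
    and ldist_rzero:
      "r\<^sub>s (A \<otimes>\<^sub>o B) \<cdot> (Id (A \<otimes>\<^sub>o B) \<oplus>\<^sub>h rzero A) \<cdot> \<delta>\<^sub>l A B zero = Id A \<otimes>\<^sub>h r\<^sub>s B"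
    and rdist_rzero:
      "r\<^sub>s (A \<otimes>\<^sub>o B) \<cdot> (Id (A \<otimes>\<^sub>o B) \<oplus>\<^sub>h lzero B) \<cdot> \<delta>\<^sub>r A zero B = r\<^sub>s A \<otimes>\<^sub>h Id B"
    and ldist_one: "(l\<^sub>p A \<oplus>\<^sub>h l\<^sub>p B) \<cdot> \<delta>\<^sub>l one A B = l\<^sub>p (A \<oplus>\<^sub>o B)"
    and rdist_one: "(r\<^sub>p A \<oplus>\<^sub>h r\<^sub>p B) \<cdot> \<delta>\<^sub>r A B one = r\<^sub>p (A \<oplus>\<^sub>o B)"

locale braided_bimonoidal_category =
  bimonoidal_category Hom Comp Id sum_ob sum_mor zero \<alpha>\<^sub>s l\<^sub>s r\<^sub>s \<zeta>\<^sub>s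
    prod_ob prod_mor one \<alpha>\<^sub>p l\<^sub>p r\<^sub>p lzero rzero \<delta>\<^sub>l \<delta>\<^sub>r
  + mult: braided_monoidal_category Hom Comp Id prod_ob prod_mor one
      \<alpha>\<^sub>p l\<^sub>p r\<^sub>p \<zeta>\<^sub>p
  for Hom :: "'o \<Rightarrow> 'o \<Rightarrow> 'm set"
    and Comp :: "'m \<Rightarrow> 'm \<Rightarrow> 'm" (infixl "\<cdot>" 55)
    and Id :: "'o \<Rightarrow> 'm"
    and sum_ob :: "'o \<Rightarrow> 'o \<Rightarrow> 'o" (infixl "\<oplus>\<^sub>o" 65)
    and sum_mor :: "'m \<Rightarrow> 'm \<Rightarrow> 'm" (infixl "\<oplus>\<^sub>h" 65)
    and zero \<alpha>\<^sub>s l\<^sub>s r\<^sub>s \<zeta>\<^sub>s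
    and prod_ob :: "'o \<Rightarrow> 'o \<Rightarrow> 'o" (infixl "\<otimes>\<^sub>o" 70)
    and prod_mor :: "'m \<Rightarrow> 'm \<Rightarrow> 'm" (infixl "\<otimes>\<^sub>h" 70)
    and one \<alpha>\<^sub>p l\<^sub>p r\<^sub>p lzero rzero \<delta>\<^sub>l \<delta>\<^sub>r
    and \<zeta>\<^sub>p :: "'o \<Rightarrow> 'o \<Rightarrow> 'm" +
  assumes braid_rdist:
      "\<delta>\<^sub>l C A B \<cdot> \<zeta>\<^sub>p (A \<oplus>\<^sub>o B) C = (\<zeta>\<^sub>p A C \<oplus>\<^sub>h \<zeta>\<^sub>p B C) \<cdot> \<delta>\<^sub>r A B C"
    and braid_ldist:
      "\<delta>\<^sub>r B C A \<cdot> \<zeta>\<^sub>p A (B \<oplus>\<^sub>o C) = (\<zeta>\<^sub>p A B \<oplus>\<^sub>h \<zeta>\<^sub>p A C) \<cdot> \<delta>\<^sub>l A B C"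
    and braid_lzero: "lzero A \<cdot> \<zeta>\<^sub>p A zero = rzero A"
    and braid_rzero: "rzero A \<cdot> \<zeta>\<^sub>p zero A = lzero A"

locale tight_braided_bimonoidal_category = braided_bimonoidal_category +
  assumes ldist_iso:
      "is_iso (prod_ob A (sum_ob B C)) (sum_ob (prod_ob A B) (prod_ob A C)) (\<delta>\<^sub>l A B C)"
    and rdist_iso:
      "is_iso (prod_ob (sum_ob A B) C) (sum_ob (prod_ob A C) (prod_ob B C)) (\<delta>\<^sub>r A B C)"


section \<open>The category of Fibonacci anyons\<close>

text \<open>
  A linear map from \<open>\<complex>\<^sup>m\<close> to \<open>\<complex>\<^sup>k\<close> is given by its \<open>k \<times> m\<close> matrix; matrices with no rows
  or no columns are allowed.
\<close>

type_synonym anyon_ob = "nat \<times> nat"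
type_synonym anyon_mor = "complex mat \<times> complex mat"

definition any_hom :: "anyon_ob \<Rightarrow> anyon_ob \<Rightarrow> anyon_mor set" where
  "any_hom A B = carrier_mat (fst B) (fst A) \<times> carrier_mat (snd B) (snd A)"

definition any_comp :: "anyon_mor \<Rightarrow> anyon_mor \<Rightarrow> anyon_mor" (infixl "\<cdot>\<^sub>F" 55) where
  "g \<cdot>\<^sub>F f = (fst g * fst f, snd g * snd f)"

definition any_id :: "anyon_ob \<Rightarrow> anyon_mor" where
  "any_id A = (1\<^sub>m (fst A), 1\<^sub>m (snd A))"

definition any_zero_mor :: "anyon_ob \<Rightarrow> anyon_ob \<Rightarrow> anyon_mor" where
  "any_zero_mor A B = (0\<^sub>m (fst B) (fst A), 0\<^sub>m (snd B) (snd A))"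

definition any_plus :: "anyon_mor \<Rightarrow> anyon_mor \<Rightarrow> anyon_mor" (infixl "+\<^sub>F" 52) where
  "f +\<^sub>F g = (fst f + fst g, snd f + snd g)"

definition any_Sum :: "anyon_ob \<Rightarrow> anyon_ob \<Rightarrow> ('i \<Rightarrow> anyon_mor) \<Rightarrow> 'i set \<Rightarrow> anyon_mor" where
  "any_Sum A B f I =
     (mat (fst B) (fst A) (\<lambda>ij. \<Sum>k\<in>I. fst (f k) $$ ij),
      mat (snd B) (snd A) (\<lambda>ij. \<Sum>k\<in>I. snd (f k) $$ ij))"

definition any_transpose :: "anyon_mor \<Rightarrow> anyon_mor" where
  "any_transpose f = (transpose_mat (fst f), transpose_mat (snd f))"

definition vacuum :: anyon_ob where "vacuum = (1, 0)"
definition tau :: anyon_ob where "tau = (0, 1)"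


subsection \<open>Direct sum\<close>

definition dsum_mat :: "complex mat \<Rightarrow> complex mat \<Rightarrow> complex mat" where
  "dsum_mat F G =
     four_block_mat F (0\<^sub>m (dim_row F) (dim_col G)) (0\<^sub>m (dim_row G) (dim_col F)) G"

definition any_zero :: anyon_ob where "any_zero = (0, 0)"

definition any_sum :: "anyon_ob \<Rightarrow> anyon_ob \<Rightarrow> anyon_ob" (infixl "\<oplus>\<^sub>F" 65) where
  "A \<oplus>\<^sub>F B = (fst A + fst B, snd A + snd B)"

definition any_sum_mor :: "anyon_mor \<Rightarrow> anyon_mor \<Rightarrow> anyon_mor" (infixl "\<boxplus>\<^sub>F" 65) where
  "f \<boxplus>\<^sub>F g = (dsum_mat (fst f) (fst g), dsum_mat (snd f) (snd g))"

definition any_in1 :: "anyon_ob \<Rightarrow> anyon_ob \<Rightarrow> anyon_mor" where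
  "any_in1 A B =
     (mat (fst A + fst B) (fst A) (\<lambda>(i, j). of_bool (i = j)),
      mat (snd A + snd B) (snd A) (\<lambda>(i, j). of_bool (i = j)))"

definition any_in2 :: "anyon_ob \<Rightarrow> anyon_ob \<Rightarrow> anyon_mor" where
  "any_in2 A B =
     (mat (fst A + fst B) (fst B) (\<lambda>(i, j). of_bool (i = fst A + j)),
      mat (snd A + snd B) (snd B) (\<lambda>(i, j). of_bool (i = snd A + j)))"

definition any_pr1 :: "anyon_ob \<Rightarrow> anyon_ob \<Rightarrow> anyon_mor" where
  "any_pr1 A B = any_transpose (any_in1 A B)"

definition any_pr2 :: "anyon_ob \<Rightarrow> anyon_ob \<Rightarrow> anyon_mor" where
  "any_pr2 A B = any_transpose (any_in2 A B)"

text \<open>The direct sum is strictly associative and unital on these objects.\<close>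

definition any_sum_assoc :: "anyon_ob \<Rightarrow> anyon_ob \<Rightarrow> anyon_ob \<Rightarrow> anyon_mor" where
  "any_sum_assoc A B C = any_id (A \<oplus>\<^sub>F B \<oplus>\<^sub>F C)"

definition any_sum_lunit :: "anyon_ob \<Rightarrow> anyon_mor" where
  "any_sum_lunit A = any_id A"

definition any_sum_runit :: "anyon_ob \<Rightarrow> anyon_mor" where
  "any_sum_runit A = any_id A"

definition any_sum_sym :: "anyon_ob \<Rightarrow> anyon_ob \<Rightarrow> anyon_mor" where
  "any_sum_sym A B = (any_in1 B A \<cdot>\<^sub>F any_pr2 A B) +\<^sub>F (any_in2 B A \<cdot>\<^sub>F any_pr1 A B)"


subsection \<open>Fusion product\<close>

definition kronecker :: "complex mat \<Rightarrow> complex mat \<Rightarrow> complex mat" where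
  "kronecker F G =
     mat (dim_row F * dim_row G) (dim_col F * dim_col G)
       (\<lambda>(i, j). F $$ (i div dim_row G, j div dim_col G) * G $$ (i mod dim_row G, j mod dim_col G))"

text \<open>
  The object \<open>(m, n)\<close> is the sum of \<open>m\<close> copies of the vacuum and \<open>n\<close> copies of \<open>\<tau>\<close>. By
  bilinearity and the fusion rule, the vacuum part of a product is indexed by the pairs of
  constituents \<open>11\<close> and \<open>\<tau>\<tau>\<close>, and its \<open>\<tau>\<close> part by the pairs \<open>1\<tau>\<close>, \<open>\<tau>1\<close> and \<open>\<tau>\<tau>\<close>,
  in this order.
\<close>

definition any_prod :: "anyon_ob \<Rightarrow> anyon_ob \<Rightarrow> anyon_ob" (infixl "\<otimes>\<^sub>F" 70) where
  "A \<otimes>\<^sub>F B = (fst A * fst B + snd A * snd B,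
              fst A * snd B + snd A * fst B + snd A * snd B)"

definition any_prod_mor :: "anyon_mor \<Rightarrow> anyon_mor \<Rightarrow> anyon_mor" (infixl "\<boxtimes>\<^sub>F" 70) where
  "f \<boxtimes>\<^sub>F g =
     (dsum_mat (kronecker (fst f) (fst g)) (kronecker (snd f) (snd g)),
      dsum_mat (dsum_mat (kronecker (fst f) (snd g)) (kronecker (snd f) (fst g)))
        (kronecker (snd f) (snd g)))"

text \<open>The vacuum is a strict unit, and \<open>0 \<otimes> A = A \<otimes> 0 = 0\<close> holds strictly.\<close>

definition any_prod_lunit :: "anyon_ob \<Rightarrow> anyon_mor" where
  "any_prod_lunit A = any_id A"

definition any_prod_runit :: "anyon_ob \<Rightarrow> anyon_mor" where
  "any_prod_runit A = any_id A"

definition any_lzero :: "anyon_ob \<Rightarrow> anyon_mor" where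
  "any_lzero A = any_zero_mor (any_zero \<otimes>\<^sub>F A) any_zero"

definition any_rzero :: "anyon_ob \<Rightarrow> anyon_mor" where
  "any_rzero A = any_zero_mor (A \<otimes>\<^sub>F any_zero) any_zero"

definition any_ldist :: "anyon_ob \<Rightarrow> anyon_ob \<Rightarrow> anyon_ob \<Rightarrow> anyon_mor" where
  "any_ldist A B C =
     (any_in1 (A \<otimes>\<^sub>F B) (A \<otimes>\<^sub>F C) \<cdot>\<^sub>F (any_id A \<boxtimes>\<^sub>F any_pr1 B C))
     +\<^sub>F (any_in2 (A \<otimes>\<^sub>F B) (A \<otimes>\<^sub>F C) \<cdot>\<^sub>F (any_id A \<boxtimes>\<^sub>F any_pr2 B C))"

definition any_rdist :: "anyon_ob \<Rightarrow> anyon_ob \<Rightarrow> anyon_ob \<Rightarrow> anyon_mor" where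
  "any_rdist A B C =
     (any_in1 (A \<otimes>\<^sub>F C) (B \<otimes>\<^sub>F C) \<cdot>\<^sub>F (any_pr1 A B \<boxtimes>\<^sub>F any_id C))
     +\<^sub>F (any_in2 (A \<otimes>\<^sub>F C) (B \<otimes>\<^sub>F C) \<cdot>\<^sub>F (any_pr2 A B \<boxtimes>\<^sub>F any_id C))"


subsection \<open>Associativity and braiding\<close>

datatype simple = Vac | Tau

fun simple_ob :: "simple \<Rightarrow> anyon_ob" where
  "simple_ob Vac = vacuum"
| "simple_ob Tau = tau"

definition summands :: "anyon_ob \<Rightarrow> (simple \<times> nat) set" where
  "summands A = {Vac} \<times> {..<fst A} \<union> {Tau} \<times> {..<snd A}"

definition any_in :: "anyon_ob \<Rightarrow> simple \<times> nat \<Rightarrow> anyon_mor" where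
  "any_in A x =
     (mat (fst A) (fst (simple_ob (fst x))) (\<lambda>(i, _). of_bool (i = snd x)),
      mat (snd A) (snd (simple_ob (fst x))) (\<lambda>(i, _). of_bool (i = snd x)))"

definition any_pr :: "anyon_ob \<Rightarrow> simple \<times> nat \<Rightarrow> anyon_mor" where
  "any_pr A x = any_transpose (any_in A x)"

definition fib_q :: real where
  "fib_q = (sqrt 5 - 1) / 2"

definition fib_z :: complex where
  "fib_z = exp (3 * complex_of_real pi * \<i> / 5)"

definition fib_F :: "complex mat" where
  "fib_F = mat_of_rows_list 2
     [[complex_of_real fib_q, complex_of_real (sqrt fib_q)],
      [complex_of_real (sqrt fib_q), - complex_of_real fib_q]]"

text \<open>
  Both \<open>(\<tau> \<otimes> \<tau>) \<otimes> \<tau>\<close> and \<open>\<tau> \<otimes> (\<tau> \<otimes> \<tau>)\<close> are the object \<open>(1, 2)\<close>, and with the ordering of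
  \<open>any_prod\<close> the two basis vectors of their \<open>\<tau>\<close> part belong to the channels \<open>1\<close> and \<open>\<tau>\<close> of
  \<open>\<tau> \<otimes> \<tau>\<close>, in this order.
\<close>

definition simple_assoc :: "simple \<Rightarrow> simple \<Rightarrow> simple \<Rightarrow> anyon_mor" where
  "simple_assoc s t u =
     (if s = Tau \<and> t = Tau \<and> u = Tau then (1\<^sub>m 1, fib_F)
      else any_id (simple_ob s \<otimes>\<^sub>F simple_ob t \<otimes>\<^sub>F simple_ob u))"

definition simple_braid :: "simple \<Rightarrow> simple \<Rightarrow> anyon_mor" where
  "simple_braid s t =
     (if s = Tau \<and> t = Tau then (fib_z\<^sup>2 \<cdot>\<^sub>m 1\<^sub>m 1, fib_z \<cdot>\<^sub>m 1\<^sub>m 1)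
      else any_id (simple_ob s \<otimes>\<^sub>F simple_ob t))"

text \<open>
  Since every object is the biproduct of its simple summands and the product is bilinear,
  the following are the only extensions of these morphisms that are natural with respect to the
  inclusions and projections.
\<close>

definition any_prod_assoc :: "anyon_ob \<Rightarrow> anyon_ob \<Rightarrow> anyon_ob \<Rightarrow> anyon_mor" where
  "any_prod_assoc A B C =
     any_Sum (A \<otimes>\<^sub>F B \<otimes>\<^sub>F C) (A \<otimes>\<^sub>F (B \<otimes>\<^sub>F C))
       (\<lambda>(a, b, c). (any_in A a \<boxtimes>\<^sub>F (any_in B b \<boxtimes>\<^sub>F any_in C c))
          \<cdot>\<^sub>F simple_assoc (fst a) (fst b) (fst c)
          \<cdot>\<^sub>F (any_pr A a \<boxtimes>\<^sub>F any_pr B b \<boxtimes>\<^sub>F any_pr C c))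
       (summands A \<times> summands B \<times> summands C)"

definition any_prod_braid :: "anyon_ob \<Rightarrow> anyon_ob \<Rightarrow> anyon_mor" where
  "any_prod_braid A B =
     any_Sum (A \<otimes>\<^sub>F B) (B \<otimes>\<^sub>F A)
       (\<lambda>(a, b). (any_in B b \<boxtimes>\<^sub>F any_in A a)
          \<cdot>\<^sub>F simple_braid (fst a) (fst b)
          \<cdot>\<^sub>F (any_pr A a \<boxtimes>\<^sub>F any_pr B b))
       (summands A \<times> summands B)"


text \<open>Consistency with the prescribed data: the fusion rule, and the values on simple objects.\<close>

lemma fusion_rule: "tau \<otimes>\<^sub>F tau = vacuum \<oplus>\<^sub>F tau"
  by (simp add: any_prod_def any_sum_def vacuum_def tau_def)

lemma vacuum_unit: "vacuum \<otimes>\<^sub>F A = A" "A \<otimes>\<^sub>F vacuum = A"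
  by (simp_all add: any_prod_def vacuum_def)


lemma summands_simple: "summands (simple_ob s) = {(s, 0)}"
  by (cases s) (auto simp: summands_def vacuum_def tau_def)

lemma any_in_simple: "any_in (simple_ob s) (s, 0) = any_id (simple_ob s)"
  by (cases s) (auto simp: any_in_def any_id_def vacuum_def tau_def intro!: eq_matI)

lemma any_pr_simple: "any_pr (simple_ob s) (s, 0) = any_id (simple_ob s)"
  by (simp add: any_pr_def any_in_simple any_transpose_def any_id_def)

lemma kronecker_one: "kronecker (1\<^sub>m a) (1\<^sub>m b) = 1\<^sub>m (a * b)"
proof (rule eq_matI)
  fix i j assume ij: "i < dim_row (1\<^sub>m (a * b) :: complex mat)" "j < dim_col (1\<^sub>m (a * b) :: complex mat)"
  then have b: "0 < b" and ij': "i < a * b" "j < a * b" by (cases b; simp)+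
  have "i = j \<longleftrightarrow> i div b = j div b \<and> i mod b = j mod b" by (metis div_mult_mod_eq)
  then show "kronecker (1\<^sub>m a) (1\<^sub>m b) $$ (i, j) = 1\<^sub>m (a * b) $$ (i, j)"
    using b ij' by (auto simp: kronecker_def less_mult_imp_div_less)
qed (simp_all add: kronecker_def)

lemma any_prod_id: "any_id A \<boxtimes>\<^sub>F any_id B = any_id (A \<otimes>\<^sub>F B)"
  by (auto simp: any_prod_mor_def any_id_def any_prod_def kronecker_one dsum_mat_def intro!: eq_matI)

lemma any_Sum_singleton: "f x \<in> any_hom A B \<Longrightarrow> any_Sum A B f {x} = f x"
  by (cases "f x") (auto simp: any_Sum_def any_hom_def intro!: eq_matI)

lemma any_id_comp: "f \<in> any_hom A B \<Longrightarrow> any_id B \<cdot>\<^sub>F f \<cdot>\<^sub>F any_id A = f"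
  by (cases f) (auto simp: any_comp_def any_id_def any_hom_def)

lemma simple_assoc_hom:
  "simple_assoc s t u \<in> any_hom (simple_ob s \<otimes>\<^sub>F simple_ob t \<otimes>\<^sub>F simple_ob u)
     (simple_ob s \<otimes>\<^sub>F (simple_ob t \<otimes>\<^sub>F simple_ob u))"
  by (cases s; cases t; cases u)
     (auto simp: simple_assoc_def any_hom_def any_id_def any_prod_def vacuum_def tau_def fib_F_def
        mat_of_rows_list_def)

lemma simple_braid_hom:
  "simple_braid s t \<in> any_hom (simple_ob s \<otimes>\<^sub>F simple_ob t) (simple_ob t \<otimes>\<^sub>F simple_ob s)"
  by (cases s; cases t)
     (auto simp: simple_braid_def any_hom_def any_id_def any_prod_def vacuum_def tau_def)

lemma any_prod_assoc_simple:
  "any_prod_assoc (simple_ob s) (simple_ob t) (simple_ob u) = simple_assoc s t u"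
  by (simp add: any_prod_assoc_def summands_simple any_Sum_singleton any_in_simple any_pr_simple
      any_prod_id any_id_comp[OF simple_assoc_hom] simple_assoc_hom)

lemma any_prod_braid_simple:
  "any_prod_braid (simple_ob s) (simple_ob t) = simple_braid s t"
  by (simp add: any_prod_braid_def summands_simple any_Sum_singleton any_in_simple any_pr_simple
      any_prod_id any_id_comp[OF simple_braid_hom] simple_braid_hom)

end

theory Submission
  imports Defs
begin

text \<open>
  Everything reduces to the simple objects \<open>1\<close> and \<open>\<tau>\<close>, where it becomes a computation with
  matrices of size at most three.

  The product of morphisms is a bilinear functor, because Kronecker products and block diagonal
  sums are. Every object is a biproduct of simple ones (\<open>simple_decomp\<close>), and a bilinear functor
  carries biproduct decompositions to biproduct decompositions (\<open>decomp_prod\<close>), so an iterated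
  product is the biproduct of the corresponding products of simple objects. A morphism is therefore
  determined by its composites with the inclusions of these summands (\<open>decomp_joint_epi\<close>).
  The associativity and braiding are sums \<open>\<Sum> \<kappa>\<^sub>i \<phi>\<^sub>i \<pi>\<^sub>i\<close> over such decompositions, which makes them
  compatible with inclusions and projections (\<open>extension_in\<close>, \<open>extension_pr\<close>). By Schur's lemma
  (\<open>simple_hom_cases\<close>) a morphism between simple objects is zero or a scalar, and scalars commute
  with every \<open>\<phi>\<^sub>i\<close>; this gives naturality (\<open>assoc_natural\<close>, \<open>braid_natural\<close>), and it gives
  invertibility because the \<open>\<phi>\<^sub>i\<close> are invertible (\<open>extension_inverse\<close>).

  Both sides of the pentagon and of the two hexagons are then natural in all their arguments, and it
  suffices to compare them on simple objects. If one of these is the vacuum, the conditions are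
  trivial, because associativity and braiding with a vacuum factor are identities (\<open>assoc_vacuum\<close>,
  \<open>braid_vacuum\<close>). What is left is the pentagon on \<open>\<tau>, \<tau>, \<tau>, \<tau>\<close> and the hexagon on
  \<open>\<tau>, \<tau>, \<tau>\<close>. These hold for numerical reasons: \<open>q\<^sup>2 = 1 - q\<close> for the pentagon, and in addition \<open>z\<^sup>2 = -1 - q z\<close> for the hexagon, which says
  that \<open>z + z\<^sup>-\<^sup>1 = 2 cos (3\<pi>/5) = -q\<close> (\<open>pentagon_tau\<close>, \<open>hexagon_tau\<close>).

  The conditions on the direct sum and the distributivity isomorphisms need no computation. All of the
  morphisms in them are characterised by their composites with the two projections of a direct sum
  (\<open>sum_joint_mono\<close>); in particular \<open>\<delta>\<^sup>l\<close> followed by a projection is \<open>1 \<otimes> pr\<close>. After projecting,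
  each condition becomes functoriality of the product, or naturality of the associativity or the braiding with
  respect to a projection. The conditions on the zero object hold since it is terminal and a strict
  unit of the direct sum.
\<close>

section \<open>Anyon morphisms as arrows\<close>

text \<open>
  Every pair of matrices is a morphism of exactly one hom set. Reading the source and target off the matrices
  turns the side conditions of categorical laws into equations between objects that rewriting decides.
\<close>
definition any_dom :: "anyon_mor \<Rightarrow> anyon_ob" where
  "any_dom f = (dim_col (fst f), dim_col (snd f))"

definition any_cod :: "anyon_mor \<Rightarrow> anyon_ob" where
  "any_cod f = (dim_row (fst f), dim_row (snd f))"

lemma any_hom_iff: "f \<in> any_hom A B \<longleftrightarrow> any_dom f = A \<and> any_cod f = B"
  by (auto simp: any_hom_def any_dom_def any_cod_def mem_Times_iff)

lemma dsum_mat_dim [simp]: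
  "dim_row (dsum_mat F G) = dim_row F + dim_row G"
  "dim_col (dsum_mat F G) = dim_col F + dim_col G"
  by (simp_all add: dsum_mat_def)

lemma kronecker_dim [simp]:
  "dim_row (kronecker F G) = dim_row F * dim_row G"
  "dim_col (kronecker F G) = dim_col F * dim_col G"
  by (simp_all add: kronecker_def)

definition any_smult :: "complex \<Rightarrow> anyon_mor \<Rightarrow> anyon_mor" (infixr "*\<^sub>F" 75) where
  "c *\<^sub>F f = (c \<cdot>\<^sub>m fst f, c \<cdot>\<^sub>m snd f)"

text \<open>The dimensions of a matrix sum are by definition those of the second summand.\<close>
lemma any_dom_simps [simp]:
  "any_dom (g \<cdot>\<^sub>F f) = any_dom f"
  "any_dom (any_id A) = A"
  "any_dom (any_zero_mor A B) = A"
  "any_dom (f +\<^sub>F g) = any_dom g"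
  "any_dom (any_Sum A B h I) = A"
  "any_dom (f \<boxplus>\<^sub>F g) = any_dom f \<oplus>\<^sub>F any_dom g"
  "any_dom (f \<boxtimes>\<^sub>F g) = any_dom f \<otimes>\<^sub>F any_dom g"
  "any_dom (c *\<^sub>F f) = any_dom f"
  "any_dom (any_transpose f) = any_cod f"
  "any_dom (any_in1 A B) = A"
  "any_dom (any_in2 A B) = B"
  "any_dom (any_pr1 A B) = A \<oplus>\<^sub>F B"
  "any_dom (any_pr2 A B) = A \<oplus>\<^sub>F B"
  "any_dom (any_in A x) = simple_ob (fst x)"
  "any_dom (any_pr A x) = A"
  by (auto simp: any_dom_def any_cod_def any_comp_def any_id_def any_zero_mor_def any_plus_def any_Sum_def
      any_sum_mor_def any_prod_mor_def any_sum_def any_prod_def any_smult_def any_transpose_def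
      any_in1_def any_in2_def any_pr1_def any_pr2_def any_in_def any_pr_def)

lemma any_cod_simps [simp]:
  "any_cod (g \<cdot>\<^sub>F f) = any_cod g"
  "any_cod (any_id A) = A"
  "any_cod (any_zero_mor A B) = B"
  "any_cod (f +\<^sub>F g) = any_cod g"
  "any_cod (any_Sum A B h I) = B"
  "any_cod (f \<boxplus>\<^sub>F g) = any_cod f \<oplus>\<^sub>F any_cod g"
  "any_cod (f \<boxtimes>\<^sub>F g) = any_cod f \<otimes>\<^sub>F any_cod g"
  "any_cod (c *\<^sub>F f) = any_cod f"
  "any_cod (any_transpose f) = any_dom f"
  "any_cod (any_in1 A B) = A \<oplus>\<^sub>F B"
  "any_cod (any_in2 A B) = A \<oplus>\<^sub>F B"
  "any_cod (any_pr1 A B) = A"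
  "any_cod (any_pr2 A B) = B"
  "any_cod (any_in A x) = A"
  "any_cod (any_pr A x) = simple_ob (fst x)"
  by (auto simp: any_dom_def any_cod_def any_comp_def any_id_def any_zero_mor_def any_plus_def any_Sum_def
      any_sum_mor_def any_prod_mor_def any_sum_def any_prod_def any_smult_def any_transpose_def
      any_in1_def any_in2_def any_pr1_def any_pr2_def any_in_def any_pr_def)

lemma any_mor_eqI:
  assumes "any_dom f = any_dom g" "any_cod f = any_cod g"
    and "\<And>i j. i < fst (any_cod g) \<Longrightarrow> j < fst (any_dom g) \<Longrightarrow> fst f $$ (i, j) = fst g $$ (i, j)"
    and "\<And>i j. i < snd (any_cod g) \<Longrightarrow> j < snd (any_dom g) \<Longrightarrow> snd f $$ (i, j) = snd g $$ (i, j)"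
  shows "f = g"
  using assms by (cases f; cases g) (auto simp: any_dom_def any_cod_def intro!: eq_matI)

subsection \<open>Composition\<close>

lemma any_id_left [simp]: "any_cod f = B \<Longrightarrow> any_id B \<cdot>\<^sub>F f = f"
  by (cases f) (auto simp: any_comp_def any_id_def any_cod_def)

lemma any_id_right [simp]: "any_dom f = A \<Longrightarrow> f \<cdot>\<^sub>F any_id A = f"
  by (cases f) (auto simp: any_comp_def any_id_def any_dom_def)

lemma any_comp_assoc [simp]:
  "any_dom h = any_cod g \<Longrightarrow> any_dom g = any_cod f \<Longrightarrow> h \<cdot>\<^sub>F g \<cdot>\<^sub>F f = h \<cdot>\<^sub>F (g \<cdot>\<^sub>F f)"
  unfolding any_comp_def any_dom_def any_cod_def
  by (auto intro!: assoc_mult_mat)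

lemma any_category: "category any_hom any_comp any_id"
  by unfold_locales (auto simp: any_hom_iff)

interpretation cat: category any_hom any_comp any_id
  by (rule any_category)

lemma any_comp_zero_left [simp]:
  "any_cod f = A \<Longrightarrow> any_zero_mor A B \<cdot>\<^sub>F f = any_zero_mor (any_dom f) B"
  by (rule any_mor_eqI)
    (auto simp: any_comp_def any_zero_mor_def any_dom_def any_cod_def scalar_prod_def)

lemma any_comp_zero_right [simp]:
  "any_dom f = B \<Longrightarrow> f \<cdot>\<^sub>F any_zero_mor A B = any_zero_mor A (any_cod f)"
  by (rule any_mor_eqI)
    (auto simp: any_comp_def any_zero_mor_def any_dom_def any_cod_def scalar_prod_def)

lemma any_comp_plus_left:
  "any_dom f = any_dom g \<Longrightarrow> any_cod f = any_cod g \<Longrightarrow> any_dom g = any_cod h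
   \<Longrightarrow> (f +\<^sub>F g) \<cdot>\<^sub>F h = f \<cdot>\<^sub>F h +\<^sub>F g \<cdot>\<^sub>F h"
  unfolding any_comp_def any_plus_def any_dom_def any_cod_def
  by (auto intro!: add_mult_distrib_mat)

lemma any_comp_plus_right:
  "any_dom f = any_dom g \<Longrightarrow> any_cod f = any_cod g \<Longrightarrow> any_dom h = any_cod g
   \<Longrightarrow> h \<cdot>\<^sub>F (f +\<^sub>F g) = h \<cdot>\<^sub>F f +\<^sub>F h \<cdot>\<^sub>F g"
  unfolding any_comp_def any_plus_def any_dom_def any_cod_def
  by (auto intro!: mult_add_distrib_mat)

lemma any_comp_smult_left:
  "any_dom g = any_cod f \<Longrightarrow> (c *\<^sub>F g) \<cdot>\<^sub>F f = c *\<^sub>F (g \<cdot>\<^sub>F f)"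
  unfolding any_comp_def any_smult_def any_dom_def any_cod_def
  by (auto intro!: mult_smult_assoc_mat)

lemma any_comp_smult_right:
  "any_dom g = any_cod f \<Longrightarrow> g \<cdot>\<^sub>F (c *\<^sub>F f) = c *\<^sub>F (g \<cdot>\<^sub>F f)"
  unfolding any_comp_def any_smult_def any_dom_def any_cod_def
  by (auto intro!: mult_smult_distrib)

lemma any_plus_zero [simp]:
  "any_dom f = A \<Longrightarrow> any_cod f = B \<Longrightarrow> f +\<^sub>F any_zero_mor A B = f"
  "any_dom f = A \<Longrightarrow> any_cod f = B \<Longrightarrow> any_zero_mor A B +\<^sub>F f = f"
  by (auto simp: any_plus_def any_zero_mor_def any_dom_def any_cod_def intro!: any_mor_eqI)

lemma any_into_zero:
  "any_cod f = any_zero \<Longrightarrow> any_cod g = any_zero \<Longrightarrow> any_dom f = any_dom g \<Longrightarrow> f = g"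
  by (rule any_mor_eqI) (auto simp: any_zero_def)

subsection \<open>Finite sums of morphisms\<close>

lemma any_Sum_empty: "any_Sum A B f {} = any_zero_mor A B"
  by (rule any_mor_eqI) (auto simp: any_Sum_def any_zero_mor_def any_dom_def any_cod_def)

lemma any_Sum_insert:
  assumes "finite I" "i \<notin> I" "any_dom (f i) = A" "any_cod (f i) = B"
  shows "any_Sum A B f (insert i I) = f i +\<^sub>F any_Sum A B f I"
  using assms
  by (intro any_mor_eqI) (auto simp: any_Sum_def any_plus_def any_dom_def any_cod_def)

lemma any_Sum_cong:
  "I = J \<Longrightarrow> (\<And>i. i \<in> J \<Longrightarrow> f i = g i) \<Longrightarrow> any_Sum A B f I = any_Sum A B g J"
  by (simp add: any_Sum_def cong: sum.cong)

text \<open>The single induction behind the fact that composition and the product distribute over finite sums.\<close>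
lemma any_Sum_additive:
  assumes hom: "\<And>i. i \<in> I \<Longrightarrow> any_dom (f i) = A \<and> any_cod (f i) = B" and "finite I"
    and H: "\<And>h. any_dom h = A \<Longrightarrow> any_cod h = B \<Longrightarrow> any_dom (H h) = A' \<and> any_cod (H h) = B'"
    and zero: "H (any_zero_mor A B) = any_zero_mor A' B'"
    and plus: "\<And>h k. any_dom h = A \<Longrightarrow> any_dom k = A \<Longrightarrow> any_cod h = B \<Longrightarrow> any_cod k = B
                 \<Longrightarrow> H (h +\<^sub>F k) = H h +\<^sub>F H k"
  shows "H (any_Sum A B f I) = any_Sum A' B' (\<lambda>i. H (f i)) I"
  using \<open>finite I\<close> hom
proof (induction I rule: finite_induct)
  case empty
  then show ?case by (simp add: any_Sum_empty zero)
next
  case (insert i I)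
  then show ?case using H by (simp add: any_Sum_insert plus)
qed

lemma any_comp_Sum_right:
  assumes "\<And>i. i \<in> I \<Longrightarrow> any_dom (f i) = A \<and> any_cod (f i) = B" "finite I" "any_dom g = B"
  shows "g \<cdot>\<^sub>F any_Sum A B f I = any_Sum A (any_cod g) (\<lambda>i. g \<cdot>\<^sub>F f i) I"
  using assms by (intro any_Sum_additive) (auto simp: any_comp_plus_right)

lemma any_comp_Sum_left:
  assumes "\<And>i. i \<in> I \<Longrightarrow> any_dom (f i) = A \<and> any_cod (f i) = B" "finite I" "any_cod g = A"
  shows "any_Sum A B f I \<cdot>\<^sub>F g = any_Sum (any_dom g) B (\<lambda>i. f i \<cdot>\<^sub>F g) I"
  using assms by (intro any_Sum_additive) (auto simp: any_comp_plus_left)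

lemma any_Sum_single:
  assumes "finite I" "i \<in> I" "\<And>j. j \<in> I \<Longrightarrow> j \<noteq> i \<Longrightarrow> f j = any_zero_mor A B"
    "any_dom (f i) = A" "any_cod (f i) = B"
  shows "any_Sum A B f I = f i"
proof -
  have z: "any_Sum A B f (I - {i}) = any_zero_mor A B"
    using assms(3) by (intro any_mor_eqI) (auto simp: any_Sum_def any_zero_mor_def any_dom_def any_cod_def)
  have "any_Sum A B f (insert i (I - {i})) = f i +\<^sub>F any_Sum A B f (I - {i})"
    using assms by (intro any_Sum_insert) auto
  then show ?thesis using assms by (simp add: z insert_absorb)
qed

lemma any_Sum_nested:
  assumes "finite I" "finite J"
  shows "any_Sum A B (\<lambda>i. any_Sum A B (f i) J) I = any_Sum A B (\<lambda>(i, j). f i j) (I \<times> J)"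
  using assms
  by (intro any_mor_eqI) (auto simp: any_Sum_def sum.cartesian_product case_prod_beta any_dom_def any_cod_def)

lemma any_Sum_reindex:
  assumes "inj_on r J"
  shows "any_Sum A B f (r ` J) = any_Sum A B (\<lambda>j. f (r j)) J"
  using assms by (simp add: any_Sum_def sum.reindex o_def)

subsection \<open>The biproduct\<close>

lemma zero_sum_ob [simp]: "any_zero \<oplus>\<^sub>F A = A" "A \<oplus>\<^sub>F any_zero = A"
  by (auto simp: any_sum_def any_zero_def)

lemma sum_ob_assoc: "A \<oplus>\<^sub>F B \<oplus>\<^sub>F C = A \<oplus>\<^sub>F (B \<oplus>\<^sub>F C)"
  by (simp add: any_sum_def)

lemma in1_mat_mult: "(mat (m + n) m (\<lambda>(i, j). of_bool (i = j)) * M :: complex mat)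
   = mat (m + n) (dim_col M) (\<lambda>(i, j). if i < m then M $$ (i, j) else 0)"
  if "dim_row M = m" for M :: "complex mat"
  using that by (intro eq_matI) (auto simp: scalar_prod_def if_distrib cong: if_cong)

lemma in2_mat_mult: "(mat (m + n) n (\<lambda>(i, j). of_bool (i = m + j)) * M :: complex mat)
   = mat (m + n) (dim_col M) (\<lambda>(i, j). if m \<le> i then M $$ (i - m, j) else 0)"
  if "dim_row M = n" for M :: "complex mat"
proof (intro eq_matI)
  fix i j assume "i < dim_row (mat (m + n) (dim_col M) (\<lambda>(i, j). if m \<le> i then M $$ (i - m, j) else 0))"
    and "j < dim_col (mat (m + n) (dim_col M) (\<lambda>(i, j). if m \<le> i then M $$ (i - m, j) else 0))"
  moreover have "m \<le> i \<Longrightarrow> i = m + k \<longleftrightarrow> k = i - m" for k by auto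
  ultimately show "(mat (m + n) n (\<lambda>(i, j). of_bool (i = m + j)) * M) $$ (i, j) =
     mat (m + n) (dim_col M) (\<lambda>(i, j). if m \<le> i then M $$ (i - m, j) else 0) $$ (i, j)"
    using that by (cases "m \<le> i") (auto simp: scalar_prod_def if_distrib cong: if_cong)
qed (use that in auto)

lemma pr1_mat_mult: "(mat (m + n) m (\<lambda>(i, j). of_bool (i = j)))\<^sup>T * M
   = mat m (dim_col M) (\<lambda>(i, j). M $$ (i, j))"
  if "dim_row M = m + n" for M :: "complex mat"
  using that by (intro eq_matI) (auto simp: scalar_prod_def if_distrib cong: if_cong)

lemma pr2_mat_mult: "(mat (m + n) n (\<lambda>(i, j). of_bool (i = m + j)))\<^sup>T * M
   = mat n (dim_col M) (\<lambda>(i, j). M $$ (m + i, j))"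
  if "dim_row M = m + n" for M :: "complex mat"
  using that by (intro eq_matI) (auto simp: scalar_prod_def if_distrib cong: if_cong)

lemmas biprod_defs = any_comp_def any_pr1_def any_pr2_def any_in1_def any_in2_def any_transpose_def
  any_sum_def

lemma pr_in [simp]:
  "any_pr1 A B \<cdot>\<^sub>F any_in1 A B = any_id A"
  "any_pr2 A B \<cdot>\<^sub>F any_in2 A B = any_id B"
  "any_pr1 A B \<cdot>\<^sub>F any_in2 A B = any_zero_mor B A"
  "any_pr2 A B \<cdot>\<^sub>F any_in1 A B = any_zero_mor A B"
  by (auto simp: biprod_defs pr1_mat_mult pr2_mat_mult any_id_def any_zero_mor_def intro!: eq_matI)

lemma in_pr_sum: "any_in1 A B \<cdot>\<^sub>F any_pr1 A B +\<^sub>F any_in2 A B \<cdot>\<^sub>F any_pr2 A B = any_id (A \<oplus>\<^sub>F B)"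
  by (auto simp: biprod_defs in1_mat_mult in2_mat_mult any_id_def any_plus_def intro!: eq_matI)

lemma mat_mult_pr1: "M * (mat (m + n) m (\<lambda>(i, j). of_bool (i = j)))\<^sup>T
   = mat (dim_row M) (m + n) (\<lambda>(i, j). if j < m then M $$ (i, j) else 0)"
  if "dim_col M = m" for M :: "complex mat"
  using that by (intro eq_matI) (auto simp: scalar_prod_def if_distrib cong: if_cong)

lemma mat_mult_pr2: "M * (mat (m + n) n (\<lambda>(i, j). of_bool (i = m + j)))\<^sup>T
   = mat (dim_row M) (m + n) (\<lambda>(i, j). if m \<le> j then M $$ (i, j - m) else 0)"
  if "dim_col M = n" for M :: "complex mat"
proof -
  have "M * (mat (m + n) n (\<lambda>(i, j). of_bool (i = m + j)))\<^sup>T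
    = (mat (m + n) n (\<lambda>(i, j). of_bool (i = m + j)) * M\<^sup>T)\<^sup>T"
    using that by (subst transpose_mult[of _ "m + n" n _ "dim_row M"]) auto
  also have "\<dots> = mat (dim_row M) (m + n) (\<lambda>(i, j). if m \<le> j then M $$ (i, j - m) else 0)"
    using that by (subst in2_mat_mult) (auto intro!: eq_matI)
  finally show ?thesis .
qed

lemma pr_sum_mor [simp]:
  "any_cod f = A \<Longrightarrow> any_cod g = B \<Longrightarrow> any_pr1 A B \<cdot>\<^sub>F (f \<boxplus>\<^sub>F g) = f \<cdot>\<^sub>F any_pr1 (any_dom f) (any_dom g)"
  "any_cod f = A \<Longrightarrow> any_cod g = B \<Longrightarrow> any_pr2 A B \<cdot>\<^sub>F (f \<boxplus>\<^sub>F g) = g \<cdot>\<^sub>F any_pr2 (any_dom f) (any_dom g)"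
  by (auto simp: biprod_defs pr1_mat_mult pr2_mat_mult mat_mult_pr1 mat_mult_pr2 any_sum_mor_def
      any_dom_def any_cod_def dsum_mat_def intro!: eq_matI)

text \<open>
  These say that the identity morphism is the canonical isomorphism between the two bracketings of a triple sum.
\<close>
lemma pr_sum_assoc:
  "any_pr1 A B \<cdot>\<^sub>F any_pr1 (A \<oplus>\<^sub>F B) C = any_pr1 A (B \<oplus>\<^sub>F C)"
  "any_pr2 A B \<cdot>\<^sub>F any_pr1 (A \<oplus>\<^sub>F B) C = any_pr1 B C \<cdot>\<^sub>F any_pr2 A (B \<oplus>\<^sub>F C)"
  "any_pr2 (A \<oplus>\<^sub>F B) C = any_pr2 B C \<cdot>\<^sub>F any_pr2 A (B \<oplus>\<^sub>F C)"
  by (auto simp: biprod_defs pr1_mat_mult pr2_mat_mult add.assoc intro!: eq_matI)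

lemma pr_zero [simp]: "any_pr1 A any_zero = any_id A" "any_pr2 any_zero A = any_id A"
  by (auto simp: biprod_defs any_id_def any_zero_def intro!: eq_matI)

lemma sum_joint_mono:
  assumes "any_cod f = A \<oplus>\<^sub>F B" "any_cod g = A \<oplus>\<^sub>F B" "any_dom f = any_dom g"
    and p: "any_pr1 A B \<cdot>\<^sub>F f = any_pr1 A B \<cdot>\<^sub>F g" "any_pr2 A B \<cdot>\<^sub>F f = any_pr2 A B \<cdot>\<^sub>F g"
  shows "f = g"
proof -
  have split: "h = any_in1 A B \<cdot>\<^sub>F (any_pr1 A B \<cdot>\<^sub>F h) +\<^sub>F any_in2 A B \<cdot>\<^sub>F (any_pr2 A B \<cdot>\<^sub>F h)"
    if "any_cod h = A \<oplus>\<^sub>F B" for h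
  proof -
    have "h = any_id (A \<oplus>\<^sub>F B) \<cdot>\<^sub>F h" using that by simp
    also have "\<dots> = any_in1 A B \<cdot>\<^sub>F (any_pr1 A B \<cdot>\<^sub>F h) +\<^sub>F any_in2 A B \<cdot>\<^sub>F (any_pr2 A B \<cdot>\<^sub>F h)"
      unfolding in_pr_sum[symmetric] using that by (subst any_comp_plus_left) auto
    finally show ?thesis .
  qed
  show ?thesis using split[of f] split[of g] assms by simp
qed

lemma pr_sum_sym [simp]:
  "any_pr1 B A \<cdot>\<^sub>F any_sum_sym A B = any_pr2 A B"
  "any_pr2 B A \<cdot>\<^sub>F any_sum_sym A B = any_pr1 A B"
  by (simp_all add: any_sum_sym_def any_comp_plus_right flip: any_comp_assoc)

section \<open>The fusion product is a bilinear functor\<close>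

text \<open>
  The index set of a Kronecker product is a product of index sets, encoded by quotient and remainder; the
  mixed product property is the factorisation of a double sum along this encoding.
\<close>
lemma sum_div_mod:
  fixes f g :: "nat \<Rightarrow> complex"
  shows "(\<Sum>k\<in>{0..<a * b}. f (k div b) * g (k mod b)) = (\<Sum>i\<in>{0..<a}. f i) * (\<Sum>j\<in>{0..<b}. g j)"
proof (cases "b = 0")
  case False
  have "i * b + j < a * b" if "i < a" "j < b" for i j
  proof -
    have "i * b + j < Suc i * b" using that by simp
    also have "\<dots> \<le> a * b" using that by (intro mult_le_mono1) auto
    finally show ?thesis .
  qed
  then have "(\<Sum>k\<in>{0..<a * b}. f (k div b) * g (k mod b))
      = (\<Sum>(i, j)\<in>{0..<a} \<times> {0..<b}. f i * g j)"
    using False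
    by (intro sum.reindex_bij_witness[where i = "\<lambda>(i, j). i * b + j" and j = "\<lambda>k. (k div b, k mod b)"])
      (auto simp: less_mult_imp_div_less)
  then show ?thesis by (simp add: sum_product sum.cartesian_product)
qed simp

lemma div_mod_lt [simp]: "i < m * n \<Longrightarrow> i div n < m" "i < m * n \<Longrightarrow> i mod n < n" for i m n :: nat
  by (cases n; simp add: less_mult_imp_div_less)+

lemma kronecker_mult:
  assumes "dim_col F' = dim_row F" "dim_col G' = dim_row G"
  shows "kronecker F' G' * kronecker F G = kronecker (F' * F) (G' * G)"
proof (rule eq_matI)
  fix i j assume ij: "i < dim_row (kronecker (F' * F) (G' * G))" "j < dim_col (kronecker (F' * F) (G' * G))"
  have "(kronecker F' G' * kronecker F G) $$ (i, j) = (\<Sum>k\<in>{0..<dim_row F * dim_row G}.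
      (F' $$ (i div dim_row G', k div dim_row G) * F $$ (k div dim_row G, j div dim_col G)) *
      (G' $$ (i mod dim_row G', k mod dim_row G) * G $$ (k mod dim_row G, j mod dim_col G)))"
    using ij assms by (auto simp: kronecker_def scalar_prod_def intro!: sum.cong)
  also have "\<dots> = kronecker (F' * F) (G' * G) $$ (i, j)"
    using ij assms by (subst sum_div_mod) (simp add: kronecker_def scalar_prod_def)
  finally show "(kronecker F' G' * kronecker F G) $$ (i, j) = kronecker (F' * F) (G' * G) $$ (i, j)" .
qed (simp_all)

lemma kronecker_plus_left:
  "dim_row F = dim_row F' \<Longrightarrow> dim_col F = dim_col F' \<Longrightarrow>
   kronecker (F + F') G = kronecker F G + kronecker F' G"
  by (auto simp: kronecker_def algebra_simps intro!: eq_matI)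

lemma kronecker_plus_right:
  "dim_row G = dim_row G' \<Longrightarrow> dim_col G = dim_col G' \<Longrightarrow>
   kronecker F (G + G') = kronecker F G + kronecker F G'"
  by (auto simp: kronecker_def algebra_simps intro!: eq_matI)

lemma kronecker_zero_left: "kronecker (0\<^sub>m m n) G = 0\<^sub>m (m * dim_row G) (n * dim_col G)"
  by (auto simp: kronecker_def intro!: eq_matI)

lemma kronecker_zero_right: "kronecker F (0\<^sub>m m n) = 0\<^sub>m (dim_row F * m) (dim_col F * n)"
  by (auto simp: kronecker_def intro!: eq_matI)

lemma kronecker_smult:
  "kronecker (c \<cdot>\<^sub>m F) G = c \<cdot>\<^sub>m kronecker F G" "kronecker F (c \<cdot>\<^sub>m G) = c \<cdot>\<^sub>m kronecker F G"
  by (auto simp: kronecker_def intro!: eq_matI)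

lemma kronecker_one_unit: "kronecker (1\<^sub>m 1) F = F" "kronecker F (1\<^sub>m 1) = F"
  by (auto simp: kronecker_def intro!: eq_matI)

lemma dsum_mat_mult:
  assumes "dim_col F' = dim_row F" "dim_col G' = dim_row G"
  shows "dsum_mat F' G' * dsum_mat F G = dsum_mat (F' * F) (G' * G)"
  unfolding dsum_mat_def
  using assms by (subst mult_four_block_mat[of _ "dim_row F'" "dim_row F" _ "dim_row G" _ "dim_row G'"
        _ _ "dim_col F" _ "dim_col G"]) auto

lemma dsum_mat_plus:
  "dim_row F = dim_row F' \<Longrightarrow> dim_col F = dim_col F' \<Longrightarrow> dim_row G = dim_row G' \<Longrightarrow>
   dim_col G = dim_col G' \<Longrightarrow> dsum_mat (F + F') (G + G') = dsum_mat F G + dsum_mat F' G'"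
  by (auto simp: dsum_mat_def intro!: eq_matI)

lemma dsum_mat_zero: "dsum_mat (0\<^sub>m a b) (0\<^sub>m c d) = 0\<^sub>m (a + c) (b + d)"
  by (auto simp: dsum_mat_def intro!: eq_matI)

lemma dsum_mat_smult: "dsum_mat (c \<cdot>\<^sub>m F) (c \<cdot>\<^sub>m G) = c \<cdot>\<^sub>m dsum_mat F G"
  by (auto simp: dsum_mat_def intro!: eq_matI)

lemma dsum_mat_empty:
  "dim_row G = 0 \<Longrightarrow> dim_col G = 0 \<Longrightarrow> dsum_mat F G = F"
  "dim_row G = 0 \<Longrightarrow> dim_col G = 0 \<Longrightarrow> dsum_mat G F = F"
  by (auto simp: dsum_mat_def intro!: eq_matI)

lemma any_prod_comp [simp]:
  "any_dom f' = any_cod f \<Longrightarrow> any_dom g' = any_cod g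
   \<Longrightarrow> (f' \<boxtimes>\<^sub>F g') \<cdot>\<^sub>F (f \<boxtimes>\<^sub>F g) = (f' \<cdot>\<^sub>F f) \<boxtimes>\<^sub>F (g' \<cdot>\<^sub>F g)"
  by (simp add: any_prod_mor_def any_comp_def any_dom_def any_cod_def dsum_mat_mult kronecker_mult)

text \<open>
  Composites are normalised to the right, so the interchange law is also needed in front of a further factor.
\<close>
lemma any_prod_comp_reassoc [simp]:
  assumes "any_dom f' = any_cod f" "any_dom g' = any_cod g" "any_dom f \<otimes>\<^sub>F any_dom g = any_cod h"
  shows "(f' \<boxtimes>\<^sub>F g') \<cdot>\<^sub>F ((f \<boxtimes>\<^sub>F g) \<cdot>\<^sub>F h) = ((f' \<cdot>\<^sub>F f) \<boxtimes>\<^sub>F (g' \<cdot>\<^sub>F g)) \<cdot>\<^sub>F h"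
proof -
  have "(f' \<boxtimes>\<^sub>F g') \<cdot>\<^sub>F ((f \<boxtimes>\<^sub>F g) \<cdot>\<^sub>F h) = ((f' \<boxtimes>\<^sub>F g') \<cdot>\<^sub>F (f \<boxtimes>\<^sub>F g)) \<cdot>\<^sub>F h"
    using assms by (subst any_comp_assoc) auto
  then show ?thesis using assms by simp
qed

lemma any_prod_plus_left:
  "any_dom f = any_dom f' \<Longrightarrow> any_cod f = any_cod f' \<Longrightarrow> (f +\<^sub>F f') \<boxtimes>\<^sub>F g = f \<boxtimes>\<^sub>F g +\<^sub>F f' \<boxtimes>\<^sub>F g"
  by (simp add: any_prod_mor_def any_plus_def any_dom_def any_cod_def dsum_mat_plus kronecker_plus_left)

lemma any_prod_plus_right:
  "any_dom g = any_dom g' \<Longrightarrow> any_cod g = any_cod g' \<Longrightarrow> f \<boxtimes>\<^sub>F (g +\<^sub>F g') = f \<boxtimes>\<^sub>F g +\<^sub>F f \<boxtimes>\<^sub>F g'"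
  by (simp add: any_prod_mor_def any_plus_def any_dom_def any_cod_def dsum_mat_plus kronecker_plus_right)

lemma any_prod_zero_left [simp]:
  "any_zero_mor A B \<boxtimes>\<^sub>F g = any_zero_mor (A \<otimes>\<^sub>F any_dom g) (B \<otimes>\<^sub>F any_cod g)"
  by (simp add: any_prod_mor_def any_zero_mor_def any_dom_def any_cod_def any_prod_def dsum_mat_zero
      kronecker_zero_left)

lemma any_prod_zero_right [simp]:
  "g \<boxtimes>\<^sub>F any_zero_mor A B = any_zero_mor (any_dom g \<otimes>\<^sub>F A) (any_cod g \<otimes>\<^sub>F B)"
  by (simp add: any_prod_mor_def any_zero_mor_def any_dom_def any_cod_def any_prod_def dsum_mat_zero
      kronecker_zero_right)

lemma any_prod_smult:
  "(c *\<^sub>F f) \<boxtimes>\<^sub>F g = c *\<^sub>F (f \<boxtimes>\<^sub>F g)" "f \<boxtimes>\<^sub>F (c *\<^sub>F g) = c *\<^sub>F (f \<boxtimes>\<^sub>F g)"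
  by (simp_all add: any_prod_mor_def any_smult_def kronecker_smult dsum_mat_smult)

lemma any_smult_simps [simp]:
  "c *\<^sub>F d *\<^sub>F f = (c * d) *\<^sub>F f" "c *\<^sub>F any_zero_mor A B = any_zero_mor A B"
  by (auto simp: any_smult_def any_zero_mor_def intro!: eq_matI)

declare any_prod_id [simp]

lemma vacuum_prod_mor [simp]: "any_id vacuum \<boxtimes>\<^sub>F f = f" "f \<boxtimes>\<^sub>F any_id vacuum = f"
  by (cases f; simp add: any_prod_mor_def any_id_def vacuum_def kronecker_one_unit dsum_mat_empty
      kronecker_one_unit[simplified])+

declare vacuum_unit [simp]

lemma zero_prod_ob [simp]: "any_zero \<otimes>\<^sub>F A = any_zero" "A \<otimes>\<^sub>F any_zero = any_zero"
  by (auto simp: any_prod_def any_zero_def)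

section \<open>Biproduct decompositions\<close>

text \<open>
  The object \<open>D\<close> is the biproduct of the objects \<open>any_dom (\<iota> i)\<close> with inclusions \<open>\<iota>\<close> and projections \<open>\<pi>\<close>.
\<close>
definition decomp :: "anyon_ob \<Rightarrow> 'i set \<Rightarrow> ('i \<Rightarrow> anyon_mor) \<Rightarrow> ('i \<Rightarrow> anyon_mor) \<Rightarrow> bool" where
  "decomp D I \<iota> \<pi> \<longleftrightarrow> finite I
     \<and> (\<forall>i\<in>I. any_cod (\<iota> i) = D \<and> any_dom (\<pi> i) = D \<and> any_cod (\<pi> i) = any_dom (\<iota> i))
     \<and> (\<forall>i\<in>I. \<forall>j\<in>I. \<pi> i \<cdot>\<^sub>F \<iota> j =
          (if i = j then any_id (any_dom (\<iota> i)) else any_zero_mor (any_dom (\<iota> j)) (any_dom (\<iota> i))))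
     \<and> any_Sum D D (\<lambda>i. \<iota> i \<cdot>\<^sub>F \<pi> i) I = any_id D"

lemma decompD:
  assumes "decomp D I \<iota> \<pi>"
  shows "finite I" "i \<in> I \<Longrightarrow> any_cod (\<iota> i) = D" "i \<in> I \<Longrightarrow> any_dom (\<pi> i) = D"
    "i \<in> I \<Longrightarrow> any_cod (\<pi> i) = any_dom (\<iota> i)"
    "i \<in> I \<Longrightarrow> \<pi> i \<cdot>\<^sub>F \<iota> i = any_id (any_dom (\<iota> i))"
    "i \<in> I \<Longrightarrow> j \<in> I \<Longrightarrow> i \<noteq> j \<Longrightarrow> \<pi> i \<cdot>\<^sub>F \<iota> j = any_zero_mor (any_dom (\<iota> j)) (any_dom (\<iota> i))"
    "any_Sum D D (\<lambda>i. \<iota> i \<cdot>\<^sub>F \<pi> i) I = any_id D"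
  using assms unfolding decomp_def by auto

lemma finite_summands [simp]: "finite (summands A)"
  by (simp add: summands_def)

lemma pr_in_simple:
  assumes "a \<in> summands A" "b \<in> summands A"
  shows "any_pr A a \<cdot>\<^sub>F any_in A b =
    (if a = b then any_id (simple_ob (fst a)) else any_zero_mor (simple_ob (fst b)) (simple_ob (fst a)))"
proof (cases a; cases b)
  fix s k t l assume ab: "a = (s, k)" "b = (t, l)"
  show ?thesis
    using assms unfolding ab summands_def
    by (cases s; cases t; cases "k = l"; intro any_mor_eqI)
      (simp_all add: vacuum_def tau_def any_pr_def any_in_def any_comp_def any_transpose_def any_id_def
        any_zero_mor_def scalar_prod_def any_dom_def any_cod_def)
qed

lemma in_pr_simple_vac:
  assumes "i < fst A" "j < fst A"
  shows "fst (any_in A a \<cdot>\<^sub>F any_pr A a) $$ (i, j) = of_bool (a = (Vac, i) \<and> i = j)"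
  using assms by (cases a; cases "fst a")
    (auto simp: vacuum_def tau_def any_pr_def any_in_def any_comp_def any_transpose_def scalar_prod_def)

lemma in_pr_simple_tau:
  assumes "i < snd A" "j < snd A"
  shows "snd (any_in A a \<cdot>\<^sub>F any_pr A a) $$ (i, j) = of_bool (a = (Tau, i) \<and> i = j)"
  using assms by (cases a; cases "fst a")
    (auto simp: vacuum_def tau_def any_pr_def any_in_def any_comp_def any_transpose_def scalar_prod_def)

lemma simple_decomp: "decomp A (summands A) (any_in A) (any_pr A)"
proof -
  have "any_Sum A A (\<lambda>a. any_in A a \<cdot>\<^sub>F any_pr A a) (summands A) = any_id A"
  proof (rule any_mor_eqI)
    fix i j assume ij: "i < fst (any_cod (any_id A))" "j < fst (any_dom (any_id A))"
    then have "(\<Sum>a\<in>summands A. fst (any_in A a \<cdot>\<^sub>F any_pr A a) $$ (i, j))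
       = (\<Sum>a\<in>summands A. if a = (Vac, i) then of_bool (i = j) else 0)"
      by (intro sum.cong) (auto simp: in_pr_simple_vac)
    also have "\<dots> = of_bool (i = j)"
      using ij by (simp add: summands_def)
    finally show "fst (any_Sum A A (\<lambda>a. any_in A a \<cdot>\<^sub>F any_pr A a) (summands A)) $$ (i, j)
        = fst (any_id A) $$ (i, j)"
      using ij by (simp add: any_Sum_def any_id_def any_dom_def any_cod_def)
  next
    fix i j assume ij: "i < snd (any_cod (any_id A))" "j < snd (any_dom (any_id A))"
    then have "(\<Sum>a\<in>summands A. snd (any_in A a \<cdot>\<^sub>F any_pr A a) $$ (i, j))
       = (\<Sum>a\<in>summands A. if a = (Tau, i) then of_bool (i = j) else 0)"
      by (intro sum.cong) (auto simp: in_pr_simple_tau)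
    also have "\<dots> = of_bool (i = j)"
      using ij by (simp add: summands_def)
    finally show "snd (any_Sum A A (\<lambda>a. any_in A a \<cdot>\<^sub>F any_pr A a) (summands A)) $$ (i, j)
        = snd (any_id A) $$ (i, j)"
      using ij by (simp add: any_Sum_def any_id_def any_dom_def any_cod_def)
  qed simp_all
  then show ?thesis
    by (simp add: decomp_def pr_in_simple)
qed

text \<open>
  Bilinearity: \<open>1 \<otimes> 1 = (\<Sum> \<iota> \<pi>) \<otimes> (\<Sum> \<kappa> \<rho>)\<close> expands to the sum of all \<open>(\<iota> \<otimes> \<kappa>) (\<pi> \<otimes> \<rho>)\<close>.
\<close>
lemma decomp_prod:
  assumes "decomp A I \<iota> \<pi>" "decomp B J \<kappa> \<rho>"
  shows "decomp (A \<otimes>\<^sub>F B) (I \<times> J) (\<lambda>(i, j). \<iota> i \<boxtimes>\<^sub>F \<kappa> j) (\<lambda>(i, j). \<pi> i \<boxtimes>\<^sub>F \<rho> j)"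
  unfolding decomp_def
proof (intro conjI ballI)
  note [simp] = decompD[OF assms(1)] decompD[OF assms(2)]
  show "finite (I \<times> J)" by simp
  fix p assume p: "p \<in> I \<times> J"
  show "any_cod ((\<lambda>(i, j). \<iota> i \<boxtimes>\<^sub>F \<kappa> j) p) = A \<otimes>\<^sub>F B" "any_dom ((\<lambda>(i, j). \<pi> i \<boxtimes>\<^sub>F \<rho> j) p) = A \<otimes>\<^sub>F B"
    "any_cod ((\<lambda>(i, j). \<pi> i \<boxtimes>\<^sub>F \<rho> j) p) = any_dom ((\<lambda>(i, j). \<iota> i \<boxtimes>\<^sub>F \<kappa> j) p)"
    using p by auto
  fix q assume q: "q \<in> I \<times> J"
  show "(\<lambda>(i, j). \<pi> i \<boxtimes>\<^sub>F \<rho> j) p \<cdot>\<^sub>F (\<lambda>(i, j). \<iota> i \<boxtimes>\<^sub>F \<kappa> j) q =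
     (if p = q then any_id (any_dom ((\<lambda>(i, j). \<iota> i \<boxtimes>\<^sub>F \<kappa> j) p))
      else any_zero_mor (any_dom ((\<lambda>(i, j). \<iota> i \<boxtimes>\<^sub>F \<kappa> j) q)) (any_dom ((\<lambda>(i, j). \<iota> i \<boxtimes>\<^sub>F \<kappa> j) p)))"
  proof (cases p; cases q)
    fix i j i' j' assume "p = (i, j)" "q = (i', j')"
    with p q show ?thesis
      by (cases "i = i'"; cases "j = j'") simp_all
  qed
next
  note [simp] = decompD[OF assms(1)] decompD[OF assms(2)]
  let ?f = "\<lambda>i. \<iota> i \<cdot>\<^sub>F \<pi> i" and ?g = "\<lambda>j. \<kappa> j \<cdot>\<^sub>F \<rho> j"
  have "any_id (A \<otimes>\<^sub>F B) = any_Sum A A ?f I \<boxtimes>\<^sub>F any_Sum B B ?g J"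
    by simp
  also have "\<dots> = any_Sum (A \<otimes>\<^sub>F B) (A \<otimes>\<^sub>F B) (\<lambda>i. ?f i \<boxtimes>\<^sub>F any_Sum B B ?g J) I"
    by (intro any_Sum_additive) (simp_all add: any_prod_plus_left del: decompD(7))
  also have "\<dots> = any_Sum (A \<otimes>\<^sub>F B) (A \<otimes>\<^sub>F B)
      (\<lambda>i. any_Sum (A \<otimes>\<^sub>F B) (A \<otimes>\<^sub>F B) (\<lambda>j. ?f i \<boxtimes>\<^sub>F ?g j) J) I"
    by (intro any_Sum_cong any_Sum_additive refl) (simp_all add: any_prod_plus_right)
  also have "\<dots> = any_Sum (A \<otimes>\<^sub>F B) (A \<otimes>\<^sub>F B) (\<lambda>(i, j). ?f i \<boxtimes>\<^sub>F ?g j) (I \<times> J)"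
    by (rule any_Sum_nested) simp_all
  also have "\<dots> = any_Sum (A \<otimes>\<^sub>F B) (A \<otimes>\<^sub>F B)
      (\<lambda>p. (\<lambda>(i, j). \<iota> i \<boxtimes>\<^sub>F \<kappa> j) p \<cdot>\<^sub>F (\<lambda>(i, j). \<pi> i \<boxtimes>\<^sub>F \<rho> j) p) (I \<times> J)"
    by (intro any_Sum_cong refl) auto
  finally show "any_Sum (A \<otimes>\<^sub>F B) (A \<otimes>\<^sub>F B)
      (\<lambda>p. (\<lambda>(i, j). \<iota> i \<boxtimes>\<^sub>F \<kappa> j) p \<cdot>\<^sub>F (\<lambda>(i, j). \<pi> i \<boxtimes>\<^sub>F \<rho> j) p) (I \<times> J) = any_id (A \<otimes>\<^sub>F B)"
    by simp
qed

lemma decomp_reindex: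
  assumes D: "decomp D I \<iota> \<pi>" and r: "bij_betw r J I"
  shows "decomp D J (\<lambda>j. \<iota> (r j)) (\<lambda>j. \<pi> (r j))"
proof -
  have inj: "inj_on r J" and im: "r ` J = I" using r by (auto simp: bij_betw_def)
  have mem: "j \<in> J \<Longrightarrow> r j \<in> I" for j using im by auto
  have eq: "i \<in> J \<Longrightarrow> j \<in> J \<Longrightarrow> r i = r j \<longleftrightarrow> i = j" for i j
    using inj by (auto dest: inj_onD)
  have "finite J" using decompD(1)[OF D] bij_betw_finite[OF r] by simp
  moreover have "any_Sum D D (\<lambda>j. \<iota> (r j) \<cdot>\<^sub>F \<pi> (r j)) J = any_id D"
    unfolding decompD(7)[OF D, symmetric] im[symmetric] by (rule any_Sum_reindex[OF inj, symmetric])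
  ultimately show ?thesis
    using D mem eq by (auto simp: decomp_def)
qed

lemma decomp_joint_epi:
  assumes D: "decomp D I \<iota> \<pi>" and "any_dom f = D" "any_dom g = D"
    and eq: "\<And>i. i \<in> I \<Longrightarrow> f \<cdot>\<^sub>F \<iota> i = g \<cdot>\<^sub>F \<iota> i" and ne: "any_cod f = any_cod g"
  shows "f = g"
proof -
  note [simp] = decompD(1-6)[OF D]
  have split: "h = any_Sum D (any_cod h) (\<lambda>i. (h \<cdot>\<^sub>F \<iota> i) \<cdot>\<^sub>F \<pi> i) I" if h: "any_dom h = D" for h
  proof -
    have "h = h \<cdot>\<^sub>F any_Sum D D (\<lambda>i. \<iota> i \<cdot>\<^sub>F \<pi> i) I"
      using h by (simp add: decompD(7)[OF D])
    also have "\<dots> = any_Sum D (any_cod h) (\<lambda>i. h \<cdot>\<^sub>F (\<iota> i \<cdot>\<^sub>F \<pi> i)) I"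
      using h by (intro any_comp_Sum_right) auto
    also have "\<dots> = any_Sum D (any_cod h) (\<lambda>i. (h \<cdot>\<^sub>F \<iota> i) \<cdot>\<^sub>F \<pi> i) I"
      using h by (intro any_Sum_cong refl) simp
    finally show ?thesis .
  qed
  have "any_Sum D (any_cod f) (\<lambda>i. (f \<cdot>\<^sub>F \<iota> i) \<cdot>\<^sub>F \<pi> i) I = any_Sum D (any_cod g) (\<lambda>i. (g \<cdot>\<^sub>F \<iota> i) \<cdot>\<^sub>F \<pi> i) I"
    unfolding ne by (intro any_Sum_cong refl arg_cong2[where f = any_comp] eq)
  then show ?thesis using split[of f] split[of g] assms by simp
qed

lemma decomp_joint_mono:
  assumes D: "decomp D I \<iota> \<pi>" and "any_cod f = D" "any_cod g = D"
    and eq: "\<And>i. i \<in> I \<Longrightarrow> \<pi> i \<cdot>\<^sub>F f = \<pi> i \<cdot>\<^sub>F g" and ne: "any_dom f = any_dom g"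
  shows "f = g"
proof -
  note [simp] = decompD(1-6)[OF D]
  have split: "h = any_Sum (any_dom h) D (\<lambda>i. \<iota> i \<cdot>\<^sub>F (\<pi> i \<cdot>\<^sub>F h)) I" if h: "any_cod h = D" for h
  proof -
    have "h = any_Sum D D (\<lambda>i. \<iota> i \<cdot>\<^sub>F \<pi> i) I \<cdot>\<^sub>F h"
      using h by (simp add: decompD(7)[OF D])
    also have "\<dots> = any_Sum (any_dom h) D (\<lambda>i. (\<iota> i \<cdot>\<^sub>F \<pi> i) \<cdot>\<^sub>F h) I"
      using h by (intro any_comp_Sum_left) auto
    also have "\<dots> = any_Sum (any_dom h) D (\<lambda>i. \<iota> i \<cdot>\<^sub>F (\<pi> i \<cdot>\<^sub>F h)) I"
      using h by (intro any_Sum_cong refl) simp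
    finally show ?thesis .
  qed
  have "any_Sum (any_dom f) D (\<lambda>i. \<iota> i \<cdot>\<^sub>F (\<pi> i \<cdot>\<^sub>F f)) I = any_Sum (any_dom g) D (\<lambda>i. \<iota> i \<cdot>\<^sub>F (\<pi> i \<cdot>\<^sub>F g)) I"
    unfolding ne by (intro any_Sum_cong refl arg_cong2[where f = any_comp] eq)
  then show ?thesis using split[of f] split[of g] assms by simp
qed

text \<open>
  The morphism \<open>\<Phi>\<close> is the diagonal one with entries \<open>\<phi>\<close>; the relations \<open>\<pi>\<^sub>j \<iota>\<^sub>i = 0\<close> for \<open>j \<noteq> i\<close> leave a
  single summand of its composite with an inclusion or a projection.
\<close>
lemma
  assumes D: "decomp D I \<iota> \<pi>" and E: "decomp E I \<kappa> \<rho>"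
    and \<phi>: "\<And>i. i \<in> I \<Longrightarrow> any_dom (\<phi> i) = any_dom (\<iota> i) \<and> any_cod (\<phi> i) = any_dom (\<kappa> i)"
    and i: "i \<in> I"
  defines "\<Phi> \<equiv> any_Sum D E (\<lambda>i. \<kappa> i \<cdot>\<^sub>F \<phi> i \<cdot>\<^sub>F \<pi> i) I"
  shows extension_in: "\<Phi> \<cdot>\<^sub>F \<iota> i = \<kappa> i \<cdot>\<^sub>F \<phi> i" and extension_pr: "\<rho> i \<cdot>\<^sub>F \<Phi> = \<phi> i \<cdot>\<^sub>F \<pi> i"
proof -
  note [simp] = decompD(1-6)[OF D] decompD(1-6)[OF E] i
  have [simp]: "any_dom (\<phi> j) = any_dom (\<iota> j)" "any_cod (\<phi> j) = any_dom (\<kappa> j)" if "j \<in> I" for j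
    using \<phi> that by auto
  have "\<Phi> \<cdot>\<^sub>F \<iota> i = any_Sum (any_dom (\<iota> i)) E (\<lambda>j. (\<kappa> j \<cdot>\<^sub>F \<phi> j \<cdot>\<^sub>F \<pi> j) \<cdot>\<^sub>F \<iota> i) I"
    unfolding \<Phi>_def by (intro any_comp_Sum_left) auto
  also have "\<dots> = (\<kappa> i \<cdot>\<^sub>F \<phi> i \<cdot>\<^sub>F \<pi> i) \<cdot>\<^sub>F \<iota> i"
    by (intro any_Sum_single) auto
  finally show "\<Phi> \<cdot>\<^sub>F \<iota> i = \<kappa> i \<cdot>\<^sub>F \<phi> i" by simp
  have "\<rho> i \<cdot>\<^sub>F \<Phi> = any_Sum D (any_cod (\<rho> i)) (\<lambda>j. \<rho> i \<cdot>\<^sub>F (\<kappa> j \<cdot>\<^sub>F \<phi> j \<cdot>\<^sub>F \<pi> j)) I"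
    unfolding \<Phi>_def by (intro any_comp_Sum_right) auto
  also have "\<dots> = any_Sum D (any_cod (\<rho> i)) (\<lambda>j. (\<rho> i \<cdot>\<^sub>F \<kappa> j) \<cdot>\<^sub>F (\<phi> j \<cdot>\<^sub>F \<pi> j)) I"
    by (intro any_Sum_cong refl) (simp del: decompD(5,6))
  also have "\<dots> = (\<rho> i \<cdot>\<^sub>F \<kappa> i) \<cdot>\<^sub>F (\<phi> i \<cdot>\<^sub>F \<pi> i)"
    by (intro any_Sum_single) auto
  finally show "\<rho> i \<cdot>\<^sub>F \<Phi> = \<phi> i \<cdot>\<^sub>F \<pi> i" by simp
qed

section \<open>Associativity and braiding as natural transformations\<close>

text \<open>
  An equation \<open>\<Phi>' u = v \<Phi>\<close> between diagonal morphisms may be checked entry by entry: each entry of \<open>u\<close> and of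
  \<open>v\<close> has to commute with the entries of \<open>\<Phi>\<close> and \<open>\<Phi>'\<close>.
\<close>
lemma natural_extension:
  assumes D: "decomp D I \<iota> \<pi>" and E': "decomp E' I' \<kappa>' \<rho>'"
    and in_ext: "\<And>i. i \<in> I \<Longrightarrow> \<Phi> \<cdot>\<^sub>F \<iota> i = \<kappa> i \<cdot>\<^sub>F \<phi> i"
    and pr_ext: "\<And>i. i \<in> I' \<Longrightarrow> \<rho>' i \<cdot>\<^sub>F \<Phi>' = \<phi>' i \<cdot>\<^sub>F \<pi>' i"
    and [simp]: "any_dom \<Phi> = D" "any_cod \<Phi> = any_dom v" "any_dom \<Phi>' = any_cod u" "any_cod \<Phi>' = E'"
      "any_dom u = D" "any_cod v = E'"
    and \<kappa>: "\<And>i. i \<in> I \<Longrightarrow> any_cod (\<kappa> i) = any_dom v \<and> any_dom (\<kappa> i) = any_cod (\<phi> i)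
        \<and> any_dom (\<phi> i) = any_dom (\<iota> i)"
    and \<pi>': "\<And>i. i \<in> I' \<Longrightarrow> any_dom (\<pi>' i) = any_cod u \<and> any_cod (\<pi>' i) = any_dom (\<phi>' i)
        \<and> any_cod (\<phi>' i) = any_cod (\<rho>' i)"
    and core: "\<And>i i'. i \<in> I \<Longrightarrow> i' \<in> I' \<Longrightarrow>
        \<phi>' i' \<cdot>\<^sub>F (\<pi>' i' \<cdot>\<^sub>F (u \<cdot>\<^sub>F \<iota> i)) = (\<rho>' i' \<cdot>\<^sub>F (v \<cdot>\<^sub>F \<kappa> i)) \<cdot>\<^sub>F \<phi> i"
  shows "\<Phi>' \<cdot>\<^sub>F u = v \<cdot>\<^sub>F \<Phi>"
proof (rule decomp_joint_epi[OF D])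
  fix i assume i: "i \<in> I"
  note [simp] = decompD(2-4)[OF D] decompD(2-4)[OF E'] i
  show "\<Phi>' \<cdot>\<^sub>F u \<cdot>\<^sub>F \<iota> i = v \<cdot>\<^sub>F \<Phi> \<cdot>\<^sub>F \<iota> i"
  proof (rule decomp_joint_mono[OF E'])
    fix i' assume i': "i' \<in> I'"
    note [simp] = i' \<kappa>[OF i] \<pi>'[OF i']
    have "\<rho>' i' \<cdot>\<^sub>F (\<Phi>' \<cdot>\<^sub>F u \<cdot>\<^sub>F \<iota> i) = (\<rho>' i' \<cdot>\<^sub>F \<Phi>') \<cdot>\<^sub>F (u \<cdot>\<^sub>F \<iota> i)"
      using \<pi>'[OF i'] by simp
    also have "\<dots> = \<phi>' i' \<cdot>\<^sub>F (\<pi>' i' \<cdot>\<^sub>F (u \<cdot>\<^sub>F \<iota> i))"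
      using \<pi>'[OF i'] pr_ext[OF i'] by simp
    also have "\<dots> = \<rho>' i' \<cdot>\<^sub>F (v \<cdot>\<^sub>F (\<kappa> i \<cdot>\<^sub>F \<phi> i))"
      using core[OF i i'] \<kappa>[OF i] by simp
    also have "\<dots> = \<rho>' i' \<cdot>\<^sub>F (v \<cdot>\<^sub>F \<Phi> \<cdot>\<^sub>F \<iota> i)"
      using in_ext[OF i] by simp
    finally show "\<rho>' i' \<cdot>\<^sub>F (\<Phi>' \<cdot>\<^sub>F u \<cdot>\<^sub>F \<iota> i) = \<rho>' i' \<cdot>\<^sub>F (v \<cdot>\<^sub>F \<Phi> \<cdot>\<^sub>F \<iota> i)" .
  qed simp_all
qed simp_all

text \<open>Schur's lemma for the two simple objects.\<close>
lemma simple_hom_cases: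
  assumes "any_dom f = simple_ob s" "any_cod f = simple_ob t"
  obtains c where "s = t" "f = c *\<^sub>F any_id (simple_ob s)"
    | "s \<noteq> t" "f = any_zero_mor (simple_ob s) (simple_ob t)"
proof (cases "s = t")
  case True
  have "f = (case s of Vac \<Rightarrow> fst f $$ (0, 0) | Tau \<Rightarrow> snd f $$ (0, 0)) *\<^sub>F any_id (simple_ob s)"
    by (rule any_mor_eqI) (use assms True in \<open>cases s;
      auto simp: any_smult_def any_id_def vacuum_def tau_def any_dom_def any_cod_def\<close>)+
  then show thesis using True that(1) by blast
next
  case False
  have "f = any_zero_mor (simple_ob s) (simple_ob t)"
    by (rule any_mor_eqI) (use assms False in \<open>cases s; cases t;
      auto simp: any_zero_mor_def vacuum_def tau_def any_dom_def any_cod_def\<close>)+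
  then show thesis using False that(2) by blast
qed

lemma prod_ob_assoc: "A \<otimes>\<^sub>F B \<otimes>\<^sub>F C = A \<otimes>\<^sub>F (B \<otimes>\<^sub>F C)"
  by (simp add: any_prod_def algebra_simps)

lemma simple_iso_dim [simp]:
  "any_dom (simple_assoc s t u) = simple_ob s \<otimes>\<^sub>F simple_ob t \<otimes>\<^sub>F simple_ob u"
  "any_cod (simple_assoc s t u) = simple_ob s \<otimes>\<^sub>F (simple_ob t \<otimes>\<^sub>F simple_ob u)"
  "any_dom (simple_braid s t) = simple_ob s \<otimes>\<^sub>F simple_ob t"
  "any_cod (simple_braid s t) = simple_ob t \<otimes>\<^sub>F simple_ob s"
  using simple_assoc_hom simple_braid_hom by (auto simp: any_hom_iff)

text \<open>
  If the three morphisms are scalars, both sides are the same multiple of \<open>simple_assoc\<close>; if one of them is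
  zero, so are both sides.
\<close>
lemma simple_assoc_natural:
  assumes "any_dom f = simple_ob s" "any_cod f = simple_ob s'" "any_dom g = simple_ob t"
    "any_cod g = simple_ob t'" "any_dom h = simple_ob u" "any_cod h = simple_ob u'"
  shows "simple_assoc s' t' u' \<cdot>\<^sub>F (f \<boxtimes>\<^sub>F g \<boxtimes>\<^sub>F h) = (f \<boxtimes>\<^sub>F (g \<boxtimes>\<^sub>F h)) \<cdot>\<^sub>F simple_assoc s t u"
  using assms(1,2)
proof (cases rule: simple_hom_cases)
  case f: (1 c)
  show ?thesis using assms(3,4)
  proof (cases rule: simple_hom_cases)
    case g: (1 d)
    show ?thesis using assms(5,6)
      by (cases rule: simple_hom_cases)
        (simp_all add: f g any_prod_smult any_comp_smult_left any_comp_smult_right mult.assoc)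
  qed (simp add: assms)
qed (simp add: assms)

lemma simple_braid_natural:
  assumes "any_dom f = simple_ob s" "any_cod f = simple_ob s'" "any_dom g = simple_ob t"
    "any_cod g = simple_ob t'"
  shows "simple_braid s' t' \<cdot>\<^sub>F (f \<boxtimes>\<^sub>F g) = (g \<boxtimes>\<^sub>F f) \<cdot>\<^sub>F simple_braid s t"
  using assms(1,2)
proof (cases rule: simple_hom_cases)
  case f: (1 c)
  show ?thesis using assms(3,4)
    by (cases rule: simple_hom_cases)
      (simp_all add: f any_prod_smult any_comp_smult_left any_comp_smult_right mult.commute)
qed (simp add: assms)

text \<open>
  Both bracketings of a triple product are indexed by the same triples of summands, and below both orders of a
  product by the same pairs, so that associativity and braiding are diagonal.
\<close>
lemma simple_decomp_left: "decomp (A \<otimes>\<^sub>F B \<otimes>\<^sub>F C) (summands A \<times> summands B \<times> summands C)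
   (\<lambda>(a, b, c). any_in A a \<boxtimes>\<^sub>F any_in B b \<boxtimes>\<^sub>F any_in C c)
   (\<lambda>(a, b, c). any_pr A a \<boxtimes>\<^sub>F any_pr B b \<boxtimes>\<^sub>F any_pr C c)"
proof -
  have "bij_betw (\<lambda>(a, b, c). ((a, b), c)) (summands A \<times> summands B \<times> summands C)
      ((summands A \<times> summands B) \<times> summands C)"
    by (rule bij_betw_byWitness[where f' = "\<lambda>((a, b), c). (a, b, c)"]) auto
  from decomp_reindex[OF decomp_prod[OF decomp_prod[OF simple_decomp simple_decomp] simple_decomp] this]
  show ?thesis by (simp add: case_prod_unfold)
qed

lemma simple_decomp_right: "decomp (A \<otimes>\<^sub>F (B \<otimes>\<^sub>F C)) (summands A \<times> summands B \<times> summands C)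
   (\<lambda>(a, b, c). any_in A a \<boxtimes>\<^sub>F (any_in B b \<boxtimes>\<^sub>F any_in C c))
   (\<lambda>(a, b, c). any_pr A a \<boxtimes>\<^sub>F (any_pr B b \<boxtimes>\<^sub>F any_pr C c))"
  using decomp_prod[OF simple_decomp decomp_prod[OF simple_decomp simple_decomp]]
  by (simp add: case_prod_unfold)

lemma simple_decomp_prod: "decomp (A \<otimes>\<^sub>F B) (summands A \<times> summands B)
   (\<lambda>(a, b). any_in A a \<boxtimes>\<^sub>F any_in B b) (\<lambda>(a, b). any_pr A a \<boxtimes>\<^sub>F any_pr B b)"
  by (rule decomp_prod[OF simple_decomp simple_decomp])

lemma simple_decomp_swap: "decomp (B \<otimes>\<^sub>F A) (summands A \<times> summands B)
   (\<lambda>(a, b). any_in B b \<boxtimes>\<^sub>F any_in A a) (\<lambda>(a, b). any_pr B b \<boxtimes>\<^sub>F any_pr A a)"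
proof -
  have "bij_betw (\<lambda>(a, b). (b, a)) (summands A \<times> summands B) (summands B \<times> summands A)"
    by (auto simp: bij_betw_def inj_on_def)
  from decomp_reindex[OF simple_decomp_prod this]
  show ?thesis by (simp add: case_prod_unfold)
qed

lemma prod_iso_dim [simp]:
  "any_dom (any_prod_assoc A B C) = A \<otimes>\<^sub>F B \<otimes>\<^sub>F C"
  "any_cod (any_prod_assoc A B C) = A \<otimes>\<^sub>F (B \<otimes>\<^sub>F C)"
  "any_dom (any_prod_braid A B) = A \<otimes>\<^sub>F B"
  "any_cod (any_prod_braid A B) = B \<otimes>\<^sub>F A"
  by (simp_all add: any_prod_assoc_def any_prod_braid_def)

lemma
  assumes "a \<in> summands A" "b \<in> summands B" "c \<in> summands C"
  shows assoc_in: "any_prod_assoc A B C \<cdot>\<^sub>F (any_in A a \<boxtimes>\<^sub>F any_in B b \<boxtimes>\<^sub>F any_in C c)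
      = (any_in A a \<boxtimes>\<^sub>F (any_in B b \<boxtimes>\<^sub>F any_in C c)) \<cdot>\<^sub>F simple_assoc (fst a) (fst b) (fst c)"
    and assoc_pr: "(any_pr A a \<boxtimes>\<^sub>F (any_pr B b \<boxtimes>\<^sub>F any_pr C c)) \<cdot>\<^sub>F any_prod_assoc A B C
      = simple_assoc (fst a) (fst b) (fst c) \<cdot>\<^sub>F (any_pr A a \<boxtimes>\<^sub>F any_pr B b \<boxtimes>\<^sub>F any_pr C c)"
  using assms
    extension_in[OF simple_decomp_left[of A B C] simple_decomp_right[of A B C],
      of "\<lambda>(a, b, c). simple_assoc (fst a) (fst b) (fst c)" "(a, b, c)"]
    extension_pr[OF simple_decomp_left[of A B C] simple_decomp_right[of A B C],
      of "\<lambda>(a, b, c). simple_assoc (fst a) (fst b) (fst c)" "(a, b, c)"]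
  by (simp_all add: any_prod_assoc_def case_prod_unfold)

lemma
  assumes "a \<in> summands A" "b \<in> summands B"
  shows braid_in: "any_prod_braid A B \<cdot>\<^sub>F (any_in A a \<boxtimes>\<^sub>F any_in B b)
      = (any_in B b \<boxtimes>\<^sub>F any_in A a) \<cdot>\<^sub>F simple_braid (fst a) (fst b)"
    and braid_pr: "(any_pr B b \<boxtimes>\<^sub>F any_pr A a) \<cdot>\<^sub>F any_prod_braid A B
      = simple_braid (fst a) (fst b) \<cdot>\<^sub>F (any_pr A a \<boxtimes>\<^sub>F any_pr B b)"
  using assms
    extension_in[OF simple_decomp_prod[of A B] simple_decomp_swap[of B A],
      of "\<lambda>(a, b). simple_braid (fst a) (fst b)" "(a, b)"]
    extension_pr[OF simple_decomp_prod[of A B] simple_decomp_swap[of B A],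
      of "\<lambda>(a, b). simple_braid (fst a) (fst b)" "(a, b)"]
  by (simp_all add: any_prod_braid_def case_prod_unfold)

lemma assoc_natural:
  assumes [simp]: "any_cod f = A" "any_cod g = B" "any_cod h = C"
  shows "any_prod_assoc A B C \<cdot>\<^sub>F (f \<boxtimes>\<^sub>F g \<boxtimes>\<^sub>F h)
    = (f \<boxtimes>\<^sub>F (g \<boxtimes>\<^sub>F h)) \<cdot>\<^sub>F any_prod_assoc (any_dom f) (any_dom g) (any_dom h)"
proof (rule natural_extension[OF simple_decomp_left simple_decomp_right,
      where \<kappa> = "\<lambda>(a, b, c). any_in (any_dom f) a \<boxtimes>\<^sub>F (any_in (any_dom g) b \<boxtimes>\<^sub>F any_in (any_dom h) c)"
        and \<pi>' = "\<lambda>(a, b, c). any_pr A a \<boxtimes>\<^sub>F any_pr B b \<boxtimes>\<^sub>F any_pr C c"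
        and \<phi> = "\<lambda>(a, b, c). simple_assoc (fst a) (fst b) (fst c)"
        and \<phi>' = "\<lambda>(a, b, c). simple_assoc (fst a) (fst b) (fst c)"])
qed (auto simp: assoc_in assoc_pr intro!: simple_assoc_natural)

lemma braid_natural:
  assumes [simp]: "any_cod f = A" "any_cod g = B"
  shows "any_prod_braid A B \<cdot>\<^sub>F (f \<boxtimes>\<^sub>F g) = (g \<boxtimes>\<^sub>F f) \<cdot>\<^sub>F any_prod_braid (any_dom f) (any_dom g)"
proof (rule natural_extension[OF simple_decomp_prod simple_decomp_swap,
      where \<kappa> = "\<lambda>(a, b). any_in (any_dom g) b \<boxtimes>\<^sub>F any_in (any_dom f) a"
        and \<pi>' = "\<lambda>(a, b). any_pr A a \<boxtimes>\<^sub>F any_pr B b"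
        and \<phi> = "\<lambda>(a, b). simple_braid (fst a) (fst b)"
        and \<phi>' = "\<lambda>(a, b). simple_braid (fst a) (fst b)"])
qed (auto simp: braid_in braid_pr intro!: simple_braid_natural)

lemma summands_vacuum [simp]: "summands vacuum = {(Vac, 0)}" "any_in vacuum (Vac, 0) = any_id vacuum"
  using summands_simple[of Vac] any_in_simple[of Vac] by simp_all

text \<open>On inclusions of summands the associativity acts by \<open>simple_assoc\<close>, an identity if a factor is the vacuum.\<close>
lemma assoc_vacuum [simp]:
  "any_prod_assoc vacuum B C = any_id (B \<otimes>\<^sub>F C)"
  "any_prod_assoc A vacuum C = any_id (A \<otimes>\<^sub>F C)"
  "any_prod_assoc A B vacuum = any_id (A \<otimes>\<^sub>F B)"
proof -
  show "any_prod_assoc vacuum B C = any_id (B \<otimes>\<^sub>F C)"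
    by (rule decomp_joint_epi[OF simple_decomp_left[of vacuum B C]])
      (auto simp: assoc_in[where A = vacuum and a = "(Vac, 0)", simplified] simple_assoc_def)
  show "any_prod_assoc A vacuum C = any_id (A \<otimes>\<^sub>F C)"
    by (rule decomp_joint_epi[OF simple_decomp_left[of A vacuum C]])
      (auto simp: assoc_in[where B = vacuum and b = "(Vac, 0)", simplified] simple_assoc_def)
  show "any_prod_assoc A B vacuum = any_id (A \<otimes>\<^sub>F B)"
    by (rule decomp_joint_epi[OF simple_decomp_left[of A B vacuum]])
      (auto simp: assoc_in[where C = vacuum and c = "(Vac, 0)", simplified] simple_assoc_def)
qed

lemma braid_vacuum [simp]:
  "any_prod_braid vacuum B = any_id B"
  "any_prod_braid A vacuum = any_id A"
proof -
  show "any_prod_braid vacuum B = any_id B"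
    by (rule decomp_joint_epi[OF simple_decomp_prod[of vacuum B]])
      (auto simp: braid_in[where A = vacuum and a = "(Vac, 0)", simplified] simple_braid_def)
  show "any_prod_braid A vacuum = any_id A"
    by (rule decomp_joint_epi[OF simple_decomp_prod[of A vacuum]])
      (auto simp: braid_in[where B = vacuum and b = "(Vac, 0)", simplified] simple_braid_def)
qed

section \<open>The coherence conditions on \<open>\<tau>\<close>\<close>

abbreviation "Q \<equiv> complex_of_real fib_q"
abbreviation "R \<equiv> complex_of_real (sqrt fib_q)"

lemma fib_q_pos: "fib_q > 0" by (simp add: fib_q_def)

lemma fib_q_sq: "fib_q\<^sup>2 = 1 - fib_q"
  by (simp add: fib_q_def power2_eq_square field_simps)

lemma q_mult: "Q * Q = 1 - Q"
  using arg_cong[OF fib_q_sq, of complex_of_real] by (simp add: power2_eq_square)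

lemma sqrt_q_mult: "R * R = Q"
  using fib_q_pos by (simp flip: of_real_mult)

text \<open>
  Together with the forms for nested products, the quadratic relations rewrite every polynomial in \<open>q\<close>, \<open>\<surd>q\<close>
  and \<open>z\<close> to one of degree at most one in each of them.
\<close>
lemma q_mult': "Q * (Q * x) = x - Q * x" by (simp add: q_mult left_diff_distrib flip: mult.assoc)
lemma sqrt_q_mult': "R * (R * x) = Q * x" by (simp add: sqrt_q_mult flip: mult.assoc)

text \<open>
  Since \<open>z\<close> has modulus one, \<open>z + z\<^sup>-\<^sup>1 = 2 cos \<theta>\<close> with \<open>\<theta> = 3\<pi>/5\<close>. From \<open>3\<theta> = 3\<pi> - 2\<theta>\<close> follows
  \<open>cos 3\<theta> = - cos 2\<theta>\<close>, a cubic equation for \<open>cos \<theta>\<close> with the roots \<open>-1\<close> and half of \<open>1 + q\<close> and \<open>-q\<close>. As \<open>\<theta>\<close>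
  lies strictly between \<open>\<pi>/2\<close> and \<open>\<pi>\<close>, only the last one is possible.
\<close>
lemma fib_z_sq: "fib_z\<^sup>2 = - 1 - Q * fib_z"
proof -
  have z: "fib_z = cis (3 * pi / 5)"
    by (simp add: fib_z_def cis_conv_exp field_simps)
  define w where "w = 2 * cos (3 * pi / 5)"
  have zw: "fib_z\<^sup>2 = complex_of_real w * fib_z - 1"
  proof -
    have "fib_z + cnj fib_z = complex_of_real w"
      by (simp add: z w_def complex_add_cnj)
    moreover have "fib_z * cnj fib_z = 1"
      by (simp add: z cis_cnj cis_mult)
    ultimately show ?thesis
      by (simp add: power2_eq_square algebra_simps flip: of_real_mult)
        (metis add.commute diff_add_cancel distrib_left mult.commute)
  qed
  have "w = - fib_q"
  proof -
    let ?c = "cos (3 * pi / 5)"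
    have "cos (3 * (3 * pi / 5)) = cos (3 * pi - 2 * (3 * pi / 5))"
      by (rule arg_cong[where f = cos]) (simp add: field_simps)
    also have "\<dots> = - cos (2 * (3 * pi / 5))"
      unfolding cos_diff by simp
    finally have "4 * ?c ^ 3 - 3 * ?c = 1 - 2 * ?c\<^sup>2"
      unfolding cos_treble_cos cos_double_cos by simp
    then have "(?c + 1) * (w\<^sup>2 - w - 1) = 0"
      by (simp add: w_def power2_eq_square power3_eq_cube algebra_simps)
    moreover have "sin (3 * pi / 5) > 0" by (rule sin_gt_zero) auto
    then have "?c + 1 \<noteq> 0"
      using sin_squared_eq[of "3 * pi / 5"] by (auto simp: add_eq_0_iff2)
    ultimately have "w\<^sup>2 - w - 1 = 0" by simp
    then have "(w + fib_q) * (w - 1 - fib_q) = 0"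
      using fib_q_sq by (simp add: power2_eq_square algebra_simps)
    moreover have "?c < 0"
    proof -
      have "?c = - cos (2 * pi / 5)"
        using cos_pi_minus[of "2 * pi / 5"] by (simp add: field_simps)
      moreover have "cos (2 * pi / 5) > 0" by (rule cos_gt_zero) auto
      ultimately show ?thesis by simp
    qed
    ultimately show ?thesis using fib_q_pos by (auto simp: w_def)
  qed
  then show ?thesis using zw by simp
qed

lemma fib_z_mult: "fib_z * fib_z = - 1 - Q * fib_z"
  using fib_z_sq by (simp add: power2_eq_square)

lemma fib_z_mult': "fib_z * (fib_z * x) = - x - Q * (fib_z * x)"
  by (simp add: fib_z_mult left_diff_distrib flip: mult.assoc)

abbreviation sigma :: anyon_ob ("\<sigma>") where "\<sigma> \<equiv> (Suc 0, Suc 0)"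

lemma tau_tau: "tau \<otimes>\<^sub>F tau = \<sigma>"
  by (simp add: any_prod_def tau_def)

lemma summands_sigma [simp]: "summands \<sigma> = {(Vac, 0), (Tau, 0)}"
  by (auto simp: summands_def)

lemma summands_tau [simp]: "summands tau = {(Tau, 0)}"
  using summands_simple[of Tau] by simp

lemma any_in_tau: "any_in tau (Tau, 0) = any_id tau"
  using any_in_simple[of Tau] by simp

abbreviation list_mat :: "nat \<Rightarrow> complex list list \<Rightarrow> complex mat" where
  "list_mat \<equiv> mat_of_rows_list"

lemmas anyon_eval = any_transpose_def any_comp_def scalar_prod_def any_prod_mor_def
  kronecker_def dsum_mat_def vacuum_def tau_def any_id_def any_prod_def any_dom_def
  any_cod_def mat_of_rows_list_def less_Suc_eq numeral_2_eq_2 numeral_3_eq_3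

text \<open>
  The inclusions of the two channels of \<open>\<sigma> = \<tau> \<otimes> \<tau>\<close>, and their products with \<open>\<tau>\<close>, as explicit matrices. They
  determine the components of associativity and braiding in which one factor is \<open>\<sigma>\<close>. Products are computed one
  factor at a time, which keeps the matrices to be evaluated small.
\<close>
lemma any_in_sigma:
  "any_in \<sigma> (Vac, 0) = (list_mat (Suc 0) [[1]], list_mat 0 [[]])"
  "any_in \<sigma> (Tau, 0) = (list_mat 0 [[]], list_mat (Suc 0) [[1]])"
  by (rule any_mor_eqI; auto simp: any_in_def anyon_eval)+

lemma vac_in_tensor:
  "(list_mat (Suc 0) [[1]], list_mat 0 [[]]) \<boxtimes>\<^sub>F any_id tau = (list_mat 0 [[]], list_mat (Suc 0) [[1],[0]])"
  "any_id tau \<boxtimes>\<^sub>F (list_mat (Suc 0) [[1]], list_mat 0 [[]]) = (list_mat 0 [[]], list_mat (Suc 0) [[1],[0]])"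
  "(list_mat 0 [[]], list_mat (Suc 0) [[1],[0]]) \<boxtimes>\<^sub>F any_id tau
     = (list_mat (Suc 0) [[1],[0]], list_mat (Suc 0) [[0],[1],[0]])"
  "any_id tau \<boxtimes>\<^sub>F (list_mat 0 [[]], list_mat (Suc 0) [[1],[0]])
     = (list_mat (Suc 0) [[1],[0]], list_mat (Suc 0) [[0],[1],[0]])"
  "(list_mat (Suc 0) [[1]], list_mat 0 [[]]) \<boxtimes>\<^sub>F any_id \<sigma>
     = (list_mat (Suc 0) [[1],[0]], list_mat (Suc 0) [[1],[0],[0]])"
  "any_id \<sigma> \<boxtimes>\<^sub>F (list_mat (Suc 0) [[1]], list_mat 0 [[]])
     = (list_mat (Suc 0) [[1],[0]], list_mat (Suc 0) [[0],[1],[0]])"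
  by (rule any_mor_eqI; auto simp: anyon_eval)+

lemma tau_in_tensor:
  "(list_mat 0 [[]], list_mat (Suc 0) [[1]]) \<boxtimes>\<^sub>F any_id tau = (list_mat (Suc 0) [[1]], list_mat (Suc 0) [[0],[1]])"
  "any_id tau \<boxtimes>\<^sub>F (list_mat 0 [[]], list_mat (Suc 0) [[1]]) = (list_mat (Suc 0) [[1]], list_mat (Suc 0) [[0],[1]])"
  "(list_mat (Suc 0) [[1]], list_mat (Suc 0) [[0],[1]]) \<boxtimes>\<^sub>F any_id tau
     = (list_mat (Suc 0) [[0],[1]], list_mat 2 [[1,0],[0,0],[0,1]])"
  "any_id tau \<boxtimes>\<^sub>F (list_mat (Suc 0) [[1]], list_mat (Suc 0) [[0],[1]])
     = (list_mat (Suc 0) [[0],[1]], list_mat 2 [[1,0],[0,0],[0,1]])"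
  "(list_mat 0 [[]], list_mat (Suc 0) [[1]]) \<boxtimes>\<^sub>F any_id \<sigma>
     = (list_mat (Suc 0) [[0],[1]], list_mat 2 [[0,0],[1,0],[0,1]])"
  "any_id \<sigma> \<boxtimes>\<^sub>F (list_mat 0 [[]], list_mat (Suc 0) [[1]])
     = (list_mat (Suc 0) [[0],[1]], list_mat 2 [[1,0],[0,0],[0,1]])"
  by (rule any_mor_eqI; auto simp: anyon_eval)+

lemmas sigma_in = any_in_sigma vac_in_tensor tau_in_tensor

lemma fib_F_list_mat: "fib_F = list_mat 2 [[Q, R], [R, -Q]]"
  by (simp add: fib_F_def)

lemma assoc_tau: "any_prod_assoc tau tau tau = (list_mat (Suc 0) [[1]], list_mat 2 [[Q, R], [R, -Q]])"
  using any_prod_assoc_simple[of Tau Tau Tau]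
  by (auto simp: simple_assoc_def fib_F_list_mat mat_of_rows_list_def intro!: eq_matI)

lemma simple_assoc_tau: "simple_assoc Tau Tau Tau = (list_mat (Suc 0) [[1]], list_mat 2 [[Q, R], [R, -Q]])"
  using any_prod_assoc_simple[of Tau Tau Tau] assoc_tau by simp

lemma simple_assoc_unit: "s = Vac \<or> t = Vac \<or> u = Vac \<Longrightarrow>
   simple_assoc s t u = any_id (simple_ob s \<otimes>\<^sub>F simple_ob t \<otimes>\<^sub>F simple_ob u)"
  by (auto simp: simple_assoc_def)

lemma list_mat_dim [simp]:
  "any_dom (list_mat m xs, list_mat n ys) = (m, n)" "any_cod (list_mat m xs, list_mat n ys) = (length xs, length ys)"
  by (simp_all add: any_dom_def any_cod_def mat_of_rows_list_def)

lemma prod_tau_sigma: "\<sigma> \<otimes>\<^sub>F tau = (Suc 0, 2)" "tau \<otimes>\<^sub>F \<sigma> = (Suc 0, 2)" "(Suc 0, 2) \<otimes>\<^sub>F tau = (2, 3)"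
   "tau \<otimes>\<^sub>F (Suc 0, 2) = (2, 3)" "\<sigma> \<otimes>\<^sub>F \<sigma> = (2, 3)"
  by (simp_all add: any_prod_def tau_def)

text \<open>
  The \<open>\<tau>\<close> part of \<open>(\<sigma> \<otimes> \<tau>) \<otimes> \<tau>\<close> has three basis vectors: the summand \<open>\<tau>\<close> of \<open>\<sigma>\<close>, fused with the second
  factor in the channel \<open>1\<close>; the summand \<open>1\<close> of \<open>\<sigma>\<close>; and the summand \<open>\<tau>\<close> with the channel \<open>\<tau>\<close>. In
  \<open>\<sigma> \<otimes> (\<tau> \<otimes> \<tau>)\<close> the summand \<open>1\<close> of \<open>\<sigma>\<close> comes first, and the summand \<open>\<tau>\<close> follows with the channels \<open>1\<close> and \<open>\<tau>\<close>
  of the other two factors. The associativity is the identity on the summand \<open>1\<close> and the matrix with entries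
  \<open>q\<close> and \<open>\<surd>q\<close> on the summand \<open>\<tau>\<close>. In the next two lemmas the summand \<open>1\<close> belongs to the second basis vector
  on both sides.
\<close>
lemma assoc_sigma_left:
  "any_prod_assoc \<sigma> tau tau = (list_mat 2 [[1,0],[0,1]], list_mat 3 [[0,1,0],[Q,0,R],[R,0,-Q]])"
proof (rule decomp_joint_epi[OF simple_decomp_left[of \<sigma> tau tau]])
  fix i assume "i \<in> summands \<sigma> \<times> summands tau \<times> summands tau"
  then show "any_prod_assoc \<sigma> tau tau \<cdot>\<^sub>F (case i of (a, b, c) \<Rightarrow> any_in \<sigma> a \<boxtimes>\<^sub>F any_in tau b \<boxtimes>\<^sub>F any_in tau c)
     = (list_mat 2 [[1,0],[0,1]], list_mat 3 [[0,1,0],[Q,0,R],[R,0,-Q]]) \<cdot>\<^sub>F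
       (case i of (a, b, c) \<Rightarrow> any_in \<sigma> a \<boxtimes>\<^sub>F any_in tau b \<boxtimes>\<^sub>F any_in tau c)"
    by (auto simp: assoc_in simple_assoc_tau simple_assoc_unit tau_tau)
      (simp only: any_in_tau any_prod_id tau_tau sigma_in, (rule any_mor_eqI; auto simp: anyon_eval))+
qed (simp_all add: tau_tau prod_tau_sigma)

lemma assoc_sigma_mid:
  "any_prod_assoc tau \<sigma> tau = (list_mat 2 [[1,0],[0,1]], list_mat 3 [[Q,0,R],[0,1,0],[R,0,-Q]])"
proof (rule decomp_joint_epi[OF simple_decomp_left[of tau \<sigma> tau]])
  fix i assume "i \<in> summands tau \<times> summands \<sigma> \<times> summands tau"
  then show "any_prod_assoc tau \<sigma> tau \<cdot>\<^sub>F (case i of (a, b, c) \<Rightarrow> any_in tau a \<boxtimes>\<^sub>F any_in \<sigma> b \<boxtimes>\<^sub>F any_in tau c)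
     = (list_mat 2 [[1,0],[0,1]], list_mat 3 [[Q,0,R],[0,1,0],[R,0,-Q]]) \<cdot>\<^sub>F
       (case i of (a, b, c) \<Rightarrow> any_in tau a \<boxtimes>\<^sub>F any_in \<sigma> b \<boxtimes>\<^sub>F any_in tau c)"
    by (auto simp: assoc_in simple_assoc_tau simple_assoc_unit tau_tau)
      (simp only: any_in_tau any_prod_id tau_tau sigma_in, (rule any_mor_eqI; auto simp: anyon_eval))+
qed (simp_all add: tau_tau prod_tau_sigma)

lemma assoc_sigma_right:
  "any_prod_assoc tau tau \<sigma> = (list_mat 2 [[1,0],[0,1]], list_mat 3 [[Q,0,R],[0,1,0],[R,0,-Q]])"
proof (rule decomp_joint_epi[OF simple_decomp_left[of tau tau \<sigma>]])
  fix i assume "i \<in> summands tau \<times> summands tau \<times> summands \<sigma>"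
  then show "any_prod_assoc tau tau \<sigma> \<cdot>\<^sub>F (case i of (a, b, c) \<Rightarrow> any_in tau a \<boxtimes>\<^sub>F any_in tau b \<boxtimes>\<^sub>F any_in \<sigma> c)
     = (list_mat 2 [[1,0],[0,1]], list_mat 3 [[Q,0,R],[0,1,0],[R,0,-Q]]) \<cdot>\<^sub>F
       (case i of (a, b, c) \<Rightarrow> any_in tau a \<boxtimes>\<^sub>F any_in tau b \<boxtimes>\<^sub>F any_in \<sigma> c)"
    by (auto simp: assoc_in simple_assoc_tau simple_assoc_unit tau_tau)
      (simp only: any_in_tau any_prod_id tau_tau sigma_in, (rule any_mor_eqI; auto simp: anyon_eval))+
qed (simp_all add: tau_tau prod_tau_sigma)

lemma braid_tau: "any_prod_braid tau tau = (list_mat (Suc 0) [[fib_z\<^sup>2]], list_mat (Suc 0) [[fib_z]])"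
  using any_prod_braid_simple[of Tau Tau]
  by (auto simp: simple_braid_def mat_of_rows_list_def intro!: eq_matI)

lemma simple_braid_tau: "simple_braid Tau Tau = (list_mat (Suc 0) [[fib_z\<^sup>2]], list_mat (Suc 0) [[fib_z]])"
  using any_prod_braid_simple[of Tau Tau] braid_tau by simp

lemma simple_braid_unit: "s = Vac \<or> t = Vac \<Longrightarrow>
   simple_braid s t = any_id (simple_ob s \<otimes>\<^sub>F simple_ob t)"
  by (auto simp: simple_braid_def)

lemma braid_sigma_left:
  "any_prod_braid \<sigma> tau = (list_mat (Suc 0) [[fib_z\<^sup>2]], list_mat 2 [[1, 0], [0, fib_z]])"
proof (rule decomp_joint_epi[OF simple_decomp_prod[of \<sigma> tau]])
  fix i assume "i \<in> summands \<sigma> \<times> summands tau"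
  then show "any_prod_braid \<sigma> tau \<cdot>\<^sub>F (case i of (a, b) \<Rightarrow> any_in \<sigma> a \<boxtimes>\<^sub>F any_in tau b)
     = (list_mat (Suc 0) [[fib_z\<^sup>2]], list_mat 2 [[1, 0], [0, fib_z]]) \<cdot>\<^sub>F
       (case i of (a, b) \<Rightarrow> any_in \<sigma> a \<boxtimes>\<^sub>F any_in tau b)"
    by (auto simp: braid_in simple_braid_tau simple_braid_unit tau_tau)
      (simp only: any_in_tau any_prod_id tau_tau sigma_in, (rule any_mor_eqI; auto simp: anyon_eval))+
qed (simp_all add: tau_tau prod_tau_sigma)

lemma braid_sigma_right:
  "any_prod_braid tau \<sigma> = (list_mat (Suc 0) [[fib_z\<^sup>2]], list_mat 2 [[1, 0], [0, fib_z]])"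
proof (rule decomp_joint_epi[OF simple_decomp_prod[of tau \<sigma>]])
  fix i assume "i \<in> summands tau \<times> summands \<sigma>"
  then show "any_prod_braid tau \<sigma> \<cdot>\<^sub>F (case i of (a, b) \<Rightarrow> any_in tau a \<boxtimes>\<^sub>F any_in \<sigma> b)
     = (list_mat (Suc 0) [[fib_z\<^sup>2]], list_mat 2 [[1, 0], [0, fib_z]]) \<cdot>\<^sub>F
       (case i of (a, b) \<Rightarrow> any_in tau a \<boxtimes>\<^sub>F any_in \<sigma> b)"
    by (auto simp: braid_in simple_braid_tau simple_braid_unit tau_tau)
      (simp only: any_in_tau any_prod_id tau_tau sigma_in, (rule any_mor_eqI; auto simp: anyon_eval))+
qed (simp_all add: tau_tau prod_tau_sigma)

lemma id_tensor_assoc_tau: "any_id tau \<boxtimes>\<^sub>F any_prod_assoc tau tau tau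
    = (list_mat 2 [[Q, R], [R, -Q]], list_mat 3 [[1,0,0], [0,Q, R], [0,R, -Q]])"
  unfolding assoc_tau by (rule any_mor_eqI) (auto simp: anyon_eval)

lemma assoc_tau_tensor_id: "any_prod_assoc tau tau tau \<boxtimes>\<^sub>F any_id tau
    = (list_mat 2 [[Q, R], [R, -Q]], list_mat 3 [[1,0,0], [0,Q, R], [0,R, -Q]])"
  unfolding assoc_tau by (rule any_mor_eqI) (auto simp: anyon_eval)

lemma id_tensor_braid_tau: "any_id tau \<boxtimes>\<^sub>F any_prod_braid tau tau
    = (list_mat (Suc 0) [[fib_z]], list_mat 2 [[fib_z\<^sup>2, 0], [0, fib_z]])"
  unfolding braid_tau by (rule any_mor_eqI) (auto simp: anyon_eval)

lemma braid_tau_tensor_id: "any_prod_braid tau tau \<boxtimes>\<^sub>F any_id tau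
    = (list_mat (Suc 0) [[fib_z]], list_mat 2 [[fib_z\<^sup>2, 0], [0, fib_z]])"
  unfolding braid_tau by (rule any_mor_eqI) (auto simp: anyon_eval)

text \<open>For three factors \<open>\<tau>\<close> this says that the associativity matrix squares to one, that is \<open>q\<^sup>2 + q = 1\<close>.\<close>
lemma simple_assoc_invol: "simple_assoc s t u \<cdot>\<^sub>F simple_assoc s t u = any_id (simple_ob s \<otimes>\<^sub>F simple_ob t \<otimes>\<^sub>F simple_ob u)"
proof (cases "s = Tau \<and> t = Tau \<and> u = Tau")
  case True
  then show ?thesis
    by (simp add: simple_assoc_tau) (rule any_mor_eqI; auto simp: anyon_eval q_mult sqrt_q_mult mult.commute)
next
  case False
  then show ?thesis by (cases s; cases t; cases u) (simp_all add: simple_assoc_unit)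
qed

lemma pentagon_tau:
  "(any_id tau \<boxtimes>\<^sub>F any_prod_assoc tau tau tau) \<cdot>\<^sub>F any_prod_assoc tau \<sigma> tau
      \<cdot>\<^sub>F (any_prod_assoc tau tau tau \<boxtimes>\<^sub>F any_id tau)
    = any_prod_assoc tau tau \<sigma> \<cdot>\<^sub>F any_prod_assoc \<sigma> tau tau"
  unfolding id_tensor_assoc_tau assoc_tau_tensor_id assoc_sigma_left assoc_sigma_mid assoc_sigma_right
  by (rule any_mor_eqI) (auto simp: anyon_eval q_mult sqrt_q_mult q_mult' sqrt_q_mult' algebra_simps)

lemma hexagon_tau:
  "any_prod_assoc tau tau tau \<cdot>\<^sub>F any_prod_braid tau \<sigma> \<cdot>\<^sub>F any_prod_assoc tau tau tau
    = (any_id tau \<boxtimes>\<^sub>F any_prod_braid tau tau) \<cdot>\<^sub>F any_prod_assoc tau tau tau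
      \<cdot>\<^sub>F (any_prod_braid tau tau \<boxtimes>\<^sub>F any_id tau)"
  unfolding id_tensor_braid_tau braid_tau_tensor_id braid_sigma_right assoc_tau
  by (rule any_mor_eqI) (auto simp: anyon_eval power2_eq_square q_mult sqrt_q_mult q_mult' sqrt_q_mult' fib_z_mult fib_z_mult' algebra_simps)

section \<open>Coherence on all objects\<close>

text \<open>Pasting of commutative squares: naturality of a composite follows from that of its factors.\<close>
lemma paste_squares:
  assumes "p \<cdot>\<^sub>F x = y \<cdot>\<^sub>F p'" "q \<cdot>\<^sub>F y = z \<cdot>\<^sub>F q'"
    and [simp]: "any_dom p = any_cod x" "any_dom y = any_cod p'" "any_dom q = any_cod p"
      "any_cod p = any_cod y" "any_dom z = any_cod q'" "any_dom q' = any_cod p'"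
  shows "(q \<cdot>\<^sub>F p) \<cdot>\<^sub>F x = z \<cdot>\<^sub>F (q' \<cdot>\<^sub>F p')"
proof -
  have "(q \<cdot>\<^sub>F p) \<cdot>\<^sub>F x = q \<cdot>\<^sub>F (y \<cdot>\<^sub>F p')" using assms(1) by simp
  also have "\<dots> = (q \<cdot>\<^sub>F y) \<cdot>\<^sub>F p'" by simp
  also have "\<dots> = z \<cdot>\<^sub>F (q' \<cdot>\<^sub>F p')" using assms(2) by simp
  finally show ?thesis .
qed

lemma paste_squares3:
  assumes "p \<cdot>\<^sub>F x = y \<cdot>\<^sub>F p'" "q \<cdot>\<^sub>F y = z \<cdot>\<^sub>F q'" "r \<cdot>\<^sub>F z = w \<cdot>\<^sub>F r'"
    and [simp]: "any_dom p = any_cod x" "any_dom y = any_cod p'" "any_dom q = any_cod p"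
      "any_cod p = any_cod y" "any_dom z = any_cod q'" "any_dom q' = any_cod p'"
      "any_dom r = any_cod q" "any_cod q = any_cod z" "any_dom w = any_cod r'" "any_dom r' = any_cod q'"
  shows "(r \<cdot>\<^sub>F q \<cdot>\<^sub>F p) \<cdot>\<^sub>F x = w \<cdot>\<^sub>F (r' \<cdot>\<^sub>F q' \<cdot>\<^sub>F p')"
  using assms(1) paste_squares[OF assms(2,3)] by (rule paste_squares) simp_all

definition pentagon_upper :: "anyon_ob \<Rightarrow> anyon_ob \<Rightarrow> anyon_ob \<Rightarrow> anyon_ob \<Rightarrow> anyon_mor" where
  "pentagon_upper A B C D = (any_id A \<boxtimes>\<^sub>F any_prod_assoc B C D) \<cdot>\<^sub>F any_prod_assoc A (B \<otimes>\<^sub>F C) D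
     \<cdot>\<^sub>F (any_prod_assoc A B C \<boxtimes>\<^sub>F any_id D)"

definition pentagon_lower :: "anyon_ob \<Rightarrow> anyon_ob \<Rightarrow> anyon_ob \<Rightarrow> anyon_ob \<Rightarrow> anyon_mor" where
  "pentagon_lower A B C D = any_prod_assoc A B (C \<otimes>\<^sub>F D) \<cdot>\<^sub>F any_prod_assoc (A \<otimes>\<^sub>F B) C D"

lemma pentagon_dim [simp]:
  "any_dom (pentagon_upper A B C D) = A \<otimes>\<^sub>F B \<otimes>\<^sub>F C \<otimes>\<^sub>F D"
  "any_cod (pentagon_upper A B C D) = A \<otimes>\<^sub>F (B \<otimes>\<^sub>F (C \<otimes>\<^sub>F D))"
  "any_dom (pentagon_lower A B C D) = A \<otimes>\<^sub>F B \<otimes>\<^sub>F C \<otimes>\<^sub>F D"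
  "any_cod (pentagon_lower A B C D) = A \<otimes>\<^sub>F (B \<otimes>\<^sub>F (C \<otimes>\<^sub>F D))"
  by (simp_all add: pentagon_upper_def pentagon_lower_def)

lemma pentagon_natural:
  assumes [simp]: "any_cod f = A" "any_cod g = B" "any_cod h = C" "any_cod k = D"
  shows "pentagon_upper A B C D \<cdot>\<^sub>F (f \<boxtimes>\<^sub>F g \<boxtimes>\<^sub>F h \<boxtimes>\<^sub>F k)
      = (f \<boxtimes>\<^sub>F (g \<boxtimes>\<^sub>F (h \<boxtimes>\<^sub>F k))) \<cdot>\<^sub>F pentagon_upper (any_dom f) (any_dom g) (any_dom h) (any_dom k)"
    and "pentagon_lower A B C D \<cdot>\<^sub>F (f \<boxtimes>\<^sub>F g \<boxtimes>\<^sub>F h \<boxtimes>\<^sub>F k)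
      = (f \<boxtimes>\<^sub>F (g \<boxtimes>\<^sub>F (h \<boxtimes>\<^sub>F k))) \<cdot>\<^sub>F pentagon_lower (any_dom f) (any_dom g) (any_dom h) (any_dom k)"
proof -
  let ?A = "any_dom f" and ?B = "any_dom g" and ?C = "any_dom h" and ?D = "any_dom k"
  have "(any_prod_assoc A B C \<boxtimes>\<^sub>F any_id D) \<cdot>\<^sub>F (f \<boxtimes>\<^sub>F g \<boxtimes>\<^sub>F h \<boxtimes>\<^sub>F k)
      = (f \<boxtimes>\<^sub>F (g \<boxtimes>\<^sub>F h) \<boxtimes>\<^sub>F k) \<cdot>\<^sub>F (any_prod_assoc ?A ?B ?C \<boxtimes>\<^sub>F any_id ?D)"
    by (simp add: assoc_natural)
  moreover have "any_prod_assoc A (B \<otimes>\<^sub>F C) D \<cdot>\<^sub>F (f \<boxtimes>\<^sub>F (g \<boxtimes>\<^sub>F h) \<boxtimes>\<^sub>F k)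
      = (f \<boxtimes>\<^sub>F (g \<boxtimes>\<^sub>F h \<boxtimes>\<^sub>F k)) \<cdot>\<^sub>F any_prod_assoc ?A (?B \<otimes>\<^sub>F ?C) ?D"
    by (simp add: assoc_natural)
  moreover have "(any_id A \<boxtimes>\<^sub>F any_prod_assoc B C D) \<cdot>\<^sub>F (f \<boxtimes>\<^sub>F (g \<boxtimes>\<^sub>F h \<boxtimes>\<^sub>F k))
      = (f \<boxtimes>\<^sub>F (g \<boxtimes>\<^sub>F (h \<boxtimes>\<^sub>F k))) \<cdot>\<^sub>F (any_id ?A \<boxtimes>\<^sub>F any_prod_assoc ?B ?C ?D)"
    by (simp add: assoc_natural)
  ultimately show "pentagon_upper A B C D \<cdot>\<^sub>F (f \<boxtimes>\<^sub>F g \<boxtimes>\<^sub>F h \<boxtimes>\<^sub>F k)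
      = (f \<boxtimes>\<^sub>F (g \<boxtimes>\<^sub>F (h \<boxtimes>\<^sub>F k))) \<cdot>\<^sub>F pentagon_upper ?A ?B ?C ?D"
    unfolding pentagon_upper_def by (rule paste_squares3) simp_all
  have "any_prod_assoc (A \<otimes>\<^sub>F B) C D \<cdot>\<^sub>F (f \<boxtimes>\<^sub>F g \<boxtimes>\<^sub>F h \<boxtimes>\<^sub>F k)
      = (f \<boxtimes>\<^sub>F g \<boxtimes>\<^sub>F (h \<boxtimes>\<^sub>F k)) \<cdot>\<^sub>F any_prod_assoc (?A \<otimes>\<^sub>F ?B) ?C ?D"
    by (simp add: assoc_natural)
  moreover have "any_prod_assoc A B (C \<otimes>\<^sub>F D) \<cdot>\<^sub>F (f \<boxtimes>\<^sub>F g \<boxtimes>\<^sub>F (h \<boxtimes>\<^sub>F k))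
      = (f \<boxtimes>\<^sub>F (g \<boxtimes>\<^sub>F (h \<boxtimes>\<^sub>F k))) \<cdot>\<^sub>F any_prod_assoc ?A ?B (?C \<otimes>\<^sub>F ?D)"
    by (simp add: assoc_natural)
  ultimately show "pentagon_lower A B C D \<cdot>\<^sub>F (f \<boxtimes>\<^sub>F g \<boxtimes>\<^sub>F h \<boxtimes>\<^sub>F k)
      = (f \<boxtimes>\<^sub>F (g \<boxtimes>\<^sub>F (h \<boxtimes>\<^sub>F k))) \<cdot>\<^sub>F pentagon_lower ?A ?B ?C ?D"
    unfolding pentagon_lower_def by (rule paste_squares) simp_all
qed

text \<open>If one of the four objects is the vacuum, the five arrows reduce to identities and two equal ones.\<close>
lemma pentagon_simple:
  "pentagon_upper (simple_ob s) (simple_ob t) (simple_ob u) (simple_ob v)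
    = pentagon_lower (simple_ob s) (simple_ob t) (simple_ob u) (simple_ob v)"
  using pentagon_tau
  by (cases s; cases t; cases u; cases v) (simp_all add: pentagon_upper_def pentagon_lower_def tau_tau)

lemma pentagon: "pentagon_upper A B C D = pentagon_lower A B C D"
  by (rule decomp_joint_epi[OF decomp_prod[OF simple_decomp_left[of A B C] simple_decomp[of D]]])
    (auto simp: pentagon_natural pentagon_simple)

definition hexagon_left :: "anyon_ob \<Rightarrow> anyon_ob \<Rightarrow> anyon_ob \<Rightarrow> anyon_mor" where
  "hexagon_left A B C =
     any_prod_assoc B C A \<cdot>\<^sub>F any_prod_braid A (B \<otimes>\<^sub>F C) \<cdot>\<^sub>F any_prod_assoc A B C"

definition hexagon_right :: "anyon_ob \<Rightarrow> anyon_ob \<Rightarrow> anyon_ob \<Rightarrow> anyon_mor" where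
  "hexagon_right A B C = (any_id B \<boxtimes>\<^sub>F any_prod_braid A C) \<cdot>\<^sub>F any_prod_assoc B A C
     \<cdot>\<^sub>F (any_prod_braid A B \<boxtimes>\<^sub>F any_id C)"

lemma hexagon_dim [simp]:
  "any_dom (hexagon_left A B C) = A \<otimes>\<^sub>F B \<otimes>\<^sub>F C" "any_cod (hexagon_left A B C) = B \<otimes>\<^sub>F (C \<otimes>\<^sub>F A)"
  "any_dom (hexagon_right A B C) = A \<otimes>\<^sub>F B \<otimes>\<^sub>F C" "any_cod (hexagon_right A B C) = B \<otimes>\<^sub>F (C \<otimes>\<^sub>F A)"
  by (simp_all add: hexagon_left_def hexagon_right_def)

lemma hexagon_natural:
  assumes [simp]: "any_cod f = A" "any_cod g = B" "any_cod h = C"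
  shows "hexagon_left A B C \<cdot>\<^sub>F (f \<boxtimes>\<^sub>F g \<boxtimes>\<^sub>F h)
      = (g \<boxtimes>\<^sub>F (h \<boxtimes>\<^sub>F f)) \<cdot>\<^sub>F hexagon_left (any_dom f) (any_dom g) (any_dom h)"
    and "hexagon_right A B C \<cdot>\<^sub>F (f \<boxtimes>\<^sub>F g \<boxtimes>\<^sub>F h)
      = (g \<boxtimes>\<^sub>F (h \<boxtimes>\<^sub>F f)) \<cdot>\<^sub>F hexagon_right (any_dom f) (any_dom g) (any_dom h)"
proof -
  let ?A = "any_dom f" and ?B = "any_dom g" and ?C = "any_dom h"
  have "any_prod_assoc A B C \<cdot>\<^sub>F (f \<boxtimes>\<^sub>F g \<boxtimes>\<^sub>F h) = (f \<boxtimes>\<^sub>F (g \<boxtimes>\<^sub>F h)) \<cdot>\<^sub>F any_prod_assoc ?A ?B ?C"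
    by (simp add: assoc_natural)
  moreover have "any_prod_braid A (B \<otimes>\<^sub>F C) \<cdot>\<^sub>F (f \<boxtimes>\<^sub>F (g \<boxtimes>\<^sub>F h))
      = (g \<boxtimes>\<^sub>F h \<boxtimes>\<^sub>F f) \<cdot>\<^sub>F any_prod_braid ?A (?B \<otimes>\<^sub>F ?C)"
    by (simp add: braid_natural)
  moreover have "any_prod_assoc B C A \<cdot>\<^sub>F (g \<boxtimes>\<^sub>F h \<boxtimes>\<^sub>F f) = (g \<boxtimes>\<^sub>F (h \<boxtimes>\<^sub>F f)) \<cdot>\<^sub>F any_prod_assoc ?B ?C ?A"
    by (simp add: assoc_natural)
  ultimately show "hexagon_left A B C \<cdot>\<^sub>F (f \<boxtimes>\<^sub>F g \<boxtimes>\<^sub>F h) = (g \<boxtimes>\<^sub>F (h \<boxtimes>\<^sub>F f)) \<cdot>\<^sub>F hexagon_left ?A ?B ?C"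
    unfolding hexagon_left_def by (rule paste_squares3) simp_all
  have "(any_prod_braid A B \<boxtimes>\<^sub>F any_id C) \<cdot>\<^sub>F (f \<boxtimes>\<^sub>F g \<boxtimes>\<^sub>F h)
      = (g \<boxtimes>\<^sub>F f \<boxtimes>\<^sub>F h) \<cdot>\<^sub>F (any_prod_braid ?A ?B \<boxtimes>\<^sub>F any_id ?C)"
    by (simp add: braid_natural)
  moreover have "any_prod_assoc B A C \<cdot>\<^sub>F (g \<boxtimes>\<^sub>F f \<boxtimes>\<^sub>F h) = (g \<boxtimes>\<^sub>F (f \<boxtimes>\<^sub>F h)) \<cdot>\<^sub>F any_prod_assoc ?B ?A ?C"
    by (simp add: assoc_natural)
  moreover have "(any_id B \<boxtimes>\<^sub>F any_prod_braid A C) \<cdot>\<^sub>F (g \<boxtimes>\<^sub>F (f \<boxtimes>\<^sub>F h))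
      = (g \<boxtimes>\<^sub>F (h \<boxtimes>\<^sub>F f)) \<cdot>\<^sub>F (any_id ?B \<boxtimes>\<^sub>F any_prod_braid ?A ?C)"
    by (simp add: braid_natural)
  ultimately show "hexagon_right A B C \<cdot>\<^sub>F (f \<boxtimes>\<^sub>F g \<boxtimes>\<^sub>F h) = (g \<boxtimes>\<^sub>F (h \<boxtimes>\<^sub>F f)) \<cdot>\<^sub>F hexagon_right ?A ?B ?C"
    unfolding hexagon_right_def by (rule paste_squares3) simp_all
qed

lemma hexagon_simple:
  "hexagon_left (simple_ob s) (simple_ob t) (simple_ob u) = hexagon_right (simple_ob s) (simple_ob t) (simple_ob u)"
  using hexagon_tau
  by (cases s; cases t; cases u) (simp_all add: hexagon_left_def hexagon_right_def tau_tau)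

lemma hexagon: "hexagon_left A B C = hexagon_right A B C"
  by (rule decomp_joint_epi[OF simple_decomp_left[of A B C]])
    (auto simp: hexagon_natural hexagon_simple)

section \<open>The additive structure\<close>

lemma comp_reassoc:
  assumes "g \<cdot>\<^sub>F f = k" "any_dom g = any_cod f" "any_dom f = any_cod h"
  shows "g \<cdot>\<^sub>F (f \<cdot>\<^sub>F h) = k \<cdot>\<^sub>F h"
  using any_comp_assoc[OF assms(2,3)] assms(1) by simp

lemma sum_sym_dim [simp]:
  "any_dom (any_sum_sym A B) = A \<oplus>\<^sub>F B" "any_cod (any_sum_sym A B) = B \<oplus>\<^sub>F A"
  by (simp_all add: any_sum_sym_def)

lemma pr_reassoc [simp]:
  "any_cod f = A \<Longrightarrow> any_cod g = B \<Longrightarrow> any_cod h = any_dom f \<oplus>\<^sub>F any_dom g \<Longrightarrow>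
     any_pr1 A B \<cdot>\<^sub>F ((f \<boxplus>\<^sub>F g) \<cdot>\<^sub>F h) = f \<cdot>\<^sub>F (any_pr1 (any_dom f) (any_dom g) \<cdot>\<^sub>F h)"
  "any_cod f = A \<Longrightarrow> any_cod g = B \<Longrightarrow> any_cod h = any_dom f \<oplus>\<^sub>F any_dom g \<Longrightarrow>
     any_pr2 A B \<cdot>\<^sub>F ((f \<boxplus>\<^sub>F g) \<cdot>\<^sub>F h) = g \<cdot>\<^sub>F (any_pr2 (any_dom f) (any_dom g) \<cdot>\<^sub>F h)"
  "any_cod h = A \<oplus>\<^sub>F B \<Longrightarrow> any_pr1 B A \<cdot>\<^sub>F (any_sum_sym A B \<cdot>\<^sub>F h) = any_pr2 A B \<cdot>\<^sub>F h"
  "any_cod h = A \<oplus>\<^sub>F B \<Longrightarrow> any_pr2 B A \<cdot>\<^sub>F (any_sum_sym A B \<cdot>\<^sub>F h) = any_pr1 A B \<cdot>\<^sub>F h"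
  by (simp_all add: comp_reassoc[OF pr_sum_mor(1)] comp_reassoc[OF pr_sum_mor(2)]
      comp_reassoc[OF pr_sum_sym(1)] comp_reassoc[OF pr_sum_sym(2)])

lemma sum_mor_id [simp]: "any_id A \<boxplus>\<^sub>F any_id B = any_id (A \<oplus>\<^sub>F B)"
  by (rule sum_joint_mono) auto

lemma sum_mor_comp:
  "any_dom f' = any_cod f \<Longrightarrow> any_dom g' = any_cod g
   \<Longrightarrow> (f' \<cdot>\<^sub>F f) \<boxplus>\<^sub>F (g' \<cdot>\<^sub>F g) = (f' \<boxplus>\<^sub>F g') \<cdot>\<^sub>F (f \<boxplus>\<^sub>F g)"
  by (rule sum_joint_mono[of _ "any_cod f'" "any_cod g'"]) auto

lemma pr_sum_assoc_reassoc:
  assumes "any_cod h = A \<oplus>\<^sub>F (B \<oplus>\<^sub>F C)"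
  shows "any_pr1 A B \<cdot>\<^sub>F (any_pr1 (A \<oplus>\<^sub>F B) C \<cdot>\<^sub>F h) = any_pr1 A (B \<oplus>\<^sub>F C) \<cdot>\<^sub>F h"
    "any_pr2 A B \<cdot>\<^sub>F (any_pr1 (A \<oplus>\<^sub>F B) C \<cdot>\<^sub>F h) = any_pr1 B C \<cdot>\<^sub>F (any_pr2 A (B \<oplus>\<^sub>F C) \<cdot>\<^sub>F h)"
  using assms by (simp_all add: sum_ob_assoc comp_reassoc[OF pr_sum_assoc(1)] comp_reassoc[OF pr_sum_assoc(2)])

lemma sum_joint_mono3:
  assumes "any_cod f = A \<oplus>\<^sub>F (B \<oplus>\<^sub>F C)" "any_cod g = A \<oplus>\<^sub>F (B \<oplus>\<^sub>F C)" "any_dom f = any_dom g"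
    "any_pr1 A (B \<oplus>\<^sub>F C) \<cdot>\<^sub>F f = any_pr1 A (B \<oplus>\<^sub>F C) \<cdot>\<^sub>F g"
    "any_pr1 B C \<cdot>\<^sub>F (any_pr2 A (B \<oplus>\<^sub>F C) \<cdot>\<^sub>F f) = any_pr1 B C \<cdot>\<^sub>F (any_pr2 A (B \<oplus>\<^sub>F C) \<cdot>\<^sub>F g)"
    "any_pr2 B C \<cdot>\<^sub>F (any_pr2 A (B \<oplus>\<^sub>F C) \<cdot>\<^sub>F f) = any_pr2 B C \<cdot>\<^sub>F (any_pr2 A (B \<oplus>\<^sub>F C) \<cdot>\<^sub>F g)"
  shows "f = g"
proof (rule sum_joint_mono[OF assms(1-4)])
  show "any_pr2 A (B \<oplus>\<^sub>F C) \<cdot>\<^sub>F f = any_pr2 A (B \<oplus>\<^sub>F C) \<cdot>\<^sub>F g"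
    by (rule sum_joint_mono[OF _ _ _ assms(5,6)]) (simp_all add: assms(3))
qed

text \<open>
  Projections of a right-bracketed triple sum, applied to a morphism whose target is bracketed to the left.
\<close>
lemma pr_left_sum:
  assumes "any_cod f = A \<oplus>\<^sub>F B" "any_cod g = C"
  shows "any_pr1 A (B \<oplus>\<^sub>F C) \<cdot>\<^sub>F (f \<boxplus>\<^sub>F g) = any_pr1 A B \<cdot>\<^sub>F (f \<cdot>\<^sub>F any_pr1 (any_dom f) (any_dom g))"
    "any_pr1 B C \<cdot>\<^sub>F (any_pr2 A (B \<oplus>\<^sub>F C) \<cdot>\<^sub>F (f \<boxplus>\<^sub>F g)) = any_pr2 A B \<cdot>\<^sub>F (f \<cdot>\<^sub>F any_pr1 (any_dom f) (any_dom g))"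
    "any_pr2 B C \<cdot>\<^sub>F (any_pr2 A (B \<oplus>\<^sub>F C) \<cdot>\<^sub>F (f \<boxplus>\<^sub>F g)) = g \<cdot>\<^sub>F any_pr2 (any_dom f) (any_dom g)"
proof -
  show "any_pr1 A (B \<oplus>\<^sub>F C) \<cdot>\<^sub>F (f \<boxplus>\<^sub>F g) = any_pr1 A B \<cdot>\<^sub>F (f \<cdot>\<^sub>F any_pr1 (any_dom f) (any_dom g))"
    using assms by (subst pr_sum_assoc_reassoc[symmetric]) (simp_all add: sum_ob_assoc)
  show "any_pr1 B C \<cdot>\<^sub>F (any_pr2 A (B \<oplus>\<^sub>F C) \<cdot>\<^sub>F (f \<boxplus>\<^sub>F g)) = any_pr2 A B \<cdot>\<^sub>F (f \<cdot>\<^sub>F any_pr1 (any_dom f) (any_dom g))"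
    using assms by (subst pr_sum_assoc_reassoc[symmetric]) (simp_all add: sum_ob_assoc)
  show "any_pr2 B C \<cdot>\<^sub>F (any_pr2 A (B \<oplus>\<^sub>F C) \<cdot>\<^sub>F (f \<boxplus>\<^sub>F g)) = g \<cdot>\<^sub>F any_pr2 (any_dom f) (any_dom g)"
    using pr_sum_mor(2)[OF assms] assms by (simp add: sum_ob_assoc pr_sum_assoc(3))
qed

lemma pr_left_sum_reassoc:
  assumes "any_cod f = A \<oplus>\<^sub>F B" "any_cod g = C" "any_cod h = any_dom f \<oplus>\<^sub>F any_dom g"
  shows "any_pr1 A (B \<oplus>\<^sub>F C) \<cdot>\<^sub>F ((f \<boxplus>\<^sub>F g) \<cdot>\<^sub>F h) = any_pr1 A B \<cdot>\<^sub>F (f \<cdot>\<^sub>F (any_pr1 (any_dom f) (any_dom g) \<cdot>\<^sub>F h))"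
    "any_pr1 B C \<cdot>\<^sub>F (any_pr2 A (B \<oplus>\<^sub>F C) \<cdot>\<^sub>F ((f \<boxplus>\<^sub>F g) \<cdot>\<^sub>F h))
       = any_pr2 A B \<cdot>\<^sub>F (f \<cdot>\<^sub>F (any_pr1 (any_dom f) (any_dom g) \<cdot>\<^sub>F h))"
    "any_pr2 B C \<cdot>\<^sub>F (any_pr2 A (B \<oplus>\<^sub>F C) \<cdot>\<^sub>F ((f \<boxplus>\<^sub>F g) \<cdot>\<^sub>F h))
       = g \<cdot>\<^sub>F (any_pr2 (any_dom f) (any_dom g) \<cdot>\<^sub>F h)"
  using pr_left_sum[OF assms(1,2), THEN arg_cong[where f = "\<lambda>k. k \<cdot>\<^sub>F h"]] assms
  by (simp_all add: sum_ob_assoc)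

lemma sum_mor_assoc: "f \<boxplus>\<^sub>F g \<boxplus>\<^sub>F h = f \<boxplus>\<^sub>F (g \<boxplus>\<^sub>F h)"
  by (rule sum_joint_mono3[of _ "any_cod f" "any_cod g" "any_cod h"])
    (simp_all add: sum_ob_assoc pr_left_sum pr_sum_assoc)

lemma zero_sum_mor [simp]: "any_id any_zero \<boxplus>\<^sub>F f = f" "f \<boxplus>\<^sub>F any_id any_zero = f"
  using pr_sum_mor(2)[of "any_id any_zero" any_zero f "any_cod f"]
    pr_sum_mor(1)[of f "any_cod f" "any_id any_zero" any_zero] by simp_all

lemma pr_sum_sym_right:
  "any_pr1 B (C \<oplus>\<^sub>F A) \<cdot>\<^sub>F any_sum_sym A (B \<oplus>\<^sub>F C) = any_pr1 B C \<cdot>\<^sub>F any_pr2 A (B \<oplus>\<^sub>F C)"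
  "any_pr1 C A \<cdot>\<^sub>F (any_pr2 B (C \<oplus>\<^sub>F A) \<cdot>\<^sub>F any_sum_sym A (B \<oplus>\<^sub>F C)) = any_pr2 B C \<cdot>\<^sub>F any_pr2 A (B \<oplus>\<^sub>F C)"
  "any_pr2 C A \<cdot>\<^sub>F (any_pr2 B (C \<oplus>\<^sub>F A) \<cdot>\<^sub>F any_sum_sym A (B \<oplus>\<^sub>F C)) = any_pr1 A (B \<oplus>\<^sub>F C)"
proof -
  show "any_pr1 B (C \<oplus>\<^sub>F A) \<cdot>\<^sub>F any_sum_sym A (B \<oplus>\<^sub>F C) = any_pr1 B C \<cdot>\<^sub>F any_pr2 A (B \<oplus>\<^sub>F C)"
    by (subst pr_sum_assoc_reassoc[symmetric]) (simp_all add: sum_ob_assoc)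
  show "any_pr1 C A \<cdot>\<^sub>F (any_pr2 B (C \<oplus>\<^sub>F A) \<cdot>\<^sub>F any_sum_sym A (B \<oplus>\<^sub>F C)) = any_pr2 B C \<cdot>\<^sub>F any_pr2 A (B \<oplus>\<^sub>F C)"
    by (subst pr_sum_assoc_reassoc[symmetric]) (simp_all add: sum_ob_assoc)
  show "any_pr2 C A \<cdot>\<^sub>F (any_pr2 B (C \<oplus>\<^sub>F A) \<cdot>\<^sub>F any_sum_sym A (B \<oplus>\<^sub>F C)) = any_pr1 A (B \<oplus>\<^sub>F C)"
    using pr_sum_sym(2)[of "B \<oplus>\<^sub>F C" A] by (simp add: sum_ob_assoc pr_sum_assoc(3))
qed

lemma sum_sym_sym: "any_sum_sym B A \<cdot>\<^sub>F any_sum_sym A B = any_id (A \<oplus>\<^sub>F B)"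
  by (rule sum_joint_mono) auto

lemma id_inverse: "A = B \<Longrightarrow> cat.inverse_arrows A B (any_id A) (any_id A)"
  by (simp add: cat.inverse_arrows_def any_hom_iff)

lemma inverse_ofI: "cat.inverse_arrows A B f g \<Longrightarrow> cat.inverse_of A B f = g"
  unfolding cat.inverse_of_def
proof (rule the_equality)
  fix h assume "cat.inverse_arrows A B f g" "cat.inverse_arrows A B f h"
  then have "h = (g \<cdot>\<^sub>F f) \<cdot>\<^sub>F h" "g = g \<cdot>\<^sub>F (f \<cdot>\<^sub>F h)" "any_dom f = A" "any_cod f = B" "any_dom g = B"
     "any_cod g = A" "any_dom h = B" "any_cod h = A"
    by (auto simp: cat.inverse_arrows_def any_hom_iff)
  then show "h = g" by simp
qed

lemma inverse_of_id: "A = B \<Longrightarrow> cat.inverse_of A B (any_id A) = any_id A"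
  by (intro inverse_ofI id_inverse)

lemma is_isoI: "cat.inverse_arrows A B f g \<Longrightarrow> cat.is_iso A B f"
  unfolding cat.is_iso_def by blast

lemma is_iso_mono: "cat.is_iso A B f \<Longrightarrow> cat.is_mono A B f"
  unfolding cat.is_mono_def
proof (intro conjI allI ballI impI)
  assume "cat.is_iso A B f"
  then obtain k where k: "any_dom f = A" "any_cod f = B" "any_dom k = B" "any_cod k = A" "k \<cdot>\<^sub>F f = any_id A"
    by (auto simp: cat.is_iso_def cat.inverse_arrows_def any_hom_iff)
  then show "f \<in> any_hom A B" by (simp add: any_hom_iff)
  fix X g h assume "g \<in> any_hom X A" "h \<in> any_hom X A" and eq: "f \<cdot>\<^sub>F g = f \<cdot>\<^sub>F h"
  then have "g = (k \<cdot>\<^sub>F f) \<cdot>\<^sub>F g" "h = (k \<cdot>\<^sub>F f) \<cdot>\<^sub>F h" "any_cod g = A" "any_cod h = A"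
    using k(5) by (auto simp: any_hom_iff)
  then show "g = h" using k eq by (metis any_comp_assoc)
qed

theorem any_sum_symmetric_monoidal:
  "symmetric_monoidal_category any_hom any_comp any_id any_sum any_sum_mor any_zero
     any_sum_assoc any_sum_lunit any_sum_runit any_sum_sym"
proof unfold_locales
  fix A B C D :: anyon_ob and f g h :: anyon_mor
  show "cat.is_iso (A \<oplus>\<^sub>F B \<oplus>\<^sub>F C) (A \<oplus>\<^sub>F (B \<oplus>\<^sub>F C)) (any_sum_assoc A B C)"
    unfolding any_sum_assoc_def by (rule is_isoI[OF id_inverse]) (rule sum_ob_assoc)
  show "cat.is_iso (any_zero \<oplus>\<^sub>F A) A (any_sum_lunit A)" "cat.is_iso (A \<oplus>\<^sub>F any_zero) A (any_sum_runit A)"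
    unfolding any_sum_lunit_def any_sum_runit_def using is_isoI[OF id_inverse[OF refl, of A]] by simp_all
  show "cat.is_iso (A \<oplus>\<^sub>F B) (B \<oplus>\<^sub>F A) (any_sum_sym A B)"
    by (rule is_isoI[where g = "any_sum_sym B A"])
      (simp add: cat.inverse_arrows_def any_hom_iff sum_sym_sym)
next
  fix A A' B B' f g assume "f \<in> any_hom A A'" "g \<in> any_hom B B'"
  then show "any_sum_sym A' B' \<cdot>\<^sub>F (f \<boxplus>\<^sub>F g) = (g \<boxplus>\<^sub>F f) \<cdot>\<^sub>F any_sum_sym A B"
    by - (rule sum_joint_mono[of _ B' A'], auto simp: any_hom_iff)
next
  fix A B C :: anyon_ob
  show "any_sum_assoc B C A \<cdot>\<^sub>F any_sum_sym A (B \<oplus>\<^sub>F C) \<cdot>\<^sub>F any_sum_assoc A B C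
       = (any_id B \<boxplus>\<^sub>F any_sum_sym A C) \<cdot>\<^sub>F any_sum_assoc B A C \<cdot>\<^sub>F (any_sum_sym A B \<boxplus>\<^sub>F any_id C)"
    unfolding any_sum_assoc_def
    by (rule sum_joint_mono3[of _ B C A]) (simp_all add: sum_ob_assoc pr_left_sum pr_sum_assoc pr_sum_sym_right)
  show "cat.inverse_of (C \<oplus>\<^sub>F A \<oplus>\<^sub>F B) (C \<oplus>\<^sub>F (A \<oplus>\<^sub>F B)) (any_sum_assoc C A B)
         \<cdot>\<^sub>F any_sum_sym (A \<oplus>\<^sub>F B) C
         \<cdot>\<^sub>F cat.inverse_of (A \<oplus>\<^sub>F B \<oplus>\<^sub>F C) (A \<oplus>\<^sub>F (B \<oplus>\<^sub>F C)) (any_sum_assoc A B C)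
       = (any_sum_sym A C \<boxplus>\<^sub>F any_id B)
         \<cdot>\<^sub>F cat.inverse_of (A \<oplus>\<^sub>F C \<oplus>\<^sub>F B) (A \<oplus>\<^sub>F (C \<oplus>\<^sub>F B)) (any_sum_assoc A C B)
         \<cdot>\<^sub>F (any_id A \<boxplus>\<^sub>F any_sum_sym B C)"
    unfolding any_sum_assoc_def inverse_of_id[OF sum_ob_assoc]
    by (rule sum_joint_mono3[of _ C A B])
      (simp_all add: sum_ob_assoc pr_left_sum_reassoc pr_sum_assoc pr_sum_assoc_reassoc)
qed (auto simp: any_hom_iff sum_mor_comp any_sum_assoc_def any_sum_lunit_def any_sum_runit_def sum_ob_assoc
    sum_mor_assoc sum_sym_sym)

section \<open>The multiplicative structure\<close>

text \<open>A diagonal morphism with invertible entries has the diagonal of their inverses as its inverse.\<close>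
lemma extension_inverse:
  assumes D: "decomp D I \<iota> \<pi>" and E: "decomp E I \<kappa> \<rho>"
    and \<phi>: "\<And>i. i \<in> I \<Longrightarrow> cat.inverse_arrows (any_dom (\<iota> i)) (any_dom (\<kappa> i)) (\<phi> i) (\<psi> i)"
  shows "cat.inverse_arrows D E (any_Sum D E (\<lambda>i. \<kappa> i \<cdot>\<^sub>F \<phi> i \<cdot>\<^sub>F \<pi> i) I)
           (any_Sum E D (\<lambda>i. \<iota> i \<cdot>\<^sub>F \<psi> i \<cdot>\<^sub>F \<rho> i) I)"
    (is "cat.inverse_arrows D E ?\<Phi> ?\<Psi>")
proof -
  have \<phi>: "any_dom (\<phi> i) = any_dom (\<iota> i)" "any_cod (\<phi> i) = any_dom (\<kappa> i)"
      "any_dom (\<psi> i) = any_dom (\<kappa> i)" "any_cod (\<psi> i) = any_dom (\<iota> i)"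
      "\<psi> i \<cdot>\<^sub>F \<phi> i = any_id (any_dom (\<iota> i))" "\<phi> i \<cdot>\<^sub>F \<psi> i = any_id (any_dom (\<kappa> i))" if "i \<in> I" for i
    using \<phi>[OF that] by (auto simp: cat.inverse_arrows_def any_hom_iff)
  have in1: "?\<Phi> \<cdot>\<^sub>F \<iota> i = \<kappa> i \<cdot>\<^sub>F \<phi> i" if "i \<in> I" for i
    using that by (intro extension_in[OF D E]) (simp_all add: \<phi>)
  have in2: "?\<Psi> \<cdot>\<^sub>F \<kappa> i = \<iota> i \<cdot>\<^sub>F \<psi> i" if "i \<in> I" for i
    using that by (intro extension_in[OF E D]) (simp_all add: \<phi>)
  have "?\<Psi> \<cdot>\<^sub>F ?\<Phi> = any_id D"
  proof (rule decomp_joint_epi[OF D])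
    fix i assume i: "i \<in> I"
    note [simp] = decompD(2)[OF D i] decompD(2)[OF E i] \<phi>[OF i]
    have "?\<Psi> \<cdot>\<^sub>F ?\<Phi> \<cdot>\<^sub>F \<iota> i = (?\<Psi> \<cdot>\<^sub>F \<kappa> i) \<cdot>\<^sub>F \<phi> i" by (simp add: in1[OF i])
    also have "\<dots> = any_id D \<cdot>\<^sub>F \<iota> i" by (simp add: in2[OF i])
    finally show "?\<Psi> \<cdot>\<^sub>F ?\<Phi> \<cdot>\<^sub>F \<iota> i = any_id D \<cdot>\<^sub>F \<iota> i" .
  qed simp_all
  moreover have "?\<Phi> \<cdot>\<^sub>F ?\<Psi> = any_id E"
  proof (rule decomp_joint_epi[OF E])
    fix i assume i: "i \<in> I"
    note [simp] = decompD(2)[OF D i] decompD(2)[OF E i] \<phi>[OF i]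
    have "?\<Phi> \<cdot>\<^sub>F ?\<Psi> \<cdot>\<^sub>F \<kappa> i = (?\<Phi> \<cdot>\<^sub>F \<iota> i) \<cdot>\<^sub>F \<psi> i" by (simp add: in2[OF i])
    also have "\<dots> = any_id E \<cdot>\<^sub>F \<kappa> i" by (simp add: in1[OF i])
    finally show "?\<Phi> \<cdot>\<^sub>F ?\<Psi> \<cdot>\<^sub>F \<kappa> i = any_id E \<cdot>\<^sub>F \<kappa> i" .
  qed simp_all
  ultimately show ?thesis by (simp add: cat.inverse_arrows_def any_hom_iff)
qed

lemma simple_assoc_inverse:
  "cat.inverse_arrows (simple_ob s \<otimes>\<^sub>F simple_ob t \<otimes>\<^sub>F simple_ob u) (simple_ob s \<otimes>\<^sub>F (simple_ob t \<otimes>\<^sub>F simple_ob u))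
     (simple_assoc s t u) (simple_assoc s t u)"
  by (simp add: cat.inverse_arrows_def any_hom_iff simple_assoc_invol prod_ob_assoc)

definition any_prod_assoc_inv :: "anyon_ob \<Rightarrow> anyon_ob \<Rightarrow> anyon_ob \<Rightarrow> anyon_mor" where
  "any_prod_assoc_inv A B C = cat.inverse_of (A \<otimes>\<^sub>F B \<otimes>\<^sub>F C) (A \<otimes>\<^sub>F (B \<otimes>\<^sub>F C)) (any_prod_assoc A B C)"

lemma assoc_inverse:
  "cat.inverse_arrows (A \<otimes>\<^sub>F B \<otimes>\<^sub>F C) (A \<otimes>\<^sub>F (B \<otimes>\<^sub>F C)) (any_prod_assoc A B C) (any_prod_assoc_inv A B C)"
proof -
  obtain g where "cat.inverse_arrows (A \<otimes>\<^sub>F B \<otimes>\<^sub>F C) (A \<otimes>\<^sub>F (B \<otimes>\<^sub>F C)) (any_prod_assoc A B C) g"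
    using extension_inverse[OF simple_decomp_left[of A B C] simple_decomp_right[of A B C],
      of "\<lambda>(a, b, c). simple_assoc (fst a) (fst b) (fst c)" "\<lambda>(a, b, c). simple_assoc (fst a) (fst b) (fst c)"]
      simple_assoc_inverse
    by (auto simp: any_prod_assoc_def case_prod_unfold)
  then show ?thesis using inverse_ofI by (simp add: any_prod_assoc_inv_def)
qed

lemma assoc_inv_simps [simp]:
  "any_dom (any_prod_assoc_inv A B C) = A \<otimes>\<^sub>F (B \<otimes>\<^sub>F C)"
  "any_cod (any_prod_assoc_inv A B C) = A \<otimes>\<^sub>F B \<otimes>\<^sub>F C"
  "any_prod_assoc_inv A B C \<cdot>\<^sub>F any_prod_assoc A B C = any_id (A \<otimes>\<^sub>F B \<otimes>\<^sub>F C)"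
  "any_prod_assoc A B C \<cdot>\<^sub>F any_prod_assoc_inv A B C = any_id (A \<otimes>\<^sub>F (B \<otimes>\<^sub>F C))"
  using assoc_inverse[of A B C] by (auto simp: cat.inverse_arrows_def any_hom_iff)

lemma assoc_inv_natural:
  assumes [simp]: "any_cod f = A" "any_cod g = B" "any_cod h = C"
  shows "any_prod_assoc_inv A B C \<cdot>\<^sub>F (f \<boxtimes>\<^sub>F (g \<boxtimes>\<^sub>F h))
    = (f \<boxtimes>\<^sub>F g \<boxtimes>\<^sub>F h) \<cdot>\<^sub>F any_prod_assoc_inv (any_dom f) (any_dom g) (any_dom h)"
proof -
  let ?A = "any_dom f" and ?B = "any_dom g" and ?C = "any_dom h"
  have "any_prod_assoc_inv A B C \<cdot>\<^sub>F (f \<boxtimes>\<^sub>F (g \<boxtimes>\<^sub>F h))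
      = any_prod_assoc_inv A B C \<cdot>\<^sub>F (((f \<boxtimes>\<^sub>F (g \<boxtimes>\<^sub>F h)) \<cdot>\<^sub>F any_prod_assoc ?A ?B ?C) \<cdot>\<^sub>F any_prod_assoc_inv ?A ?B ?C)"
    by simp
  also have "\<dots> = any_prod_assoc_inv A B C \<cdot>\<^sub>F ((any_prod_assoc A B C \<cdot>\<^sub>F (f \<boxtimes>\<^sub>F g \<boxtimes>\<^sub>F h)) \<cdot>\<^sub>F any_prod_assoc_inv ?A ?B ?C)"
    by (simp only: assoc_natural[OF assms])
  also have "\<dots> = (f \<boxtimes>\<^sub>F g \<boxtimes>\<^sub>F h) \<cdot>\<^sub>F any_prod_assoc_inv ?A ?B ?C"
    by (simp add: comp_reassoc[OF assoc_inv_simps(3)])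
  finally show ?thesis .
qed

lemma assoc_inv_vacuum [simp]:
  "any_prod_assoc_inv vacuum B C = any_id (B \<otimes>\<^sub>F C)"
  "any_prod_assoc_inv A vacuum C = any_id (A \<otimes>\<^sub>F C)"
  "any_prod_assoc_inv A B vacuum = any_id (A \<otimes>\<^sub>F B)"
  by (simp_all add: any_prod_assoc_inv_def inverse_of_id)

lemma assoc_inv_tau: "any_prod_assoc_inv tau tau tau = any_prod_assoc tau tau tau"
  using inverse_ofI[OF simple_assoc_inverse[of Tau Tau Tau]] any_prod_assoc_simple[of Tau Tau Tau]
  by (simp add: any_prod_assoc_inv_def)

lemma braid_is_iso: "cat.is_iso (A \<otimes>\<^sub>F B) (B \<otimes>\<^sub>F A) (any_prod_braid A B)"
proof -
  define r :: "simple \<Rightarrow> simple \<Rightarrow> anyon_mor" where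
    "r s t = (if s = Tau \<and> t = Tau then (list_mat (Suc 0) [[1 / fib_z\<^sup>2]], list_mat (Suc 0) [[1 / fib_z]])
       else any_id (simple_ob s \<otimes>\<^sub>F simple_ob t))" for s t
  have z: "fib_z \<noteq> 0" by (simp add: fib_z_def)
  have tau: "cat.inverse_arrows (tau \<otimes>\<^sub>F tau) (tau \<otimes>\<^sub>F tau) (simple_braid Tau Tau) (r Tau Tau)"
    unfolding cat.inverse_arrows_def any_hom_iff simple_braid_tau r_def tau_tau
    using z by (auto intro!: any_mor_eqI simp: anyon_eval)
  have "cat.inverse_arrows (simple_ob s \<otimes>\<^sub>F simple_ob t) (simple_ob t \<otimes>\<^sub>F simple_ob s)
      (simple_braid s t) (r s t)" for s t
    using tau by (cases s; cases t) (simp_all add: simple_braid_unit r_def id_inverse)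
  then show ?thesis
    using extension_inverse[OF simple_decomp_prod[of A B] simple_decomp_swap[of B A],
      of "\<lambda>(a, b). simple_braid (fst a) (fst b)" "\<lambda>(a, b). r (fst a) (fst b)"]
    by (intro is_isoI) (auto simp: any_prod_braid_def case_prod_unfold)
qed

definition hexagon_inv_left :: "anyon_ob \<Rightarrow> anyon_ob \<Rightarrow> anyon_ob \<Rightarrow> anyon_mor" where
  "hexagon_inv_left A B C =
     any_prod_assoc_inv C A B \<cdot>\<^sub>F any_prod_braid (A \<otimes>\<^sub>F B) C \<cdot>\<^sub>F any_prod_assoc_inv A B C"

definition hexagon_inv_right :: "anyon_ob \<Rightarrow> anyon_ob \<Rightarrow> anyon_ob \<Rightarrow> anyon_mor" where
  "hexagon_inv_right A B C = (any_prod_braid A C \<boxtimes>\<^sub>F any_id B) \<cdot>\<^sub>F any_prod_assoc_inv A C B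
     \<cdot>\<^sub>F (any_id A \<boxtimes>\<^sub>F any_prod_braid B C)"

lemma hexagon_inv_dim [simp]:
  "any_dom (hexagon_inv_left A B C) = A \<otimes>\<^sub>F (B \<otimes>\<^sub>F C)" "any_cod (hexagon_inv_left A B C) = C \<otimes>\<^sub>F A \<otimes>\<^sub>F B"
  "any_dom (hexagon_inv_right A B C) = A \<otimes>\<^sub>F (B \<otimes>\<^sub>F C)" "any_cod (hexagon_inv_right A B C) = C \<otimes>\<^sub>F A \<otimes>\<^sub>F B"
  by (simp_all add: hexagon_inv_left_def hexagon_inv_right_def)

lemma hexagon_inv_natural:
  assumes [simp]: "any_cod f = A" "any_cod g = B" "any_cod h = C"
  shows "hexagon_inv_left A B C \<cdot>\<^sub>F (f \<boxtimes>\<^sub>F (g \<boxtimes>\<^sub>F h))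
      = (h \<boxtimes>\<^sub>F f \<boxtimes>\<^sub>F g) \<cdot>\<^sub>F hexagon_inv_left (any_dom f) (any_dom g) (any_dom h)"
    and "hexagon_inv_right A B C \<cdot>\<^sub>F (f \<boxtimes>\<^sub>F (g \<boxtimes>\<^sub>F h))
      = (h \<boxtimes>\<^sub>F f \<boxtimes>\<^sub>F g) \<cdot>\<^sub>F hexagon_inv_right (any_dom f) (any_dom g) (any_dom h)"
proof -
  let ?A = "any_dom f" and ?B = "any_dom g" and ?C = "any_dom h"
  have "any_prod_assoc_inv A B C \<cdot>\<^sub>F (f \<boxtimes>\<^sub>F (g \<boxtimes>\<^sub>F h)) = (f \<boxtimes>\<^sub>F g \<boxtimes>\<^sub>F h) \<cdot>\<^sub>F any_prod_assoc_inv ?A ?B ?C"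
    by (simp add: assoc_inv_natural)
  moreover have "any_prod_braid (A \<otimes>\<^sub>F B) C \<cdot>\<^sub>F (f \<boxtimes>\<^sub>F g \<boxtimes>\<^sub>F h)
      = (h \<boxtimes>\<^sub>F (f \<boxtimes>\<^sub>F g)) \<cdot>\<^sub>F any_prod_braid (?A \<otimes>\<^sub>F ?B) ?C"
    by (simp add: braid_natural)
  moreover have "any_prod_assoc_inv C A B \<cdot>\<^sub>F (h \<boxtimes>\<^sub>F (f \<boxtimes>\<^sub>F g)) = (h \<boxtimes>\<^sub>F f \<boxtimes>\<^sub>F g) \<cdot>\<^sub>F any_prod_assoc_inv ?C ?A ?B"
    by (simp add: assoc_inv_natural)
  ultimately show "hexagon_inv_left A B C \<cdot>\<^sub>F (f \<boxtimes>\<^sub>F (g \<boxtimes>\<^sub>F h)) = (h \<boxtimes>\<^sub>F f \<boxtimes>\<^sub>F g) \<cdot>\<^sub>F hexagon_inv_left ?A ?B ?C"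
    unfolding hexagon_inv_left_def by (rule paste_squares3) simp_all
  have "(any_id A \<boxtimes>\<^sub>F any_prod_braid B C) \<cdot>\<^sub>F (f \<boxtimes>\<^sub>F (g \<boxtimes>\<^sub>F h))
      = (f \<boxtimes>\<^sub>F (h \<boxtimes>\<^sub>F g)) \<cdot>\<^sub>F (any_id ?A \<boxtimes>\<^sub>F any_prod_braid ?B ?C)"
    by (simp add: braid_natural)
  moreover have "any_prod_assoc_inv A C B \<cdot>\<^sub>F (f \<boxtimes>\<^sub>F (h \<boxtimes>\<^sub>F g)) = (f \<boxtimes>\<^sub>F h \<boxtimes>\<^sub>F g) \<cdot>\<^sub>F any_prod_assoc_inv ?A ?C ?B"
    by (simp add: assoc_inv_natural)
  moreover have "(any_prod_braid A C \<boxtimes>\<^sub>F any_id B) \<cdot>\<^sub>F (f \<boxtimes>\<^sub>F h \<boxtimes>\<^sub>F g)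
      = (h \<boxtimes>\<^sub>F f \<boxtimes>\<^sub>F g) \<cdot>\<^sub>F (any_prod_braid ?A ?C \<boxtimes>\<^sub>F any_id ?B)"
    by (simp add: braid_natural)
  ultimately show "hexagon_inv_right A B C \<cdot>\<^sub>F (f \<boxtimes>\<^sub>F (g \<boxtimes>\<^sub>F h)) = (h \<boxtimes>\<^sub>F f \<boxtimes>\<^sub>F g) \<cdot>\<^sub>F hexagon_inv_right ?A ?B ?C"
    unfolding hexagon_inv_right_def by (rule paste_squares3) simp_all
qed

text \<open>
  For three factors \<open>\<tau>\<close> the associativity is its own inverse and the braidings involved are the same diagonal
  matrices in both hexagons, so the second hexagon is the first one.
\<close>
lemma hexagon_inv_tau: "hexagon_inv_left tau tau tau = hexagon_inv_right tau tau tau"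
  using hexagon_tau
  unfolding hexagon_inv_left_def hexagon_inv_right_def assoc_inv_tau id_tensor_braid_tau braid_tau_tensor_id
    tau_tau braid_sigma_left braid_sigma_right by simp

lemma hexagon_inv_simple:
  "hexagon_inv_left (simple_ob s) (simple_ob t) (simple_ob u) = hexagon_inv_right (simple_ob s) (simple_ob t) (simple_ob u)"
  using hexagon_inv_tau
  by (cases s; cases t; cases u) (simp_all add: hexagon_inv_left_def hexagon_inv_right_def)

lemma hexagon_inv: "hexagon_inv_left A B C = hexagon_inv_right A B C"
  by (rule decomp_joint_epi[OF simple_decomp_right[of A B C]])
    (auto simp: hexagon_inv_natural hexagon_inv_simple)

theorem any_prod_braided_monoidal:
  "braided_monoidal_category any_hom any_comp any_id any_prod any_prod_mor vacuum
     any_prod_assoc any_prod_lunit any_prod_runit any_prod_braid"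
proof unfold_locales
  fix A B C D :: anyon_ob
  show "cat.is_iso (A \<otimes>\<^sub>F B \<otimes>\<^sub>F C) (A \<otimes>\<^sub>F (B \<otimes>\<^sub>F C)) (any_prod_assoc A B C)"
    by (rule is_isoI[OF assoc_inverse])
  show "cat.is_iso (A \<otimes>\<^sub>F B) (B \<otimes>\<^sub>F A) (any_prod_braid A B)"
    by (rule braid_is_iso)
  show "cat.is_iso (vacuum \<otimes>\<^sub>F A) A (any_prod_lunit A)" "cat.is_iso (A \<otimes>\<^sub>F vacuum) A (any_prod_runit A)"
    unfolding any_prod_lunit_def any_prod_runit_def using is_isoI[OF id_inverse[OF refl, of A]] by simp_all
  show "(any_id A \<boxtimes>\<^sub>F any_prod_assoc B C D) \<cdot>\<^sub>F any_prod_assoc A (B \<otimes>\<^sub>F C) D \<cdot>\<^sub>F (any_prod_assoc A B C \<boxtimes>\<^sub>F any_id D)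
       = any_prod_assoc A B (C \<otimes>\<^sub>F D) \<cdot>\<^sub>F any_prod_assoc (A \<otimes>\<^sub>F B) C D"
    using pentagon[of A B C D] unfolding pentagon_upper_def pentagon_lower_def .
  show "any_prod_assoc B C A \<cdot>\<^sub>F any_prod_braid A (B \<otimes>\<^sub>F C) \<cdot>\<^sub>F any_prod_assoc A B C
       = (any_id B \<boxtimes>\<^sub>F any_prod_braid A C) \<cdot>\<^sub>F any_prod_assoc B A C \<cdot>\<^sub>F (any_prod_braid A B \<boxtimes>\<^sub>F any_id C)"
    using hexagon[of A B C] unfolding hexagon_left_def hexagon_right_def .
  show "cat.inverse_of (C \<otimes>\<^sub>F A \<otimes>\<^sub>F B) (C \<otimes>\<^sub>F (A \<otimes>\<^sub>F B)) (any_prod_assoc C A B)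
         \<cdot>\<^sub>F any_prod_braid (A \<otimes>\<^sub>F B) C
         \<cdot>\<^sub>F cat.inverse_of (A \<otimes>\<^sub>F B \<otimes>\<^sub>F C) (A \<otimes>\<^sub>F (B \<otimes>\<^sub>F C)) (any_prod_assoc A B C)
       = (any_prod_braid A C \<boxtimes>\<^sub>F any_id B)
         \<cdot>\<^sub>F cat.inverse_of (A \<otimes>\<^sub>F C \<otimes>\<^sub>F B) (A \<otimes>\<^sub>F (C \<otimes>\<^sub>F B)) (any_prod_assoc A C B)
         \<cdot>\<^sub>F (any_id A \<boxtimes>\<^sub>F any_prod_braid B C)"
    using hexagon_inv[of A B C] unfolding hexagon_inv_left_def hexagon_inv_right_def any_prod_assoc_inv_def .
qed (auto simp: any_hom_iff any_prod_lunit_def any_prod_runit_def assoc_natural braid_natural)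

section \<open>Distributivity\<close>

lemma dist_dim [simp]:
  "any_dom (any_ldist A B C) = A \<otimes>\<^sub>F (B \<oplus>\<^sub>F C)" "any_cod (any_ldist A B C) = A \<otimes>\<^sub>F B \<oplus>\<^sub>F A \<otimes>\<^sub>F C"
  "any_dom (any_rdist A B C) = (A \<oplus>\<^sub>F B) \<otimes>\<^sub>F C" "any_cod (any_rdist A B C) = A \<otimes>\<^sub>F C \<oplus>\<^sub>F B \<otimes>\<^sub>F C"
  by (simp_all add: any_ldist_def any_rdist_def)

text \<open>
  The distributivity isomorphisms are the canonical comparisons: composing with a projection of the target
  gives the image under the product functor of the corresponding projection.
\<close>
lemma pr_dist [simp]:
  "any_pr1 (A \<otimes>\<^sub>F B) (A \<otimes>\<^sub>F C) \<cdot>\<^sub>F any_ldist A B C = any_id A \<boxtimes>\<^sub>F any_pr1 B C"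
  "any_pr2 (A \<otimes>\<^sub>F B) (A \<otimes>\<^sub>F C) \<cdot>\<^sub>F any_ldist A B C = any_id A \<boxtimes>\<^sub>F any_pr2 B C"
  "any_pr1 (A \<otimes>\<^sub>F C) (B \<otimes>\<^sub>F C) \<cdot>\<^sub>F any_rdist A B C = any_pr1 A B \<boxtimes>\<^sub>F any_id C"
  "any_pr2 (A \<otimes>\<^sub>F C) (B \<otimes>\<^sub>F C) \<cdot>\<^sub>F any_rdist A B C = any_pr2 A B \<boxtimes>\<^sub>F any_id C"
  by (simp_all add: any_ldist_def any_rdist_def any_comp_plus_right flip: any_comp_assoc)

lemma pr_dist_reassoc [simp]:
  "any_cod h = A \<otimes>\<^sub>F (B \<oplus>\<^sub>F C) \<Longrightarrow>
     any_pr1 (A \<otimes>\<^sub>F B) (A \<otimes>\<^sub>F C) \<cdot>\<^sub>F (any_ldist A B C \<cdot>\<^sub>F h) = (any_id A \<boxtimes>\<^sub>F any_pr1 B C) \<cdot>\<^sub>F h"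
  "any_cod h = A \<otimes>\<^sub>F (B \<oplus>\<^sub>F C) \<Longrightarrow>
     any_pr2 (A \<otimes>\<^sub>F B) (A \<otimes>\<^sub>F C) \<cdot>\<^sub>F (any_ldist A B C \<cdot>\<^sub>F h) = (any_id A \<boxtimes>\<^sub>F any_pr2 B C) \<cdot>\<^sub>F h"
  "any_cod h = (A \<oplus>\<^sub>F B) \<otimes>\<^sub>F C \<Longrightarrow>
     any_pr1 (A \<otimes>\<^sub>F C) (B \<otimes>\<^sub>F C) \<cdot>\<^sub>F (any_rdist A B C \<cdot>\<^sub>F h) = (any_pr1 A B \<boxtimes>\<^sub>F any_id C) \<cdot>\<^sub>F h"
  "any_cod h = (A \<oplus>\<^sub>F B) \<otimes>\<^sub>F C \<Longrightarrow>
     any_pr2 (A \<otimes>\<^sub>F C) (B \<otimes>\<^sub>F C) \<cdot>\<^sub>F (any_rdist A B C \<cdot>\<^sub>F h) = (any_pr2 A B \<boxtimes>\<^sub>F any_id C) \<cdot>\<^sub>F h"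
  by (simp_all add: comp_reassoc[OF pr_dist(1)] comp_reassoc[OF pr_dist(2)] comp_reassoc[OF pr_dist(3)]
      comp_reassoc[OF pr_dist(4)])

lemma ldist_is_iso:
  "cat.is_iso (A \<otimes>\<^sub>F (B \<oplus>\<^sub>F C)) (A \<otimes>\<^sub>F B \<oplus>\<^sub>F A \<otimes>\<^sub>F C) (any_ldist A B C)"
proof (rule is_isoI)
  let ?g = "(any_id A \<boxtimes>\<^sub>F any_in1 B C) \<cdot>\<^sub>F any_pr1 (A \<otimes>\<^sub>F B) (A \<otimes>\<^sub>F C)
    +\<^sub>F (any_id A \<boxtimes>\<^sub>F any_in2 B C) \<cdot>\<^sub>F any_pr2 (A \<otimes>\<^sub>F B) (A \<otimes>\<^sub>F C)"
  have "?g \<cdot>\<^sub>F any_ldist A B C = any_id (A \<otimes>\<^sub>F (B \<oplus>\<^sub>F C))"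
    by (simp add: any_comp_plus_left in_pr_sum flip: any_prod_plus_right)
  moreover have "any_ldist A B C \<cdot>\<^sub>F ?g = any_id (A \<otimes>\<^sub>F B \<oplus>\<^sub>F A \<otimes>\<^sub>F C)"
    by (rule sum_joint_mono[of _ "A \<otimes>\<^sub>F B" "A \<otimes>\<^sub>F C"]) (simp_all add: any_comp_plus_right)
  ultimately show "cat.inverse_arrows (A \<otimes>\<^sub>F (B \<oplus>\<^sub>F C)) (A \<otimes>\<^sub>F B \<oplus>\<^sub>F A \<otimes>\<^sub>F C) (any_ldist A B C) ?g"
    by (simp add: cat.inverse_arrows_def any_hom_iff)
qed

lemma rdist_is_iso:
  "cat.is_iso ((A \<oplus>\<^sub>F B) \<otimes>\<^sub>F C) (A \<otimes>\<^sub>F C \<oplus>\<^sub>F B \<otimes>\<^sub>F C) (any_rdist A B C)"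
proof (rule is_isoI)
  let ?g = "(any_in1 A B \<boxtimes>\<^sub>F any_id C) \<cdot>\<^sub>F any_pr1 (A \<otimes>\<^sub>F C) (B \<otimes>\<^sub>F C)
    +\<^sub>F (any_in2 A B \<boxtimes>\<^sub>F any_id C) \<cdot>\<^sub>F any_pr2 (A \<otimes>\<^sub>F C) (B \<otimes>\<^sub>F C)"
  have "?g \<cdot>\<^sub>F any_rdist A B C = any_id ((A \<oplus>\<^sub>F B) \<otimes>\<^sub>F C)"
    by (simp add: any_comp_plus_left in_pr_sum flip: any_prod_plus_left)
  moreover have "any_rdist A B C \<cdot>\<^sub>F ?g = any_id (A \<otimes>\<^sub>F C \<oplus>\<^sub>F B \<otimes>\<^sub>F C)"
    by (rule sum_joint_mono[of _ "A \<otimes>\<^sub>F C" "B \<otimes>\<^sub>F C"]) (simp_all add: any_comp_plus_right)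
  ultimately show "cat.inverse_arrows ((A \<oplus>\<^sub>F B) \<otimes>\<^sub>F C) (A \<otimes>\<^sub>F C \<oplus>\<^sub>F B \<otimes>\<^sub>F C) (any_rdist A B C) ?g"
    by (simp add: cat.inverse_arrows_def any_hom_iff)
qed

text \<open>
  Naturality in the last argument alone; the identity of \<open>A \<otimes> B\<close> has to be read as a product of identities.
\<close>
lemma assoc_natural_id:
  "any_cod h = C \<Longrightarrow> any_prod_assoc A B C \<cdot>\<^sub>F (any_id (A \<otimes>\<^sub>F B) \<boxtimes>\<^sub>F h)
    = (any_id A \<boxtimes>\<^sub>F (any_id B \<boxtimes>\<^sub>F h)) \<cdot>\<^sub>F any_prod_assoc A B (any_dom h)"
  using assoc_natural[of "any_id A" A "any_id B" B h C] by simp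

lemma annihilator_dim [simp]:
  "any_dom (any_lzero A) = any_zero" "any_cod (any_lzero A) = any_zero"
  "any_dom (any_rzero A) = any_zero" "any_cod (any_rzero A) = any_zero"
  by (simp_all add: any_lzero_def any_rzero_def)

text \<open>The products with zero are strictly zero, so the annihilators are endomorphisms of the zero object.\<close>
lemma annihilator_id [simp]: "any_lzero A = any_id any_zero" "any_rzero A = any_id any_zero"
  by (rule any_into_zero; simp)+

lemma id_zero_prod_mor: "any_id any_zero \<boxtimes>\<^sub>F f = any_id any_zero" "f \<boxtimes>\<^sub>F any_id any_zero = any_id any_zero"
  by (rule any_into_zero; simp)+

text \<open>
  The first factor is the exchange of the middle summands of \<open>(W \<oplus> X) \<oplus> (Y \<oplus> Z)\<close> with the identities
  \<open>\<alpha>\<^sup>\<oplus>\<close> left out. Each of the four projections turns both sides into a product of two projections.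
\<close>
lemma dist_exchange:
  fixes A B C D :: anyon_ob
  defines "W \<equiv> A \<otimes>\<^sub>F C" and "X \<equiv> A \<otimes>\<^sub>F D" and "Y \<equiv> B \<otimes>\<^sub>F C" and "Z \<equiv> B \<otimes>\<^sub>F D"
  shows "(any_id W \<boxplus>\<^sub>F (any_sum_sym X Y \<boxplus>\<^sub>F any_id Z))
      \<cdot>\<^sub>F ((any_ldist A C D \<boxplus>\<^sub>F any_ldist B C D) \<cdot>\<^sub>F any_rdist A B (C \<oplus>\<^sub>F D))
    = (any_rdist A B C \<boxplus>\<^sub>F any_rdist A B D) \<cdot>\<^sub>F any_ldist (A \<oplus>\<^sub>F B) C D"
    (is "?M = ?N")
proof (rule sum_joint_mono[of _ "W \<oplus>\<^sub>F Y" "X \<oplus>\<^sub>F Z"])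
  note defs = W_def X_def Y_def Z_def sum_ob_assoc pr_sum_assoc(3) pr_sum_assoc_reassoc pr_left_sum_reassoc
  show "any_pr1 (W \<oplus>\<^sub>F Y) (X \<oplus>\<^sub>F Z) \<cdot>\<^sub>F ?M = any_pr1 (W \<oplus>\<^sub>F Y) (X \<oplus>\<^sub>F Z) \<cdot>\<^sub>F ?N"
    by (rule sum_joint_mono[of _ W Y]) (simp_all add: defs)
  show "any_pr2 (W \<oplus>\<^sub>F Y) (X \<oplus>\<^sub>F Z) \<cdot>\<^sub>F ?M = any_pr2 (W \<oplus>\<^sub>F Y) (X \<oplus>\<^sub>F Z) \<cdot>\<^sub>F ?N"
    by (rule sum_joint_mono[of _ X Z]) (simp_all add: defs)
qed (simp_all add: W_def X_def Y_def Z_def sum_ob_assoc)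

theorem mainTheorem19:
  shows "tight_braided_bimonoidal_category any_hom any_comp any_id
    any_sum any_sum_mor any_zero any_sum_assoc any_sum_lunit any_sum_runit any_sum_sym
    any_prod any_prod_mor vacuum any_prod_assoc any_prod_lunit any_prod_runit
    any_lzero any_rzero any_ldist any_rdist any_prod_braid"
proof -
  interpret add: symmetric_monoidal_category any_hom any_comp any_id any_sum any_sum_mor any_zero
    any_sum_assoc any_sum_lunit any_sum_runit any_sum_sym
    by (rule any_sum_symmetric_monoidal)
  interpret mult: braided_monoidal_category any_hom any_comp any_id any_prod any_prod_mor vacuum
    any_prod_assoc any_prod_lunit any_prod_runit any_prod_braid
    by (rule any_prod_braided_monoidal)
  note [simp] = any_sum_assoc_def any_sum_lunit_def any_sum_runit_def any_prod_lunit_def any_prod_runit_def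
    assoc_natural assoc_natural_id braid_natural
  show ?thesis
  proof unfold_locales
    fix A A' B B' C C' D f g h assume "f \<in> any_hom A A'" "g \<in> any_hom B B'" "h \<in> any_hom C C'"
    then have [simp]: "any_dom f = A" "any_cod f = A'" "any_dom g = B" "any_cod g = B'" "any_dom h = C" "any_cod h = C'"
      by (simp_all add: any_hom_iff)
    show "any_ldist A' B' C' \<cdot>\<^sub>F (f \<boxtimes>\<^sub>F (g \<boxplus>\<^sub>F h)) = (f \<boxtimes>\<^sub>F g \<boxplus>\<^sub>F f \<boxtimes>\<^sub>F h) \<cdot>\<^sub>F any_ldist A B C"
      by (rule sum_joint_mono[of _ "A' \<otimes>\<^sub>F B'" "A' \<otimes>\<^sub>F C'"]) simp_all
    show "any_rdist A' B' C' \<cdot>\<^sub>F ((f \<boxplus>\<^sub>F g) \<boxtimes>\<^sub>F h) = (f \<boxtimes>\<^sub>F h \<boxplus>\<^sub>F g \<boxtimes>\<^sub>F h) \<cdot>\<^sub>F any_rdist A B C"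
      by (rule sum_joint_mono[of _ "A' \<otimes>\<^sub>F C'" "B' \<otimes>\<^sub>F C'"]) simp_all
  next
    fix A B C D :: anyon_ob
    show "any_ldist A C B \<cdot>\<^sub>F (any_id A \<boxtimes>\<^sub>F any_sum_sym B C) = any_sum_sym (A \<otimes>\<^sub>F B) (A \<otimes>\<^sub>F C) \<cdot>\<^sub>F any_ldist A B C"
      by (rule sum_joint_mono[of _ "A \<otimes>\<^sub>F C" "A \<otimes>\<^sub>F B"]) simp_all
    show "any_rdist B A C \<cdot>\<^sub>F (any_sum_sym A B \<boxtimes>\<^sub>F any_id C) = any_sum_sym (A \<otimes>\<^sub>F C) (B \<otimes>\<^sub>F C) \<cdot>\<^sub>F any_rdist A B C"
      by (rule sum_joint_mono[of _ "B \<otimes>\<^sub>F C" "A \<otimes>\<^sub>F C"]) simp_all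
    show "any_sum_assoc (A \<otimes>\<^sub>F D) (B \<otimes>\<^sub>F D) (C \<otimes>\<^sub>F D) \<cdot>\<^sub>F (any_rdist A B D \<boxplus>\<^sub>F any_id (C \<otimes>\<^sub>F D))
        \<cdot>\<^sub>F any_rdist (A \<oplus>\<^sub>F B) C D
      = (any_id (A \<otimes>\<^sub>F D) \<boxplus>\<^sub>F any_rdist B C D) \<cdot>\<^sub>F any_rdist A (B \<oplus>\<^sub>F C) D
        \<cdot>\<^sub>F (any_sum_assoc A B C \<boxtimes>\<^sub>F any_id D)"
      by (rule sum_joint_mono3[of _ "A \<otimes>\<^sub>F D" "B \<otimes>\<^sub>F D" "C \<otimes>\<^sub>F D"])
        (simp_all add: sum_ob_assoc pr_left_sum_reassoc pr_sum_assoc)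
    show "any_sum_assoc (A \<otimes>\<^sub>F B) (A \<otimes>\<^sub>F C) (A \<otimes>\<^sub>F D) \<cdot>\<^sub>F (any_ldist A B C \<boxplus>\<^sub>F any_id (A \<otimes>\<^sub>F D))
        \<cdot>\<^sub>F any_ldist A (B \<oplus>\<^sub>F C) D
      = (any_id (A \<otimes>\<^sub>F B) \<boxplus>\<^sub>F any_ldist A C D) \<cdot>\<^sub>F any_ldist A B (C \<oplus>\<^sub>F D)
        \<cdot>\<^sub>F (any_id A \<boxtimes>\<^sub>F any_sum_assoc B C D)"
      by (rule sum_joint_mono3[of _ "A \<otimes>\<^sub>F B" "A \<otimes>\<^sub>F C" "A \<otimes>\<^sub>F D"])
        (simp_all add: sum_ob_assoc pr_left_sum_reassoc pr_sum_assoc)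
    show "any_ldist A (B \<otimes>\<^sub>F C) (B \<otimes>\<^sub>F D) \<cdot>\<^sub>F (any_id A \<boxtimes>\<^sub>F any_ldist B C D) \<cdot>\<^sub>F any_prod_assoc A B (C \<oplus>\<^sub>F D)
      = (any_prod_assoc A B C \<boxplus>\<^sub>F any_prod_assoc A B D) \<cdot>\<^sub>F any_ldist (A \<otimes>\<^sub>F B) C D"
      by (rule sum_joint_mono[of _ "A \<otimes>\<^sub>F (B \<otimes>\<^sub>F C)" "A \<otimes>\<^sub>F (B \<otimes>\<^sub>F D)"]) simp_all
    show "(any_prod_assoc A C D \<boxplus>\<^sub>F any_prod_assoc B C D) \<cdot>\<^sub>F any_rdist (A \<otimes>\<^sub>F C) (B \<otimes>\<^sub>F C) D
        \<cdot>\<^sub>F (any_rdist A B C \<boxtimes>\<^sub>F any_id D)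
      = any_rdist A B (C \<otimes>\<^sub>F D) \<cdot>\<^sub>F any_prod_assoc (A \<oplus>\<^sub>F B) C D"
      by (rule sum_joint_mono[of _ "A \<otimes>\<^sub>F (C \<otimes>\<^sub>F D)" "B \<otimes>\<^sub>F (C \<otimes>\<^sub>F D)"]) simp_all
    show "(any_prod_assoc A B D \<boxplus>\<^sub>F any_prod_assoc A C D) \<cdot>\<^sub>F any_rdist (A \<otimes>\<^sub>F B) (A \<otimes>\<^sub>F C) D
        \<cdot>\<^sub>F (any_ldist A B C \<boxtimes>\<^sub>F any_id D)
      = any_ldist A (B \<otimes>\<^sub>F D) (C \<otimes>\<^sub>F D) \<cdot>\<^sub>F (any_id A \<boxtimes>\<^sub>F any_rdist B C D) \<cdot>\<^sub>F any_prod_assoc A (B \<oplus>\<^sub>F C) D"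
      by (rule sum_joint_mono[of _ "A \<otimes>\<^sub>F (B \<otimes>\<^sub>F D)" "A \<otimes>\<^sub>F (C \<otimes>\<^sub>F D)"]) simp_all
    show "any_ldist C A B \<cdot>\<^sub>F any_prod_braid (A \<oplus>\<^sub>F B) C
      = (any_prod_braid A C \<boxplus>\<^sub>F any_prod_braid B C) \<cdot>\<^sub>F any_rdist A B C"
      by (rule sum_joint_mono[of _ "C \<otimes>\<^sub>F A" "C \<otimes>\<^sub>F B"]) simp_all
    show "any_rdist B C A \<cdot>\<^sub>F any_prod_braid A (B \<oplus>\<^sub>F C)
      = (any_prod_braid A B \<boxplus>\<^sub>F any_prod_braid A C) \<cdot>\<^sub>F any_ldist A B C"
      by (rule sum_joint_mono[of _ "B \<otimes>\<^sub>F A" "C \<otimes>\<^sub>F A"]) simp_all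
    show "(any_prod_lunit A \<boxplus>\<^sub>F any_prod_lunit B) \<cdot>\<^sub>F any_ldist vacuum A B = any_prod_lunit (A \<oplus>\<^sub>F B)"
      by (rule sum_joint_mono[of _ A B]) (use pr_dist(1,2)[of vacuum A B] in simp_all)
    show "(any_prod_runit A \<boxplus>\<^sub>F any_prod_runit B) \<cdot>\<^sub>F any_rdist A B vacuum = any_prod_runit (A \<oplus>\<^sub>F B)"
      by (rule sum_joint_mono[of _ A B]) (use pr_dist(3,4)[of A vacuum B] in simp_all)
  next
    fix W X Y Z A B C D :: anyon_ob
    assume WXYZ: "W = A \<otimes>\<^sub>F C" "X = A \<otimes>\<^sub>F D" "Y = B \<otimes>\<^sub>F C" "Z = B \<otimes>\<^sub>F D"
    show "cat.inverse_of ((W \<oplus>\<^sub>F Y) \<oplus>\<^sub>F (X \<oplus>\<^sub>F Z)) (W \<oplus>\<^sub>F (Y \<oplus>\<^sub>F (X \<oplus>\<^sub>F Z))) (any_sum_assoc W Y (X \<oplus>\<^sub>F Z))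
        \<cdot>\<^sub>F (any_id W \<boxplus>\<^sub>F any_sum_assoc Y X Z)
        \<cdot>\<^sub>F (any_id W \<boxplus>\<^sub>F (any_sum_sym X Y \<boxplus>\<^sub>F any_id Z))
        \<cdot>\<^sub>F (any_id W \<boxplus>\<^sub>F cat.inverse_of ((X \<oplus>\<^sub>F Y) \<oplus>\<^sub>F Z) (X \<oplus>\<^sub>F (Y \<oplus>\<^sub>F Z)) (any_sum_assoc X Y Z))
        \<cdot>\<^sub>F any_sum_assoc W X (Y \<oplus>\<^sub>F Z)
        \<cdot>\<^sub>F (any_ldist A C D \<boxplus>\<^sub>F any_ldist B C D) \<cdot>\<^sub>F any_rdist A B (C \<oplus>\<^sub>F D)
      = (any_rdist A B C \<boxplus>\<^sub>F any_rdist A B D) \<cdot>\<^sub>F any_ldist (A \<oplus>\<^sub>F B) C D"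
      using dist_exchange[of A C D B] by (simp add: WXYZ inverse_of_id sum_ob_assoc)
  next
    fix A B :: anyon_ob
    show "any_sum_lunit (A \<otimes>\<^sub>F B) \<cdot>\<^sub>F (any_rzero A \<boxplus>\<^sub>F any_id (A \<otimes>\<^sub>F B)) \<cdot>\<^sub>F any_ldist A any_zero B
      = any_id A \<boxtimes>\<^sub>F any_sum_lunit B"
      using pr_dist(2)[of A any_zero B] by simp
    show "any_sum_lunit (B \<otimes>\<^sub>F A) \<cdot>\<^sub>F (any_lzero A \<boxplus>\<^sub>F any_id (B \<otimes>\<^sub>F A)) \<cdot>\<^sub>F any_rdist any_zero B A
      = any_sum_lunit B \<boxtimes>\<^sub>F any_id A"
      using pr_dist(4)[of any_zero A B] by simp
    show "any_sum_runit (A \<otimes>\<^sub>F B) \<cdot>\<^sub>F (any_id (A \<otimes>\<^sub>F B) \<boxplus>\<^sub>F any_rzero A) \<cdot>\<^sub>F any_ldist A B any_zero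
      = any_id A \<boxtimes>\<^sub>F any_sum_runit B"
      using pr_dist(1)[of A B any_zero] by simp
    show "any_sum_runit (A \<otimes>\<^sub>F B) \<cdot>\<^sub>F (any_id (A \<otimes>\<^sub>F B) \<boxplus>\<^sub>F any_lzero B) \<cdot>\<^sub>F any_rdist A any_zero B
      = any_sum_runit A \<boxtimes>\<^sub>F any_id B"
      using pr_dist(3)[of A B any_zero] by simp
  qed (auto simp: any_hom_iff ldist_is_iso rdist_is_iso is_iso_mono id_zero_prod_mor
      intro!: is_isoI[OF id_inverse] intro: any_into_zero)
qed

end
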